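(* Let $m,n\in\mathbb{N}$ and let $\psi:\mathbb{F}[X]^m\to\{k^r:r\in\mathbb{Z}\}\cup\{0\}$ be bounded, with $\psi(\mathbf{q})>0$ for infinitely many $\mathbf{q}$. Then $$\dim_H\mathcal{W}(m,n;\psi)=n(m-1)+\min\{\eta(\psi),n\}.$$
   Context: $\mathbb{F}$ is a finite field with $k$ elements; $\mathbb{F}((X^{-1}))$ is the field of formal Laurent series in $X^{-1}$ over $\mathbb{F}$ with absolute value $|f|=k^{\deg f}$ ($|0|=0$), where the degree of a nonzero Laurent series is the largest exponent of $X$ with nonzero coefficient. On vectors, $|\mathbf{x}|_\infty=\max_i|x_i|$; matrices in $\mathrm{Mat}_{m\times n}(\mathbb{F}((X^{-1})))$ are identified with vectors in $\mathbb{F}((X^{-1}))^{mn}$. For $\mathbf{v}\in\mathbb{F}((X^{-1}))^n$, $\|\mathbf{v}\|$ is the $|\cdot|_\infty$-distance from $\mathbf{v}$ to $\mathbb{F}[X]^n$. $$\mathcal{W}(m,n;\psi)=\{A\in\mathrm{Mat}_{m\times n}(\mathbb{F}((X^{-1}))):\|\mathbf{q}A\|<\psi(\mathbf{q})\text{ for infinitely many }\mathbf{q}\in\mathbb{F}[X]^m\}.$$ $\eta(\psi)=\inf\{\eta\in\mathbb{R}:\sum_{\mathbf{q}\in\mathbb{F}[X]^m\setminus\{0\}}|\mathbf{q}|_\infty^n(\psi(\mathbf{q})/|\mathbf{q}|_\infty)^\eta<\infty\}$. $\dim_H$ is Hausdorff dimension (with respect to the metric from $|\cdot|_\infty$). 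*)

theory Defs
  imports "HOL-Analysis.Analysis" "HOL-Computational_Algebra.Polynomial"
          "HOL-Computational_Algebra.Formal_Laurent_Series"
begin

text \<open>Encoding: an element  f = sum_j c_j X^(-j)  (c_j = 0 for j << 0) of F((X^-1)) is
  represented by the formal Laurent series  g = sum_j c_j T^j  in T = X^-1, i.e. by
  an element of 'a fls with fls_nth g j = c_j.  The substitution X^-1 |-> T is a field
  isomorphism F((X^-1)) -> F((T)).  Under it deg f = - fls_subdegree g.\<close>

definition poly_to_lx :: "'a::zero poly \<Rightarrow> 'a fls" where
  "poly_to_lx p = Abs_fls (\<lambda>j. if j \<le> 0 then coeff p (nat (- j)) else 0)"

definition lx_abs :: "'a::{zero,finite} fls \<Rightarrow> real" where
  "lx_abs f = (if f = 0 then 0 else real CARD('a) powr (- real_of_int (fls_subdegree f)))"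

definition poly_abs :: "'a::{zero,finite} poly \<Rightarrow> real" where
  "poly_abs p = (if p = 0 then 0 else real CARD('a) ^ degree p)"

definition vec_lx_abs :: "'a::{zero,finite} fls ^ 'n \<Rightarrow> real" where
  "vec_lx_abs v = Max (range (\<lambda>j. lx_abs (v $ j)))"

definition mat_lx_abs :: "'a::{zero,finite} fls ^ 'n ^ 'm \<Rightarrow> real" where
  "mat_lx_abs A = Max (range (\<lambda>(i, j). lx_abs (A $ i $ j)))"

definition vec_poly_abs :: "'a::{zero,finite} poly ^ 'm \<Rightarrow> real" where
  "vec_poly_abs q = Max (range (\<lambda>i. poly_abs (q $ i)))"

definition dist_polys :: "'a::{ab_group_add,finite} fls ^ 'n \<Rightarrow> real" where
  "dist_polys v = Inf {vec_lx_abs (v - (\<chi> j. poly_to_lx (P $ j))) | P :: 'a poly ^ 'n. True}"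

definition vecmat_lx :: "'a::{comm_ring_1} poly ^ 'm \<Rightarrow> 'a fls ^ 'n ^ 'm \<Rightarrow> 'a fls ^ 'n" where
  "vecmat_lx q A = (\<chi> j. \<Sum>i\<in>UNIV. poly_to_lx (q $ i) * A $ i $ j)"

definition W_set :: "('a::{field,finite} poly ^ 'm \<Rightarrow> real) \<Rightarrow> ('a fls ^ 'n ^ 'm) set" where
  "W_set \<psi> = {A. infinite {q. dist_polys (vecmat_lx q A) < \<psi> q}}"

text \<open>eta(psi); the terms are nonnegative, so summability = finiteness of the sum.
  Convention 0 powr eta = 0 (terms with psi q = 0 contribute nothing).\<close>
definition eta_psi :: "('a::{field,finite} poly ^ 'm \<Rightarrow> real) \<Rightarrow> nat \<Rightarrow> real" where
  "eta_psi \<psi> n = Inf {\<eta>::real. (\<lambda>q. vec_poly_abs q ^ n * (\<psi> q / vec_poly_abs q) powr \<eta>)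
                           summable_on (UNIV - {0})}"

definition diam_d :: "('b \<Rightarrow> 'b \<Rightarrow> real) \<Rightarrow> 'b set \<Rightarrow> ennreal" where
  "diam_d d U = (SUP x\<in>U. SUP y\<in>U. ennreal (d x y))"

definition hausdorff_pre :: "('b \<Rightarrow> 'b \<Rightarrow> real) \<Rightarrow> real \<Rightarrow> real \<Rightarrow> 'b set \<Rightarrow> ennreal" where
  "hausdorff_pre d s \<delta> S =
     (INF C\<in>{C :: nat \<Rightarrow> 'b set. S \<subseteq> (\<Union>i. C i) \<and> (\<forall>i. diam_d d (C i) \<le> ennreal \<delta>)}.
        (\<Sum>i. ennreal (enn2real (diam_d d (C i)) powr s)))"

definition hausdorff_measure :: "('b \<Rightarrow> 'b \<Rightarrow> real) \<Rightarrow> real \<Rightarrow> 'b set \<Rightarrow> ennreal" where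
  "hausdorff_measure d s S = (SUP \<delta>\<in>{0<..}. hausdorff_pre d s \<delta> S)"

definition hausdorff_dim :: "('b \<Rightarrow> 'b \<Rightarrow> real) \<Rightarrow> 'b set \<Rightarrow> ereal" where
  "hausdorff_dim d S = Inf (ereal ` {s. 0 < s \<and> hausdorff_measure d s S = 0})"

definition mat_dist :: "'a::{ab_group_add,finite} fls ^ 'n ^ 'm \<Rightarrow> 'a fls ^ 'n ^ 'm \<Rightarrow> real" where
  "mat_dist A B = mat_lx_abs (A - B)"

end

theory Submission
  imports Defs "HOL-Library.Sublist" "HOL-Computational_Algebra.Polynomial_Factorial"
begin

text \<open>After translation by polynomials one works in the unit ball, whose points are sequences of digits.
  The upper bound is the natural covering of $\{A : \|qA\| < \psi(q)\}$ by $|q|^n (|q|/\psi(q))^{n(m-1)}$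
  balls of radius $\psi(q)/|q|$.

  For the lower bound, average the uniform measures on the sets $\|qA\| < k^{-r}$ over a set $Q$ of vectors
  of equal degree $d$ with $\psi(q) = k^{-r}$. Such a measure is uniform down to scale $k^{-d}$, and below
  that scale its $s$-energy is controlled by the pair correlations. By duality these are governed by the
  solutions of $aq + bq' = 0$ with $a, b$ of small degree; only proportional pairs matter, and the divisor
  bound shows that there are few of them. Divergence of the defining series of $\eta(\psi)$ provides
  arbitrarily large $d$ with $Q$ so large that the energy is small. Given a cover by balls with small
  $s$-mass, one then descends through such measures to a point of the limsup set outside the cover.\<close>

section \<open>Trees of cylinders and covers\<close>

text \<open>Since \<open>\<psi>\<close> is neither monotone nor confined to primitive vectors, many
  members of \<open>Q\<close> may be multiples of a common vector. Their neighbourhoods then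
  overlap, and the averaged measure need not satisfy a Frostman bound at every node; only its second
  moment is under control. The inequality
  \<open>\<nu> \<le> L * w / 2 + \<nu>\<^sup>2 / (2 * (L * w))\<close> turns that moment into a
  Frostman bound with an error, and the errors summed over nodes are the energy. No measure on the
  limsup set is constructed. The cover is fixed beforehand, and each stage uses masses at finitely
  many depths. A stage can start at any node because the next measure is uniform down to a depth
  beyond that node; this is why small energy is required for arbitrarily large \<open>d\<close>. The
  minimum with \<open>n\<close> has its origin in the geometric sum in the energy, whose ratio is
  \<open>k powr (n - \<theta>)\<close> with codimension \<open>\<theta> = m * n - s\<close>. For
  \<open>\<theta> > n\<close> it is bounded and one vector suffices; for \<open>\<theta> < n\<close>
  the deepest level dominates and the size of \<open>Q\<close> has to compensate.\<close>

text \<open>A list is a node of the tree of finite digit strings and stands for the ball of all points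
  having it as a prefix.\<close>

definition cover_mass :: "(nat \<Rightarrow> real) \<Rightarrow> (nat \<Rightarrow> 'v list) \<Rightarrow> 'v list \<Rightarrow> real" where
  "cover_mass w C Z = (\<Sum>i. if prefix Z (C i) then w (length (C i)) else 0)"

lemma finite_lists_length_le_UNIV: "finite {Y :: 'v::finite list. length Y \<le> r \<and> P Y}"
  by (rule finite_subset[OF _ finite_lists_length_le[of UNIV r]]) auto

lemma finite_lists_length_eq_UNIV: "finite {Y :: 'v::finite list. length Y = r \<and> P Y}"
  by (rule finite_subset[OF _ finite_lists_length_eq[of UNIV r]]) auto

context
  fixes w :: "nat \<Rightarrow> real" and C :: "nat \<Rightarrow> 'v::finite list"
  assumes w_pos: "\<And>t. w t > 0" and w_sum: "summable (\<lambda>i. w (length (C i)))"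
begin

lemma cover_mass_summable: "summable (\<lambda>i. if P i then w (length (C i)) else 0)"
  using w_pos by (intro summable_comparison_test'[OF w_sum, of 0]) (auto simp: less_imp_le)

lemma cover_mass_ge: "w (length (C i)) \<le> cover_mass w C (C i)"
proof -
  have "(\<Sum>j\<in>{i}. if prefix (C i) (C j) then w (length (C j)) else 0) \<le> cover_mass w C (C i)"
    unfolding cover_mass_def using w_pos
    by (intro sum_le_suminf cover_mass_summable) (auto simp: less_imp_le)
  thus ?thesis by simp
qed

lemma cover_mass_nonneg: "0 \<le> cover_mass w C Z"
  unfolding cover_mass_def using w_pos by (intro suminf_nonneg cover_mass_summable) (auto simp: less_imp_le)

text \<open>A covering node strictly below \<open>Z\<close> lies below exactly one child; only
  covering nodes equal to \<open>Z\<close> are lost.\<close>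

lemma cover_mass_superadditive: "(\<Sum>v\<in>UNIV. cover_mass w C (Z @ [v])) \<le> cover_mass w C Z"
proof -
  have "(\<Sum>v\<in>UNIV. cover_mass w C (Z @ [v])) =
        (\<Sum>i. \<Sum>v\<in>UNIV. if prefix (Z @ [v]) (C i) then w (length (C i)) else 0)"
    unfolding cover_mass_def by (rule suminf_sum[symmetric]) (rule cover_mass_summable)
  also have "\<dots> \<le> cover_mass w C Z"
    unfolding cover_mass_def
  proof (rule suminf_le[OF _ summable_sum cover_mass_summable])
    fix i
    show "(\<Sum>v\<in>UNIV. if prefix (Z @ [v]) (C i) then w (length (C i)) else 0)
        \<le> (if prefix Z (C i) then w (length (C i)) else 0)"
    proof (cases "\<exists>v. prefix (Z @ [v]) (C i)")
      case True
      then obtain v where v: "prefix (Z @ [v]) (C i)" by blast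
      then obtain zs where zs: "C i = Z @ v # zs" by (auto simp: prefix_def)
      have "\<And>u. prefix (Z @ [u]) (C i) \<longleftrightarrow> u = v" using zs by (auto simp: prefix_def)
      moreover have "prefix Z (C i)" using zs by (auto simp: prefix_def)
      ultimately show ?thesis by simp
    next
      case False
      thus ?thesis using w_pos by (auto simp: less_imp_le)
    qed
  qed (rule cover_mass_summable)
  finally show ?thesis .
qed

text \<open>Induction from the bottom. A covering node pays for its mass with its own weight,
  through \<open>bound\<close>. At depth \<open>\<rho>\<close> an uncovered node of positive mass is
  paid for by \<open>not_good\<close>, which supplies only \<open>w \<rho> / 2\<close>; hence the
  halved \<open>bound_last\<close>. The premise \<open>uncovered\<close> still allows
  \<open>Z\<close> itself to be a covering node. As \<open>not_good\<close> negates what the descent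
  looks for, the lemma serves inside a proof by contradiction.\<close>

lemma mass_le_cover_mass_plus_error:
  fixes \<nu> e :: "'v list \<Rightarrow> real"
  assumes e_nonneg: "\<And>Z. e Z \<ge> 0" and L: "L > 0"
    and additive: "\<And>Z. prefix B Z \<Longrightarrow> length Z < \<rho> \<Longrightarrow> \<nu> Z = (\<Sum>v\<in>UNIV. \<nu> (Z @ [v]))"
    and bound: "\<And>Z. prefix B Z \<Longrightarrow> length Z < \<rho> \<Longrightarrow> \<nu> Z \<le> L * w (length Z) + e Z"
    and bound_last: "\<And>Z. prefix B Z \<Longrightarrow> length Z = \<rho> \<Longrightarrow> \<nu> Z \<le> L * w \<rho> / 2 + e Z"
    and not_good: "\<And>Z. prefix B Z \<Longrightarrow> length Z = \<rho> \<Longrightarrow> \<nu> Z > 0 \<Longrightarrow>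
       (\<And>i. \<not> prefix (C i) Z) \<Longrightarrow> cover_mass w C Z \<ge> w \<rho> / 2"
    and Z: "prefix B Z" "length Z \<le> \<rho>" and uncovered: "\<And>i. C i \<noteq> Z \<Longrightarrow> \<not> prefix (C i) Z"
  shows "\<nu> Z \<le> L * cover_mass w C Z + (\<Sum>Y | length Y \<le> \<rho> \<and> prefix Z Y. e Y)"
  using Z uncovered
proof (induction "\<rho> - length Z" arbitrary: Z)
  case 0
  hence len: "length Z = \<rho>" by simp
  have "{Y. length Y \<le> \<rho> \<and> prefix Z Y} = {Z}"
    using len by (auto simp: prefix_def)
  hence err: "(\<Sum>Y | length Y \<le> \<rho> \<and> prefix Z Y. e Y) = e Z" by simp
  show ?case
  proof (cases "\<exists>i. C i = Z")
    case True
    hence "w \<rho> \<le> cover_mass w C Z" using cover_mass_ge len by metis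
    hence "w \<rho> / 2 \<le> cover_mass w C Z" using w_pos[of \<rho>] by linarith
    hence "L * w \<rho> / 2 \<le> L * cover_mass w C Z" using L by (simp flip: times_divide_eq_right)
    with bound_last[OF 0(2) len] show ?thesis by (simp add: err)
  next
    case False
    hence nc: "\<not> prefix (C i) Z" for i using 0(4) by metis
    show ?thesis
    proof (cases "\<nu> Z > 0")
      case True
      from not_good[OF 0(2) len True nc] have "L * (w \<rho> / 2) \<le> L * cover_mass w C Z"
        using L by simp
      with bound_last[OF 0(2) len] show ?thesis by (simp add: err)
    next
      case False
      have "L * cover_mass w C Z \<ge> 0" using L cover_mass_nonneg by simp
      with False e_nonneg[of Z] show ?thesis by (simp add: err)
    qed
  qed
next
  case (Suc n)
  hence len: "length Z < \<rho>" by simp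
  show ?case
  proof (cases "\<exists>i. C i = Z")
    case True
    hence "w (length Z) \<le> cover_mass w C Z" using cover_mass_ge by metis
    hence "L * w (length Z) \<le> L * cover_mass w C Z" using L by simp
    moreover have "e Z \<le> (\<Sum>Y | length Y \<le> \<rho> \<and> prefix Z Y. e Y)"
      using len e_nonneg finite_lists_length_le_UNIV by (intro member_le_sum) auto
    ultimately show ?thesis using bound[OF Suc(3) len] by linarith
  next
    case False
    hence nc: "\<not> prefix (C i) Z" for i using Suc(5) by metis
    have IH: "\<nu> (Z @ [v]) \<le> L * cover_mass w C (Z @ [v]) +
         (\<Sum>Y | length Y \<le> \<rho> \<and> prefix (Z @ [v]) Y. e Y)" for v
    proof (rule Suc(1))
      show "n = \<rho> - length (Z @ [v])" using Suc(2) by simp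
      show "prefix B (Z @ [v])" using Suc(3) by simp
      show "length (Z @ [v]) \<le> \<rho>" using len by simp
      show "\<not> prefix (C i) (Z @ [v])" if "C i \<noteq> Z @ [v]" for i
        using that nc by (simp add: prefix_snoc)
    qed
    have "\<nu> Z = (\<Sum>v\<in>UNIV. \<nu> (Z @ [v]))" using additive[OF Suc(3) len] .
    also have "\<dots> \<le> (\<Sum>v\<in>UNIV. L * cover_mass w C (Z @ [v]) +
         (\<Sum>Y | length Y \<le> \<rho> \<and> prefix (Z @ [v]) Y. e Y))"
      by (rule sum_mono) (rule IH)
    also have "\<dots> = L * (\<Sum>v\<in>UNIV. cover_mass w C (Z @ [v])) +
         (\<Sum>v\<in>UNIV. \<Sum>Y | length Y \<le> \<rho> \<and> prefix (Z @ [v]) Y. e Y)"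
      by (simp add: sum.distrib sum_distrib_left)
    also have "\<dots> \<le> L * cover_mass w C Z + (\<Sum>Y | length Y \<le> \<rho> \<and> prefix Z Y. e Y)"
    proof (rule add_mono)
      show "L * (\<Sum>v\<in>UNIV. cover_mass w C (Z @ [v])) \<le> L * cover_mass w C Z"
        using L cover_mass_superadditive by simp
      have "(\<Sum>v\<in>UNIV. \<Sum>Y | length Y \<le> \<rho> \<and> prefix (Z @ [v]) Y. e Y)
          = sum e (\<Union>v\<in>UNIV. {Y. length Y \<le> \<rho> \<and> prefix (Z @ [v]) Y})"
        by (rule sum.UNION_disjoint[symmetric]) (auto simp: finite_lists_length_le_UNIV prefix_def)
      also have "\<dots> \<le> (\<Sum>Y | length Y \<le> \<rho> \<and> prefix Z Y. e Y)"
        by (rule sum_mono2) (auto simp: finite_lists_length_le_UNIV prefix_def e_nonneg)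
      finally show "(\<Sum>v\<in>UNIV. \<Sum>Y | length Y \<le> \<rho> \<and> prefix (Z @ [v]) Y. e Y)
           \<le> (\<Sum>Y | length Y \<le> \<rho> \<and> prefix Z Y. e Y)" .
    qed
    finally show ?thesis .
  qed
qed

text \<open>The descent keeps the mass of the covering nodes below the current node under half the weight
  of that node; a covering node itself would already contribute the full weight.\<close>
lemma exists_point_avoiding_cover:
  fixes Ev :: "nat \<Rightarrow> 'v list \<Rightarrow> bool"
  assumes total: "(\<Sum>i. w (length (C i))) < w 0 / 2"
    and stage: "\<And>B D. \<exists>\<rho> \<nu> e L. length B < \<rho> \<and> L > 0 \<and> (\<forall>Z. e Z \<ge> (0::real)) \<and>
      (\<forall>Z. prefix B Z \<longrightarrow> length Z < \<rho> \<longrightarrow> \<nu> Z = (\<Sum>v\<in>UNIV. \<nu> (Z @ [v]))) \<and>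
      (\<forall>Z. prefix B Z \<longrightarrow> length Z < \<rho> \<longrightarrow> \<nu> Z \<le> L * w (length Z) + e Z) \<and>
      (\<forall>Z. prefix B Z \<longrightarrow> length Z = \<rho> \<longrightarrow> \<nu> Z \<le> L * w \<rho> / 2 + e Z) \<and>
      \<nu> B = 1 \<and> L * w (length B) \<le> 1 \<and> (\<Sum>Y | length Y \<le> \<rho> \<and> prefix B Y. e Y) \<le> 1 / 2 \<and>
      (\<forall>Z. prefix B Z \<longrightarrow> length Z = \<rho> \<longrightarrow> \<nu> Z > 0 \<longrightarrow> Ev D Z)"
  shows "\<exists>x. (\<forall>i. map x [0..<length (C i)] \<noteq> C i) \<and> (\<forall>D. \<exists>t. Ev D (map x [0..<t]))"
proof -
  define P where "P = (\<lambda>(n::nat) Z. cover_mass w C Z < w (length Z) / 2 \<and>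
     (\<forall>i. \<not> prefix (C i) Z))"
  have step: "\<exists>Z. P (Suc n) Z \<and> strict_prefix B Z \<and> Ev n Z" if PB: "P n B" for n B
  proof -
    from stage[of B n] show ?thesis
    proof (elim exE conjE, goal_cases)
      case (1 \<rho> \<nu> e L)
    have "\<exists>Z. prefix B Z \<and> length Z = \<rho> \<and> \<nu> Z > 0 \<and> (\<forall>i. \<not> prefix (C i) Z) \<and>
        cover_mass w C Z < w \<rho> / 2"
    proof (rule ccontr)
      assume neg: "\<not> ?thesis"
      \<comment> \<open>The contradiction is \<open>1 = \<nu> B \<le> L * cover_mass w C B + 1 / 2 <
        L * w (length B) / 2 + 1 / 2 \<le> 1\<close>.\<close>
      have "\<nu> B \<le> L * cover_mass w C B + (\<Sum>Y | length Y \<le> \<rho> \<and> prefix B Y. e Y)"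
      proof (rule mass_le_cover_mass_plus_error[of e L B \<rho> \<nu>, OF 1(3)[rule_format] 1(2) 1(4)[rule_format] 1(5)[rule_format] 1(6)[rule_format]])
        show "w \<rho> / 2 \<le> cover_mass w C Z"
          if "prefix B Z" "length Z = \<rho>" "0 < \<nu> Z" "\<And>i. \<not> prefix (C i) Z" for Z
        proof (rule ccontr)
          assume "\<not> ?thesis"
          hence "cover_mass w C Z < w \<rho> / 2" by simp
          with that neg show False by blast
        qed
        show "\<not> prefix (C i) B" for i using PB by (simp add: P_def)
      qed (use 1(1) in auto)
      also have "L * cover_mass w C B < L * (w (length B) / 2)"
        using PB 1(2) by (simp add: P_def)
      hence "L * cover_mass w C B + (\<Sum>Y | length Y \<le> \<rho> \<and> prefix B Y. e Y) < 1"
        using 1(8) 1(9) by (simp add: field_simps)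
      finally show False using 1(7) by simp
    qed
    then obtain Z where Z: "prefix B Z" "length Z = \<rho>" "\<nu> Z > 0" "\<forall>i. \<not> prefix (C i) Z"
        "cover_mass w C Z < w \<rho> / 2" by blast
    have "strict_prefix B Z" using Z 1(1) by (auto simp: strict_prefix_def)
    with Z 1(10) show ?thesis unfolding P_def by blast
    qed
  qed
  have "P 0 []"
  proof -
    have "cover_mass w C [] < w 0 / 2" using total by (simp add: cover_mass_def)
    moreover have "\<not> prefix (C i) []" for i
    proof
      assume "prefix (C i) []"
      hence "C i = []" by simp
      hence "w 0 \<le> cover_mass w C []" using cover_mass_ge[of i] by simp
      thus False using calculation w_pos[of 0] by simp
    qed
    ultimately show ?thesis by (simp add: P_def)
  qed
  then obtain B where B: "\<And>n. P n (B n)" "\<And>n. strict_prefix (B n) (B (Suc n))"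
      "\<And>n. Ev n (B (Suc n))"
    using dependent_nat_choice[of P "\<lambda>n B Z. strict_prefix B Z \<and> Ev n Z"] step by metis
  have len: "length (B n) \<ge> n" for n
  proof (induction n)
    case (Suc n)
    have "length (B n) < length (B (Suc n))" using B(2) by (rule prefix_length_less)
    with Suc show ?case by simp
  qed simp
  have mono: "prefix (B n) (B m)" if "n \<le> m" for n m
    using that
  proof (induction m rule: dec_induct)
    case (step m)
    thus ?case using B(2)[of m] by (auto simp: strict_prefix_def)
  qed simp
  \<comment> \<open>\<open>B n\<close> has length at least \<open>n\<close>, so
    \<open>B (Suc l)\<close> does have an entry at position \<open>l\<close>.\<close>
  define x where "x l = B (Suc l) ! l" for l
  have x: "map x [0..<length (B n)] = B n" for n
  proof (rule nth_equalityI)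
    fix l assume "l < length (map x [0..<length (B n)])"
    hence l: "l < length (B n)" by simp
    have l': "l < length (B (Suc l))" using len[of "Suc l"] by simp
    have "B (Suc l) ! l = B n ! l"
    proof (cases "Suc l \<le> n")
      case True
      from mono[OF this] l' show ?thesis by (auto simp: prefix_def nth_append)
    next
      case False
      hence "n \<le> Suc l" by simp
      from mono[OF this] l show ?thesis by (auto simp: prefix_def nth_append)
    qed
    thus "map x [0..<length (B n)] ! l = B n ! l" using l by (simp add: x_def)
  qed simp
  have "map x [0..<length (C i)] \<noteq> C i" for i
  proof
    assume *: "map x [0..<length (C i)] = C i"
    have "length (C i) \<le> length (B (length (C i)))" by (rule len)
    hence "[0..<length (B (length (C i)))] = [0..<length (C i)] @ [length (C i)..<length (B (length (C i)))]"
      by (metis le_add_diff_inverse upt_add_eq_append zero_le)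
    hence "B (length (C i)) = C i @ map x [length (C i)..<length (B (length (C i)))]"
      using x[of "length (C i)"] * by (metis map_append)
    hence "prefix (C i) (B (length (C i)))" by (metis prefixI)
    thus False using B(1) by (simp add: P_def)
  qed
  moreover have "Ev D (map x [0..<length (B (Suc D))])" for D using B(3) x by simp
  ultimately show ?thesis by blast
qed

end

section \<open>Kernels of linear relations between polynomial vectors\<close>

lemma card_field_ge_2: "CARD('a::{zero_neq_one,finite}) \<ge> 2"
  using card_mono[of UNIV "{0::'a, 1}"] by simp

text \<open>A shift permutes \<open>V\<close> and carries the zero fibre onto the fibre over
  \<open>c\<close>, so all fibres have the same size. Shifts are arbitrary bijections because
  \<open>V\<close> is also taken to be a set of lists.\<close>

lemma card_zero_fibre:
  fixes f :: "'b \<Rightarrow> 'a::{ab_group_add,finite}"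
  assumes fin: "finite V"
    and shift: "\<And>c. \<exists>g. bij_betw g V V \<and> (\<forall>y\<in>V. f (g y) = f y + c)"
  shows "CARD('a) * card {y\<in>V. f y = 0} = card V"
proof -
  have eq: "card {y\<in>V. f y = c} = card {y\<in>V. f y = 0}" for c
  proof -
    obtain g where g: "bij_betw g V V" "\<forall>y\<in>V. f (g y) = f y + c" using shift by blast
    have "bij_betw g {y\<in>V. f y = 0} {y\<in>V. f y = c}"
      unfolding bij_betw_def
    proof
      show "inj_on g {y \<in> V. f y = 0}"
        using g(1) by (auto simp: bij_betw_def intro: inj_on_subset)
      show "g ` {y \<in> V. f y = 0} = {y \<in> V. f y = c}"
      proof
        show "g ` {y \<in> V. f y = 0} \<subseteq> {y \<in> V. f y = c}"
          using g(2) bij_betw_apply[OF g(1)] by auto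
        show "{y \<in> V. f y = c} \<subseteq> g ` {y \<in> V. f y = 0}"
        proof
          fix z assume z: "z \<in> {y \<in> V. f y = c}"
          hence "z \<in> g ` V" using bij_betw_imp_surj_on[OF g(1)] by simp
          then obtain y where y: "y \<in> V" "z = g y" by blast
          have "f (g y) = f y + c" using g(2) y(1) by blast
          moreover have "f (g y) = c" using z y(2) by simp
          ultimately have "f y = 0" by simp
          with y show "z \<in> g ` {y \<in> V. f y = 0}" by blast
        qed
      qed
    qed
    from bij_betw_same_card[OF this] show ?thesis by simp
  qed
  have "card V = card (\<Union>c\<in>UNIV. {y\<in>V. f y = c})" by (rule arg_cong[where f=card]) auto
  also have "\<dots> = (\<Sum>c\<in>UNIV. card {y\<in>V. f y = c})"
    using fin by (intro card_UN_disjoint) auto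
  also have "\<dots> = CARD('a) * card {y\<in>V. f y = 0}" by (subst eq) simp
  finally show ?thesis by simp
qed

text \<open>Row rank equals column rank, in counting form: both sides result from counting the pairs
  with \<^term>\<open>\<beta> y w = 0\<close>.\<close>
lemma card_left_right_kernel:
  fixes \<beta> :: "'b \<Rightarrow> 'c \<Rightarrow> 'a::{field,finite}"
  assumes fin: "finite V" "finite W"
    and l: "\<And>y. y \<in> V \<Longrightarrow> (\<exists>w\<in>W. \<beta> y w \<noteq> 0) \<Longrightarrow> CARD('a) * card {w\<in>W. \<beta> y w = 0} = card W"
    and r: "\<And>w. w \<in> W \<Longrightarrow> (\<exists>y\<in>V. \<beta> y w \<noteq> 0) \<Longrightarrow> CARD('a) * card {y\<in>V. \<beta> y w = 0} = card V"
  shows "card W * card {y\<in>V. \<forall>w\<in>W. \<beta> y w = 0} = card V * card {w\<in>W. \<forall>y\<in>V. \<beta> y w = 0}"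
proof -
  let ?A = "{y\<in>V. \<forall>w\<in>W. \<beta> y w = 0}" and ?B = "{w\<in>W. \<forall>y\<in>V. \<beta> y w = 0}" and ?k = "CARD('a)"
  \<comment> \<open>Zeros are counted row by row: a row in the kernel contributes
    \<open>card Y\<close>, any other row the fraction \<open>1 / ?k\<close> of it. The identity is
    cleared of division and subtraction to live in the natural numbers.\<close>
  have *: "?k * card {p \<in> X \<times> Y. \<gamma> (fst p) (snd p) = 0} + card {y\<in>X. \<forall>w\<in>Y. \<gamma> y w = 0} * card Y
      = card X * card Y + ?k * (card {y\<in>X. \<forall>w\<in>Y. \<gamma> y w = 0} * card Y)"
    if fin: "finite X" "finite Y"
    and l: "\<And>y. y \<in> X \<Longrightarrow> (\<exists>w\<in>Y. \<gamma> y w \<noteq> 0) \<Longrightarrow> ?k * card {w\<in>Y. \<gamma> y w = 0} = card Y"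
    for X :: "'x set" and Y :: "'y set" and \<gamma> :: "'x \<Rightarrow> 'y \<Rightarrow> 'a"
  proof -
    let ?A = "{y\<in>X. \<forall>w\<in>Y. \<gamma> y w = 0}"
    have "card {p \<in> X \<times> Y. \<gamma> (fst p) (snd p) = 0} = card (SIGMA y:X. {w\<in>Y. \<gamma> y w = 0})"
      by (rule arg_cong[where f=card]) auto
    also have "\<dots> = (\<Sum>y\<in>X. card {w\<in>Y. \<gamma> y w = 0})" using fin by (intro card_SigmaI) auto
    finally have "?k * card {p \<in> X \<times> Y. \<gamma> (fst p) (snd p) = 0} = (\<Sum>y\<in>X. ?k * card {w\<in>Y. \<gamma> y w = 0})"
      by (simp add: sum_distrib_left)
    also have "\<dots> = (\<Sum>y\<in>?A. ?k * card {w\<in>Y. \<gamma> y w = 0}) + (\<Sum>y\<in>X-?A. ?k * card {w\<in>Y. \<gamma> y w = 0})"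
      using fin by (subst sum.subset_diff[of ?A]) auto
    also have "(\<Sum>y\<in>?A. ?k * card {w\<in>Y. \<gamma> y w = 0}) = (\<Sum>y\<in>?A. ?k * card Y)"
    proof (rule sum.cong)
      fix y assume "y \<in> ?A"
      hence "{w\<in>Y. \<gamma> y w = 0} = Y" by auto
      thus "?k * card {w\<in>Y. \<gamma> y w = 0} = ?k * card Y" by simp
    qed simp
    also have "(\<Sum>y\<in>X-?A. ?k * card {w\<in>Y. \<gamma> y w = 0}) = (\<Sum>y\<in>X-?A. card Y)"
      by (rule sum.cong) (use l in auto)
    also have "\<dots> = card (X - ?A) * card Y" by simp
    finally have 1: "?k * card {p \<in> X \<times> Y. \<gamma> (fst p) (snd p) = 0} =
        card ?A * (?k * card Y) + card (X - ?A) * card Y" by simp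
    have "card X = card ?A + card (X - ?A)"
      using fin by (metis (no_types, lifting) card_Diff_subset card_mono finite_subset le_add_diff_inverse mem_Collect_eq subsetI)
    thus ?thesis unfolding 1 by (simp add: algebra_simps)
  qed
  have "card {p \<in> V \<times> W. \<beta> (fst p) (snd p) = 0} = card {p \<in> W \<times> V. \<beta> (snd p) (fst p) = 0}"
    by (rule bij_betw_same_card[of prod.swap]) (auto simp: bij_betw_def inj_on_def image_iff)
  with *[of V W \<beta>, OF fin l] *[of W V "\<lambda>w y. \<beta> y w", OF fin(2,1) r]
  have "?k * (card ?A * card W) + card ?B * card V = ?k * (card ?B * card V) + card ?A * card W"
    by (simp add: algebra_simps)
  \<comment> \<open>Equating the two counts leaves the nonzero factor \<open>?k - 1\<close> to
    cancel.\<close>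
  hence "(int ?k - 1) * (int (card W * card ?A) - int (card V * card ?B)) = 0"
    by (simp add: algebra_simps flip: of_nat_mult of_nat_add)
  moreover have "?k > 1" using card_field_ge_2[where 'a='a] by linarith
  ultimately show ?thesis by (metis (no_types, lifting) eq_iff_diff_eq_0 mult_eq_0_iff of_nat_1 of_nat_eq_iff less_irrefl)
qed

text \<open>Written through coefficients so that \<open>u = 0\<close> gives the zero polynomial
  alone; the condition \<open>degree p < u\<close> would give the empty set there.\<close>

definition polys_below :: "nat \<Rightarrow> 'a::zero poly set" where
  "polys_below u = {p. \<forall>l\<ge>u. coeff p l = 0}"

lemma polys_below_iff: "p \<in> polys_below (Suc e) \<longleftrightarrow> degree p \<le> e"
  unfolding polys_below_def using le_degree coeff_eq_0 by (fastforce simp: not_less_eq_eq intro: degree_le)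

lemma polys_below_closed:
  "0 \<in> polys_below u" "a \<in> polys_below u \<Longrightarrow> b \<in> polys_below u \<Longrightarrow> a + b \<in> polys_below u"
  "a \<in> polys_below u \<Longrightarrow> b \<in> polys_below u \<Longrightarrow> a - b \<in> polys_below u"
  "a \<in> polys_below u \<Longrightarrow> smult c a \<in> polys_below u" for a b :: "'a::comm_ring poly"
  by (auto simp: polys_below_def)

lemma card_polys_below:
  "finite (polys_below u :: 'a::{comm_ring,finite} poly set)" "card (polys_below u :: 'a poly set) = CARD('a) ^ u"
proof -
  have "bij_betw Poly {xs :: 'a list. set xs \<subseteq> UNIV \<and> length xs = u} (polys_below u)"
  proof (rule bij_betw_byWitness[where f' = "\<lambda>p. map (coeff p) [0..<u]"])
    show "\<forall>xs\<in>{xs :: 'a list. set xs \<subseteq> UNIV \<and> length xs = u}. map (coeff (Poly xs)) [0..<u] = xs"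
      by (auto intro!: nth_equalityI simp: nth_default_def)
    show "\<forall>p\<in>polys_below u. Poly (map (coeff p) [0..<u]) = (p :: 'a poly)"
      by (auto intro!: poly_eqI simp: nth_default_def polys_below_def)
  qed (auto simp: polys_below_def nth_default_def)
  thus "finite (polys_below u :: 'a poly set)" "card (polys_below u :: 'a poly set) = CARD('a) ^ u"
    using card_lists_length_eq[of "UNIV :: 'a set" u] finite_lists_length_eq[of "UNIV :: 'a set" u]
    by (auto simp: bij_betw_finite dest: bij_betw_same_card)
qed

text \<open>These are the linear dependences, within one column, between the \<open>u\<close>
  conditions \<open>sat\<close> imposes for \<open>q\<close> and those for \<open>q'\<close>. The
  trivial solution is always present, so cardinality 1 means independence.\<close>

definition rel_kernel :: "nat \<Rightarrow> 'a::comm_ring poly ^ 'm \<Rightarrow> 'a poly ^ 'm \<Rightarrow> ('a poly \<times> 'a poly) set" where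
  "rel_kernel u q q' = {(a, b). a \<in> polys_below u \<and> b \<in> polys_below u \<and> (\<forall>i. a * q $ i + b * q' $ i = 0)}"

lemma finite_rel_kernel: "finite (rel_kernel u q (q' :: 'a::{comm_ring,finite} poly ^ 'm))"
  by (rule finite_subset[of _ "polys_below u \<times> polys_below u"]) (auto simp: rel_kernel_def card_polys_below)

definition monic_divisors :: "'a::field poly \<Rightarrow> 'a poly set" where
  "monic_divisors p = {h. h dvd p \<and> lead_coeff h = 1}"

lemma finite_monic_divisors: "p \<noteq> 0 \<Longrightarrow> finite (monic_divisors (p :: 'a::{field,finite} poly))"
  by (rule finite_subset[OF _ card_polys_below(1)[of "Suc (degree p)"]])
     (auto simp: monic_divisors_def polys_below_iff dvd_imp_degree_le)

text \<open>Among all $h \neq 0$ with $h q' = h' q$ one of minimal degree divides every other, by division with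
  remainder; this replaces a gcd, which is not available over an arbitrary field class.\<close>
lemma rel_kernel_proportional:
  fixes q q' :: "'a::{field,finite} poly ^ 'm"
  assumes i0: "degree (q $ i0) = d" "q $ i0 \<noteq> 0" and le: "\<And>i. degree (q' $ i) \<le> d" and "q' \<noteq> 0"
    and nontriv: "card (rel_kernel u q q') \<noteq> 1"
  obtains h h' where "h \<in> monic_divisors (q $ i0)" "\<And>i. h * q' $ i = h' * q $ i"
    "degree h' \<le> degree h" "degree h < u" "card (rel_kernel u q q') \<le> CARD('a) ^ (u - degree h)"
proof -
  let ?P = "\<lambda>h. h \<noteq> 0 \<and> (\<exists>h'. \<forall>i. h * q' $ i = h' * q $ i)"
  have "(0, 0) \<in> rel_kernel u q q'" by (simp add: rel_kernel_def polys_below_closed)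
  have "rel_kernel u q q' \<noteq> {(0, 0)}"
  proof
    assume "rel_kernel u q q' = {(0, 0)}"
    with nontriv show False by simp
  qed
  then obtain a b where ab: "(a, b) \<in> rel_kernel u q q'" "(a, b) \<noteq> (0, 0)"
    using \<open>(0, 0) \<in> _\<close> by fastforce
  have eqs: "a * q $ i + b * q' $ i = 0" for i using ab by (simp add: rel_kernel_def)
  \<comment> \<open>With \<open>b = 0\<close> the relation at \<open>i0\<close> would force
    \<open>a = 0\<close> as well.\<close>
  have b0: "b \<noteq> 0"
  proof
    assume "b = 0"
    with eqs[of i0] i0 ab(2) show False by simp
  qed
  have "b * q' $ i = - a * q $ i" for i
    using eqs[of i] by (simp add: eq_neg_iff_add_eq_0 add.commute)
  hence Pb: "?P b" using b0 by blast
  then obtain h0 where h0: "?P h0" and min0: "\<And>g. ?P g \<Longrightarrow> degree h0 \<le> degree g"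
    using ex_has_least_nat[of ?P b degree] by blast
  obtain h0' where h0': "\<And>i. h0 * q' $ i = h0' * q $ i" using h0 by blast
  define h where "h = smult (inverse (lead_coeff h0)) h0"
  define h' where "h' = smult (inverse (lead_coeff h0)) h0'"
  have h: "h \<noteq> 0" "lead_coeff h = 1" "degree h = degree h0" using h0 by (auto simp: h_def)
  have hh': "h * q' $ i = h' * q $ i" for i using h0' by (simp add: h_def h'_def)
  have dvd: "h dvd c" if c: "\<And>i. c * q' $ i = c' * q $ i" for c c'
  proof -
    have "c mod h * q' $ i = (c' - (c div h) * h') * q $ i" for i
    proof -
      have "c mod h = c - (c div h) * h" by (simp add: minus_div_mult_eq_mod)
      thus ?thesis using c[of i] hh'[of i] by (simp add: left_diff_distrib mult.assoc)
    qed
    hence "c mod h \<noteq> 0 \<Longrightarrow> ?P (c mod h)" by blast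
    moreover have "c mod h \<noteq> 0 \<Longrightarrow> degree (c mod h) < degree h"
      using degree_mod_less[of h c] h by auto
    ultimately have "c mod h = 0" using min0[of "c mod h"] h by force
    thus ?thesis by auto
  qed
  \<comment> \<open>The multiplier \<open>q $ i0\<close> is itself admissible, with partner
    \<open>q' $ i0\<close>: the cross products agree after cancelling \<open>h\<close>.\<close>
  have div: "h dvd q $ i0"
  proof (rule dvd)
    fix i
    have "h * (q $ i0 * q' $ i) = h * (q' $ i0 * q $ i)"
    proof -
      have "h * (q $ i0 * q' $ i) = q $ i0 * (h * q' $ i)" by (simp only: mult_ac)
      also have "\<dots> = (h' * q $ i0) * q $ i" by (simp only: hh' mult_ac)
      also have "\<dots> = h * (q' $ i0 * q $ i)" by (simp only: hh'[symmetric] mult_ac)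
      finally show ?thesis .
    qed
    thus "q $ i0 * q' $ i = q' $ i0 * q $ i" using h by simp
  qed
  \<comment> \<open>Compare degrees in component \<open>i0\<close>, where \<open>q\<close> attains
    the maximal degree \<open>d\<close> and \<open>q'\<close> cannot exceed it.\<close>
  have deg: "degree h' \<le> degree h"
  proof (cases "h' = 0")
    case False
    have "h' * q $ i0 \<noteq> 0" using False i0 by simp
    hence "q' $ i0 \<noteq> 0" using hh'[of i0] by auto
    hence "degree h + degree (q' $ i0) = degree h' + d"
      using hh'[of i0] h False i0 by (metis degree_mult_eq)
    with le[of i0] show ?thesis by simp
  qed simp
  have div_b: "h dvd b'" if "(a', b') \<in> rel_kernel u q q'" for a' b'
  proof (rule dvd)
    fix i
    have "a' * q $ i + b' * q' $ i = 0" using that by (simp add: rel_kernel_def)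
    thus "b' * q' $ i = - a' * q $ i" by (simp add: eq_neg_iff_add_eq_0 add.commute)
  qed
  have degu: "degree f < u" if "f \<in> polys_below u" "f \<noteq> 0" for f :: "'a poly"
    using that leading_coeff_0_iff by (fastforce simp: polys_below_def not_less[symmetric])
  have hu: "degree h < u"
    using div_b[OF ab(1)] b0 degu[of b] ab(1) dvd_imp_degree_le[of h b] by (auto simp: rel_kernel_def)
  \<comment> \<open>A solution is determined by its second entry because \<open>q $ i0\<close> is
    nonzero, and that entry is \<open>h\<close> times a member of
    \<open>polys_below (u - degree h)\<close>.\<close>
  have "card (rel_kernel u q q') \<le> card (polys_below (u - degree h) :: 'a poly set)"
  proof (rule card_inj_on_le[of "\<lambda>p. snd p div h"])
    show "inj_on (\<lambda>p. snd p div h) (rel_kernel u q q')"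
    proof (rule inj_onI, clarify)
      fix a1 b1 a2 b2 assume k: "(a1, b1) \<in> rel_kernel u q q'" "(a2, b2) \<in> rel_kernel u q q'"
        and eq: "snd (a1, b1) div h = snd (a2, b2) div h"
      have b: "b1 = b2" using div_b[OF k(1)] div_b[OF k(2)] eq by (metis dvd_mult_div_cancel snd_conv)
      have "a1 * q $ i0 + b1 * q' $ i0 = 0" "a2 * q $ i0 + b2 * q' $ i0 = 0"
        using k by (simp_all add: rel_kernel_def)
      moreover have "(a1 - a2) * q $ i0 = (a1 * q $ i0 + b1 * q' $ i0) - (a2 * q $ i0 + b1 * q' $ i0)"
        by (simp add: algebra_simps)
      ultimately have "(a1 - a2) * q $ i0 = 0" using b by simp
      thus "a1 = a2 \<and> b1 = b2" using b i0 by simp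
    qed
    show "(\<lambda>p. snd p div h) ` rel_kernel u q q' \<subseteq> polys_below (u - degree h)"
    proof clarify
      fix a b' assume k: "(a, b') \<in> rel_kernel u q q'"
      then obtain c where c: "b' = h * c" using div_b by blast
      hence cd: "b' div h = c" using h by simp
      show "snd (a, b') div h \<in> polys_below (u - degree h)"
      proof (cases "c = 0")
        case False
        have "degree b' = degree h + degree c" using False h by (simp add: c degree_mult_eq)
        moreover have "degree b' < u" using degu[of b'] k False h c by (auto simp: rel_kernel_def)
        ultimately have "degree c < u - degree h" by simp
        thus ?thesis using cd by (auto simp: polys_below_def intro!: coeff_eq_0)
      qed (use cd in \<open>simp add: polys_below_closed\<close>)
    qed
  qed (rule card_polys_below)
  hence "card (rel_kernel u q q') \<le> CARD('a) ^ (u - degree h)" by (simp add: card_polys_below)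
  with that[of h h'] div h hh' deg hu show ?thesis by (auto simp: monic_divisors_def)
qed

text \<open>Vectors with trivial kernel contribute 1 each. Any other \<open>q'\<close> is recovered
  from a pair \<open>(h, h')\<close> with \<open>h\<close> a monic divisor of \<open>q $ i0\<close>
  and \<open>degree h' \<le> degree h\<close>. For fixed \<open>h\<close> there are
  \<open>k ^ (degree h + 1)\<close> candidates \<open>h'\<close>, each contributing at most
  \<open>k ^ ((u - degree h) * n)\<close>, and \<open>n \<ge> 1\<close> bounds the product by
  \<open>k ^ (u * n + 1)\<close>.\<close>

lemma sum_rel_kernel_le:
  fixes Q :: "('a::{field,finite} poly ^ 'm) set" and q :: "'a poly ^ 'm"
  assumes "finite Q" and n: "n \<ge> 1" and i0: "degree (q $ i0) = d" "q $ i0 \<noteq> 0"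
    and Q: "\<And>q' i. q' \<in> Q \<Longrightarrow> degree (q' $ i) \<le> d" "0 \<notin> Q"
  shows "(\<Sum>q'\<in>Q. card (rel_kernel u q q') ^ n) \<le> card Q + card (monic_divisors (q $ i0)) * CARD('a) ^ (u * n + 1)"
proof -
  let ?k = "CARD('a)" and ?K = "\<lambda>q'. card (rel_kernel u q q')"
  have k1: "?k \<ge> 1" by (simp add: Suc_le_eq)
  define R where "R = {q' \<in> Q. ?K q' \<noteq> 1}"
  have fR: "finite R" using assms(1) by (simp add: R_def)
  have "\<forall>q'\<in>R. \<exists>p. fst p \<in> monic_divisors (q $ i0) \<and> (\<forall>i. fst p * q' $ i = snd p * q $ i) \<and>
    degree (snd p) \<le> degree (fst p) \<and> degree (fst p) < u \<and> ?K q' \<le> ?k ^ (u - degree (fst p))"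
  proof
    fix q' assume q': "q' \<in> R"
    hence "q' \<in> Q" "?K q' \<noteq> 1" by (auto simp: R_def)
    moreover from this have "q' \<noteq> 0" using Q by auto
    ultimately obtain h h' where "h \<in> monic_divisors (q $ i0)" "\<And>i. h * q' $ i = h' * q $ i"
      "degree h' \<le> degree h" "degree h < u" "?K q' \<le> ?k ^ (u - degree h)"
      using rel_kernel_proportional[OF i0 Q(1)] by metis
    thus "\<exists>p. fst p \<in> monic_divisors (q $ i0) \<and> (\<forall>i. fst p * q' $ i = snd p * q $ i) \<and>
      degree (snd p) \<le> degree (fst p) \<and> degree (fst p) < u \<and> ?K q' \<le> ?k ^ (u - degree (fst p))"
      by (intro exI[of _ "(h, h')"]) auto
  qed
  then obtain F where F: "\<And>q'. q' \<in> R \<Longrightarrow> fst (F q') \<in> monic_divisors (q $ i0)"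
      "\<And>q' i. q' \<in> R \<Longrightarrow> fst (F q') * q' $ i = snd (F q') * q $ i"
      "\<And>q'. q' \<in> R \<Longrightarrow> degree (snd (F q')) \<le> degree (fst (F q'))"
      "\<And>q'. q' \<in> R \<Longrightarrow> degree (fst (F q')) < u"
      "\<And>q'. q' \<in> R \<Longrightarrow> ?K q' \<le> ?k ^ (u - degree (fst (F q')))"
    unfolding bchoice_iff by blast
  have inj: "inj_on F R"
  proof (rule inj_onI)
    fix x y assume xy: "x \<in> R" "y \<in> R" "F x = F y"
    have nz: "fst (F x) \<noteq> 0" using F(1)[OF xy(1)] by (auto simp: monic_divisors_def)
    have "fst (F x) * x $ i = fst (F x) * y $ i" for i using F(2)[OF xy(1)] F(2)[OF xy(2)] xy(3) by simp
    with nz show "x = y" by (simp add: vec_eq_iff)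
  qed
  define D where "D = {h \<in> monic_divisors (q $ i0). degree h < u}"
  have fD: "finite D" using i0 by (simp add: D_def finite_monic_divisors)
  have "(\<Sum>q'\<in>R. ?K q' ^ n) \<le> (\<Sum>q'\<in>R. (?k ^ (u - degree (fst (F q')))) ^ n)"
    by (intro sum_mono power_mono F(5)) auto
  also have "\<dots> = (\<Sum>p\<in>F ` R. (?k ^ (u - degree (fst p))) ^ n)"
    by (simp add: sum.reindex[OF inj])
  also have "\<dots> \<le> (\<Sum>p\<in>((SIGMA h:D. polys_below (Suc (degree h))) :: ('a poly \<times> 'a poly) set). (?k ^ (u - degree (fst p))) ^ n)"
  proof (rule sum_mono2)
    show "F ` R \<subseteq> (SIGMA h:D. polys_below (Suc (degree h)))"
    proof
      fix p assume "p \<in> F ` R"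
      then obtain q' where "q' \<in> R" "p = F q'" by blast
      with F(1,3,4)[of q'] show "p \<in> (SIGMA h:D. polys_below (Suc (degree h)))"
        by (cases "F q'") (auto simp: D_def polys_below_iff)
    qed
  qed (auto simp: fD card_polys_below)
  also have "\<dots> = (\<Sum>h\<in>D. \<Sum>p\<in>(polys_below (Suc (degree h)) :: 'a poly set). (?k ^ (u - degree h)) ^ n)"
    by (subst sum.Sigma) (auto simp: fD card_polys_below intro!: sum.cong)
  also have "\<dots> = (\<Sum>h\<in>D. ?k ^ Suc (degree h) * (?k ^ (u - degree h)) ^ n)"
    by (simp add: card_polys_below)
  also have "\<dots> \<le> (\<Sum>h\<in>D. ?k ^ (u * n + 1))"
  proof (rule sum_mono)
    fix h assume "h \<in> D"
    hence hu: "degree h < u" by (simp add: D_def)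
    have "?k ^ Suc (degree h) * (?k ^ (u - degree h)) ^ n = ?k ^ (Suc (degree h) + (u - degree h) * n)"
      by (simp only: power_add power_mult)
    also have "\<dots> \<le> ?k ^ (u * n + 1)"
    proof (rule power_increasing)
      have "degree h \<le> degree h * n" using n by simp
      moreover have "degree h * n \<le> u * n" using hu by simp
      ultimately show "Suc (degree h) + (u - degree h) * n \<le> u * n + 1"
        unfolding diff_mult_distrib by linarith
    qed (use k1 in simp)
    finally show "?k ^ Suc (degree h) * (?k ^ (u - degree h)) ^ n \<le> ?k ^ (u * n + 1)" .
  qed
  also have "\<dots> = card D * ?k ^ (u * n + 1)" by simp
  also have "\<dots> \<le> card (monic_divisors (q $ i0)) * ?k ^ (u * n + 1)"
    using i0 by (intro mult_le_mono1 card_mono finite_monic_divisors) (auto simp: D_def)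
  finally have 1: "(\<Sum>q'\<in>R. ?K q' ^ n) \<le> card (monic_divisors (q $ i0)) * ?k ^ (u * n + 1)" .
  have "(\<Sum>q'\<in>Q. ?K q' ^ n) = (\<Sum>q'\<in>Q - R. ?K q' ^ n) + (\<Sum>q'\<in>R. ?K q' ^ n)"
    using assms(1) by (intro sum.subset_diff) (auto simp: R_def)
  also have "(\<Sum>q'\<in>Q - R. ?K q' ^ n) = card (Q - R)" by (simp add: R_def)
  also have "\<dots> \<le> card Q" using assms(1) by (intro card_mono) auto
  finally show ?thesis using 1 by linarith
qed

section \<open>The divisor bound and counting digit strings\<close>

text \<open>By primality each copy of \<open>p\<close> divides either \<open>g\<close> or its
  cofactor; cancelling it there lowers \<open>a\<close>.\<close>

lemma dvd_power_mult_prime: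
  fixes p :: "'a::field poly"
  assumes p: "prime_elem p" and "g dvd p ^ a * q"
  shows "\<exists>b\<le>a. \<exists>g'. g = p ^ b * g' \<and> g' dvd q"
  using assms(2)
proof (induction a arbitrary: g)
  case (Suc a)
  from Suc.prems obtain x where x: "p * (p ^ a * q) = g * x" by (auto simp: mult.assoc)
  hence "p dvd g * x" by (metis dvd_triv_left)
  hence "p dvd g \<or> p dvd x" using p by (simp add: prime_elem_dvd_mult_iff)
  thus ?case
  proof
    assume "p dvd g"
    then obtain g1 where g1: "g = p * g1" by blast
    hence "p * (p ^ a * q) = p * (g1 * x)" using x by (simp add: mult.assoc)
    hence "p ^ a * q = g1 * x" using p by (metis mult_cancel_left prime_elem_not_zeroI)
    hence "g1 dvd p ^ a * q" by simp
    from Suc.IH[OF this] obtain b g' where "b \<le> a" "g1 = p ^ b * g'" "g' dvd q" by blast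
    thus ?thesis using g1 by (intro exI[of _ "Suc b"]) (auto simp: mult.assoc)
  next
    assume "p dvd x"
    then obtain x1 where x1: "x = p * x1" by blast
    hence "p * (p ^ a * q) = p * (g * x1)" using x by (simp add: mult.left_commute)
    hence "p ^ a * q = g * x1" using p by (metis mult_cancel_left prime_elem_not_zeroI)
    hence "g dvd p ^ a * q" by simp
    from Suc.IH[OF this] obtain b g' where "b \<le> a" "g = p ^ b * g'" "g' dvd q" by blast
    thus ?thesis using le_SucI by blast
  qed
qed auto

text \<open>A nonconstant divisor of least degree is irreducible, hence prime over a field.\<close>

lemma exists_monic_prime_factor:
  fixes q :: "'a::field poly"
  assumes "degree q \<noteq> 0"
  obtains p where "prime_elem p" "lead_coeff p = 1" "p dvd q" "degree p \<noteq> 0"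
proof -
  let ?P = "\<lambda>p. p dvd q \<and> degree p \<noteq> 0"
  obtain p0 where p0: "p0 dvd q" "degree p0 \<noteq> 0" "\<And>r. ?P r \<Longrightarrow> degree p0 \<le> degree r"
    using ex_has_least_nat[of ?P q degree] assms dvd_refl[of q] by metis
  define p where "p = smult (inverse (lead_coeff p0)) p0"
  have nz: "p0 \<noteq> 0" using p0(2) by auto
  have pd: "degree p = degree p0" "lead_coeff p = 1" using nz by (auto simp: p_def)
  have pq: "p dvd q" using p0(1) nz by (simp add: p_def smult_dvd_iff)
  have p0': "p \<noteq> 0" using pd by auto
  have "irreducible p"
  proof (rule irreducibleI)
    show "p \<noteq> 0" by fact
    show "\<not> p dvd 1" using pd p0(2) p0' by (auto simp: is_unit_iff_degree)
    fix a b assume ab: "p = a * b"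
    have nzab: "a \<noteq> 0" "b \<noteq> 0" using ab p0' by auto
    show "a dvd 1 \<or> b dvd 1"
    proof (cases "degree a = 0")
      case True
      thus ?thesis using nzab by (simp add: is_unit_iff_degree)
    next
      case False
      have "a dvd q" using ab pq by (metis dvd_mult_left)
      hence "degree p \<le> degree a" using p0(3)[of a] False pd by simp
      hence "degree b = 0" using ab nzab by (simp add: degree_mult_eq)
      thus ?thesis using nzab by (simp add: is_unit_iff_degree)
    qed
  qed
  hence "prime_elem p" by (rule field_poly_irreducible_imp_prime)
  with that pd pq p0(2) show ?thesis by metis
qed

lemma prime_power_decomposition:
  fixes q :: "'a::field poly"
  assumes "q \<noteq> 0" "degree p \<noteq> 0"
  obtains a q' where "q = p ^ a * q'" "\<not> p dvd q'"
  using assms(1)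
proof (induction "degree q" arbitrary: q thesis rule: less_induct)
  case less
  show ?case
  proof (cases "p dvd q")
    case True
    then obtain r where r: "q = p * r" by blast
    hence "r \<noteq> 0" "p \<noteq> 0" using less.prems by auto
    hence "degree r < degree q" using r assms(2) by (simp add: degree_mult_eq)
    from less.hyps[OF this _ \<open>r \<noteq> 0\<close>] obtain a q' where "r = p ^ a * q'" "\<not> p dvd q'" by blast
    thus ?thesis using less.prems(1)[of "Suc a" q'] r by (simp add: mult.assoc)
  next
    case False
    thus ?thesis using less.prems(1)[of 0 q] by simp
  qed
qed

lemma card_monic_divisors_prime_power_mult:
  fixes p q :: "'a::{field,finite} poly"
  assumes p: "prime_elem p" "lead_coeff p = 1" and q: "q \<noteq> 0"
  shows "card (monic_divisors (p ^ a * q)) \<le> Suc a * card (monic_divisors q)"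
proof -
  have "monic_divisors (p ^ a * q) \<subseteq> (\<lambda>(b, g). p ^ b * g) ` ({..a} \<times> monic_divisors q)"
  proof
    fix g assume "g \<in> monic_divisors (p ^ a * q)"
    hence g: "g dvd p ^ a * q" "lead_coeff g = 1" by (auto simp: monic_divisors_def)
    from dvd_power_mult_prime[OF p(1) g(1)] obtain b g' where
      b: "b \<le> a" "g = p ^ b * g'" "g' dvd q" by blast
    have "lead_coeff g' = 1" using g(2) p(2) b(2) by (simp add: lead_coeff_mult lead_coeff_power)
    with b show "g \<in> (\<lambda>(b, g). p ^ b * g) ` ({..a} \<times> monic_divisors q)"
      by (force simp: monic_divisors_def)
  qed
  hence "card (monic_divisors (p ^ a * q)) \<le> card ({..a} \<times> monic_divisors q)"
    using q by (intro surj_card_le finite_cartesian_product finite_monic_divisors) auto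
  thus ?thesis by (simp add: card_cartesian_product)
qed

lemma linear_le_exponential:
  assumes "(x::real) > 1"
  obtains C where "C \<ge> 1" "\<And>a::nat. real (Suc a) \<le> C * x ^ a"
proof -
  have "(\<lambda>a. real (Suc a) / x ^ a) \<longlonglongrightarrow> 0"
  proof -
    have "(\<lambda>a. real a * (1 / x) ^ a + (1 / x) ^ a) \<longlonglongrightarrow> 0 + 0"
      using assms by (intro tendsto_add powser_times_n_limit_0 LIMSEQ_power_zero) (auto simp: abs_if)
    moreover have "real a * (1 / x) ^ a + (1 / x) ^ a = real (Suc a) / x ^ a" for a
      by (simp add: power_one_over field_simps add_divide_distrib)
    ultimately show ?thesis by simp
  qed
  hence "Bseq (\<lambda>a. real (Suc a) / x ^ a)" by (intro convergent_imp_Bseq convergentI)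
  then obtain K where K: "\<And>a. norm (real (Suc a) / x ^ a) \<le> K" by (auto simp: Bseq_def)
  show ?thesis
  proof (rule that[of "max 1 K"])
    fix a
    have "real (Suc a) / x ^ a \<le> max 1 K" using K[of a] abs_ge_self[of "real (Suc a) / x ^ a"]
      unfolding real_norm_def by linarith
    thus "real (Suc a) \<le> max 1 K * x ^ a" using assms by (simp add: field_simps)
  qed simp
qed

text \<open>An exact prime power \<open>p ^ a\<close> in \<open>q\<close> multiplies the number of
  divisors by at most \<open>a + 1\<close>. For \<open>degree p \<ge> b\<close> this is at most
  \<open>2 ^ a\<close>, hence at most \<open>(k powr \<epsilon>) ^ (a * degree p)\<close>, which the
  degree of \<open>q\<close> already pays for. Each of the finitely many remaining monic primes
  costs one more factor \<open>C\<close>.\<close>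

lemma divisor_bound:
  assumes \<epsilon>: "\<epsilon> > 0"
  obtains C :: real where "C \<ge> 1"
    "\<And>q :: 'a::{field,finite} poly. q \<noteq> 0 \<Longrightarrow> real (card (monic_divisors q)) \<le> C * real CARD('a) powr (\<epsilon> * real (degree q))"
proof -
  let ?k = "real CARD('a)"
  have k: "?k > 1" using card_field_ge_2[where 'a='a] by simp
  have kx: "?k powr \<epsilon> > 1" using gr_one_powr[OF k \<epsilon>] .
  obtain C where C: "C \<ge> 1" "\<And>a::nat. real (Suc a) \<le> C * (?k powr \<epsilon>) ^ a"
    using linear_le_exponential[OF kx] by blast
  \<comment> \<open>only primes of degree below this bound contribute a factor C\<close>
  obtain b :: nat where b: "2 \<le> (?k powr \<epsilon>) ^ b" using real_arch_pow[OF kx, of 2] by (auto intro: less_imp_le)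
  define small where "small q = {p :: 'a poly. p dvd q \<and> prime_elem p \<and> lead_coeff p = 1 \<and> degree p < b}" for q
  have finS: "finite (small q)" for q
    by (rule finite_subset[OF _ card_polys_below(1)[of "Suc b"]]) (auto simp: small_def polys_below_iff)
  \<comment> \<open>The exponent of \<open>C\<close> counts the small primes of this particular
    \<open>q\<close>, so that splitting off the full power of one of them frees exactly the factor
    the induction step needs.\<close>
  have main: "real (card (monic_divisors q)) \<le> C ^ card (small q) * ?k powr (\<epsilon> * real (degree q))"
    if "q \<noteq> 0" for q
    using that
  proof (induction "degree q" arbitrary: q rule: less_induct)
    case less
    show ?case
    proof (cases "degree q = 0")
      case True
      have "monic_divisors q \<subseteq> {1}"
      proof
        fix h assume "h \<in> monic_divisors q"
        hence h: "h dvd q" "lead_coeff h = 1" by (auto simp: monic_divisors_def)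
        hence "degree h = 0" using dvd_imp_degree_le[OF h(1) less.prems] True by simp
        then obtain c where "h = [:c:]" by (rule degree_eq_zeroE)
        with h show "h \<in> {1}" by (simp add: one_pCons)
      qed
      hence "card (monic_divisors q) \<le> card {1 :: 'a poly}" by (intro card_mono) auto
      hence "real (card (monic_divisors q)) \<le> 1" by simp
      also have "1 \<le> C ^ card (small q)" using C(1) by simp
      finally show ?thesis using True k by simp
    next
      case False
      then obtain p where p: "prime_elem p" "lead_coeff p = 1" "p dvd q" "degree p \<noteq> 0"
        by (rule exists_monic_prime_factor)
      obtain a q' where q': "q = p ^ a * q'" "\<not> p dvd q'"
        using prime_power_decomposition[OF less.prems p(4)] by blast
      have nz: "q' \<noteq> 0" "p \<noteq> 0" using q' less.prems p by auto
      have a: "a > 0" using q' p(3) by (cases a) auto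
      have deg: "degree q = a * degree p + degree q'"
        using nz by (simp add: q'(1) degree_mult_eq degree_power_eq)
      hence IH: "real (card (monic_divisors q')) \<le> C ^ card (small q') * ?k powr (\<epsilon> * real (degree q'))"
        using a p(4) nz by (intro less.hyps) auto
      have sub: "small q' \<subseteq> small q" using q'(1) by (auto simp: small_def)
      have powr: "(?k powr \<epsilon>) ^ (a * degree p) = ?k powr (\<epsilon> * real (a * degree p))"
        using k by (simp add: powr_powr flip: powr_realpow)
      have "real (Suc a) * C ^ card (small q') \<le> C ^ card (small q) * (?k powr \<epsilon>) ^ (a * degree p)"
      proof (cases "degree p < b")
        case True
        have "insert p (small q') \<subseteq> small q" using sub True p by (auto simp: small_def)
        hence "card (insert p (small q')) \<le> card (small q)" by (intro card_mono finS)
        moreover have "p \<notin> small q'" using q' by (simp add: small_def)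
        ultimately have "Suc (card (small q')) \<le> card (small q)" using finS by simp
        hence c: "C ^ Suc (card (small q')) \<le> C ^ card (small q)" using C(1) by (rule power_increasing)
        have "(?k powr \<epsilon>) ^ a \<le> (?k powr \<epsilon>) ^ (a * degree p)" using kx p(4) by (intro power_increasing) auto
        hence "C * (?k powr \<epsilon>) ^ a \<le> C * (?k powr \<epsilon>) ^ (a * degree p)" using C(1) by simp
        hence "real (Suc a) \<le> C * (?k powr \<epsilon>) ^ (a * degree p)" using C(2)[of a] by linarith
        hence "real (Suc a) * C ^ card (small q') \<le> C * (?k powr \<epsilon>) ^ (a * degree p) * C ^ card (small q')"
          using C(1) by (intro mult_right_mono) auto
        also have "\<dots> = C ^ Suc (card (small q')) * (?k powr \<epsilon>) ^ (a * degree p)" by simp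
        also have "\<dots> \<le> C ^ card (small q) * (?k powr \<epsilon>) ^ (a * degree p)"
          using c by (rule mult_right_mono) simp
        finally show ?thesis .
      next
        case False
        have "real (Suc a) \<le> 2 ^ a"
        proof -
          have "Suc a \<le> 2 ^ a" by (rule Suc_leI) (rule less_exp)
          thus ?thesis by (metis of_nat_le_iff of_nat_numeral of_nat_power)
        qed
        also have "\<dots> \<le> ((?k powr \<epsilon>) ^ b) ^ a" using b by (intro power_mono) auto
        also have "\<dots> = (?k powr \<epsilon>) ^ (a * b)" by (simp only: mult.commute[of a b] power_mult)
        also have "\<dots> \<le> (?k powr \<epsilon>) ^ (a * degree p)" using kx False by (intro power_increasing) auto
        finally have 1: "real (Suc a) \<le> (?k powr \<epsilon>) ^ (a * degree p)" .
        have "C ^ card (small q') \<le> C ^ card (small q)"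
          using sub C(1) by (intro power_increasing card_mono finS) auto
        with 1 have "real (Suc a) * C ^ card (small q') \<le> (?k powr \<epsilon>) ^ (a * degree p) * C ^ card (small q)"
          using C(1) by (intro mult_mono) auto
        thus ?thesis by (simp add: mult.commute)
      qed
      note step = this
      have "real (card (monic_divisors q)) \<le> real (Suc a * card (monic_divisors q'))"
        using card_monic_divisors_prime_power_mult[OF p(1,2) nz(1), of a] q'(1) by (simp only: of_nat_le_iff)
      also have "\<dots> = real (Suc a) * real (card (monic_divisors q'))" by (rule of_nat_mult)
      also have "\<dots> \<le> real (Suc a) * (C ^ card (small q') * ?k powr (\<epsilon> * real (degree q')))"
        using IH by (intro mult_left_mono) auto
      also have "\<dots> = (real (Suc a) * C ^ card (small q')) * ?k powr (\<epsilon> * real (degree q'))" by simp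
      also have "\<dots> \<le> (C ^ card (small q) * (?k powr \<epsilon>) ^ (a * degree p)) * ?k powr (\<epsilon> * real (degree q'))"
        by (intro mult_right_mono step) auto
      also have "\<dots> = C ^ card (small q) * ?k powr (\<epsilon> * real (degree q))"
        by (simp only: powr deg of_nat_add distrib_left powr_add mult.assoc)
      finally show ?thesis .
    qed
  qed
  \<comment> \<open>A bound for the number of small primes that does not depend on
    \<open>q\<close>.\<close>
  define M where "M = card (polys_below (Suc b) :: 'a poly set)"
  show ?thesis
  proof (rule that[of "C ^ M"])
    fix q :: "'a poly" assume "q \<noteq> 0"
    have "small q \<subseteq> polys_below (Suc b)" by (auto simp: small_def polys_below_iff)
    hence "card (small q) \<le> M" unfolding M_def by (intro card_mono card_polys_below)
    hence "C ^ card (small q) \<le> C ^ M" using C(1) by (intro power_increasing) auto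
    hence "C ^ card (small q) * ?k powr (\<epsilon> * real (degree q)) \<le> C ^ M * ?k powr (\<epsilon> * real (degree q))"
      by (rule mult_right_mono) simp
    with main[OF \<open>q \<noteq> 0\<close>] show "real (card (monic_divisors q)) \<le> C ^ M * ?k powr (\<epsilon> * real (degree q))"
      by linarith
  qed (use C(1) in simp)
qed

text \<open>For the digit string of a matrix \<^term>\<open>A\<close>, \<^term>\<open>lin_form d q ys v\<close> is the vector of coefficients of
  $X^{-(v+1)}$ in $qA$, so \<^term>\<open>sat d q u ys\<close> says $\|qA\| < k^{-u}$.\<close>

definition lin_form :: "nat \<Rightarrow> 'a::comm_ring_1 poly ^ 'm \<Rightarrow> ('a ^ 'n ^ 'm) list \<Rightarrow> nat \<Rightarrow> 'a ^ 'n" where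
  "lin_form d q ys v = (\<chi> j. \<Sum>i\<in>UNIV. \<Sum>l\<le>d. coeff (q $ i) l * (ys ! (l + v)) $ i $ j)"

definition sat :: "nat \<Rightarrow> 'a::comm_ring_1 poly ^ 'm \<Rightarrow> nat \<Rightarrow> ('a ^ 'n ^ 'm) list \<Rightarrow> bool" where
  "sat d q u ys \<longleftrightarrow> (\<forall>v<u. lin_form d q ys v = 0)"

lemma lin_form_append: "d + v < length ys \<Longrightarrow> lin_form d q (ys @ zs) v = lin_form d q ys v"
  by (auto simp: lin_form_def vec_eq_iff nth_append intro!: sum.cong)

text \<open>Condition \<open>v\<close> reads the digits at positions \<open>v\<close> to
  \<open>d + v\<close>, so the digit appended at position \<open>d + u\<close> decides condition
  \<open>u\<close> and leaves the earlier ones alone.\<close>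

lemma sat_snoc:
  "length ys = d + u \<Longrightarrow> sat d q (Suc u) (ys @ [y]) \<longleftrightarrow> sat d q u ys \<and> lin_form d q (ys @ [y]) u = 0"
  by (auto simp: sat_def less_Suc_eq lin_form_append)

text \<open>The new digit enters condition \<open>u\<close> only through the coefficients of degree
  \<open>d\<close>. One of these is nonzero, at \<open>i0\<close>, so altering row \<open>i0\<close>
  of the digit shifts the value by any prescribed vector.\<close>

lemma card_sat_children:
  fixes q :: "'a::{field,finite} poly ^ 'm" and ys :: "('a ^ 'n ^ 'm) list"
  assumes len: "length ys = d + u" and nz: "coeff (q $ i0) d \<noteq> 0"
  shows "CARD('a) ^ CARD('n) * card {y. lin_form d q (ys @ [y]) u = 0} = CARD('a ^ 'n ^ 'm)"
proof -
  have eq: "lin_form d q (ys @ [y + z]) u = lin_form d q (ys @ [y]) u + (\<chi> j. \<Sum>i\<in>UNIV. coeff (q $ i) d * z $ i $ j)" for y z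
  proof -
    have "(\<Sum>l\<le>d. coeff (q $ i) l * ((ys @ [y + z]) ! (l + u)) $ i $ j) =
       (\<Sum>l\<le>d. coeff (q $ i) l * ((ys @ [y]) ! (l + u)) $ i $ j + (if l = d then coeff (q $ i) d * z $ i $ j else 0))" for i j
      by (rule sum.cong) (auto simp: nth_append len algebra_simps)
    thus ?thesis by (simp add: lin_form_def vec_eq_iff sum.distrib)
  qed
  have "CARD('a ^ 'n) * card {y\<in>UNIV. lin_form d q (ys @ [y]) u = 0} = card (UNIV :: ('a ^ 'n ^ 'm) set)"
  proof (rule card_zero_fibre)
    fix c :: "'a ^ 'n"
    define z :: "'a ^ 'n ^ 'm" where "z = (\<chi> i j. if i = i0 then c $ j / coeff (q $ i0) d else 0)"
    have "(\<Sum>i\<in>UNIV. coeff (q $ i) d * z $ i $ j) = c $ j" for j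
    proof -
      have "(\<Sum>i\<in>UNIV. coeff (q $ i) d * z $ i $ j) = (\<Sum>i\<in>UNIV. if i = i0 then c $ j else 0)"
        using nz by (intro sum.cong) (auto simp: z_def)
      thus ?thesis by simp
    qed
    hence "(\<chi> j. \<Sum>i\<in>UNIV. coeff (q $ i) d * z $ i $ j) = c" by (simp add: vec_eq_iff)
    moreover have "bij_betw (\<lambda>y. y + z) UNIV UNIV"
      by (rule bij_betw_byWitness[where f'="\<lambda>y. y - z"]) auto
    ultimately show "\<exists>g. bij_betw g UNIV UNIV \<and> (\<forall>y\<in>UNIV. lin_form d q (ys @ [g y]) u = lin_form d q (ys @ [y]) u + c)"
      using eq by (intro exI[of _ "\<lambda>y. y + z"]) auto
  qed simp
  thus ?thesis by simp
qed

text \<open>The adjoint of multiplication by \<open>p\<close>: pairing \<open>a * p\<close> with a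
  sequence amounts to pairing \<open>a\<close> with the window sums of that sequence. For
  \<open>p = q $ i\<close> these windows build \<open>lin_form\<close>.\<close>

lemma sum_coeff_mult:
  fixes a p :: "'a::comm_ring_1 poly"
  assumes a: "a \<in> polys_below u" and p: "degree p \<le> d"
  shows "(\<Sum>l<d + u. coeff (a * p) l * f l) = (\<Sum>v<u. coeff a v * (\<Sum>c\<le>d. coeff p c * f (c + v)))"
proof -
  have "(\<Sum>l<d + u. coeff (a * p) l * f l) = (\<Sum>l<d + u. \<Sum>v\<le>l. coeff a v * coeff p (l - v) * f l)"
    by (simp add: coeff_mult sum_distrib_right)
  also have "\<dots> = (\<Sum>x\<in>(SIGMA l:{..<d + u}. {..l}). coeff a (snd x) * coeff p (fst x - snd x) * f (fst x))"
    by (subst sum.Sigma) (auto simp: split_beta)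
  also have "\<dots> = (\<Sum>x\<in>{..<u} \<times> {..d}. coeff a (fst x) * coeff p (snd x) * f (snd x + fst x))"
  \<comment> \<open>The triangle of pairs is replaced by the box \<open>v < u\<close>,
    \<open>l - v \<le> d\<close>; outside the box one of the two coefficients vanishes.\<close>
  proof (rule sum.reindex_bij_witness_not_neutral[where i = "\<lambda>x. (snd x + fst x, fst x)"
      and j = "\<lambda>x. (snd x, fst x - snd x)" and
      S' = "{x \<in> (SIGMA l:{..<d + u}. {..l}). \<not> (snd x < u \<and> fst x - snd x \<le> d)}" and T' = "{}"])
    show "coeff a (snd x) * coeff p (fst x - snd x) * f (fst x) = 0"
      if "x \<in> {x \<in> (SIGMA l:{..<d + u}. {..l}). \<not> (snd x < u \<and> fst x - snd x \<le> d)}" for x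
      using that a p by (auto simp: polys_below_def coeff_eq_0)
  qed (auto simp: finite_subset[OF _ finite_SigmaI])
  also have "\<dots> = (\<Sum>v<u. \<Sum>c\<le>d. coeff a v * coeff p c * f (c + v))"
    by (subst sum.cartesian_product) (simp add: split_beta)
  finally show ?thesis by (simp add: sum_distrib_left mult.assoc)
qed

lemma sat_imp_sum_eq_0:
  fixes q :: "'a::comm_ring_1 poly ^ 'm" and ys :: "('a ^ 'n ^ 'm) list"
  assumes "sat d q u ys" "a \<in> polys_below u" "\<And>i. degree (q $ i) \<le> d"
  shows "(\<Sum>i\<in>UNIV. \<Sum>l<d + u. coeff (a * q $ i) l * (ys ! l) $ i $ j) = 0"
proof -
  have "(\<Sum>i\<in>UNIV. \<Sum>l<d + u. coeff (a * q $ i) l * (ys ! l) $ i $ j) =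
     (\<Sum>i\<in>UNIV. \<Sum>v<u. coeff a v * (\<Sum>c\<le>d. coeff (q $ i) c * (ys ! (c + v)) $ i $ j))"
    using assms by (simp add: sum_coeff_mult)
  also have "\<dots> = (\<Sum>v<u. coeff a v * (lin_form d q ys v $ j))"
    by (subst sum.swap) (simp add: lin_form_def sum_distrib_left)
  also have "\<dots> = 0" using assms(1) by (simp add: sat_def)
  finally show ?thesis .
qed

lemma card_vec_components: "card {w :: 'b ^ 'n. \<forall>j. w $ j \<in> S} = card S ^ CARD('n)"
proof -
  have "bij_betw vec_nth {w :: 'b ^ 'n. \<forall>j. w $ j \<in> S} (PiE UNIV (\<lambda>_. S))"
    by (rule bij_betw_byWitness[where f'=vec_lambda]) auto
  hence "card {w :: 'b ^ 'n. \<forall>j. w $ j \<in> S} = card (PiE (UNIV :: 'n set) (\<lambda>_. S))"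
    by (rule bij_betw_same_card)
  thus ?thesis by (simp add: card_PiE)
qed

lemma finite_vec_components:
  assumes "finite S" shows "finite {w :: 'b ^ 'n. \<forall>j. w $ j \<in> S}"
proof (rule finite_imageD)
  show "finite (vec_nth ` {w :: 'b ^ 'n. \<forall>j. w $ j \<in> S})"
    by (rule finite_subset[of _ "PiE UNIV (\<lambda>_. S)"]) (auto intro: finite_PiE assms)
qed (auto simp: inj_on_def vec_eq_iff)

text \<open>A digit string is paired with a choice of \<open>(a, b)\<close> for every column,
  through the coefficients of \<open>a * q + b * q'\<close>. Strings satisfying both conditions
  annihilate every choice, and a choice annihilated by every string has all its columns in
  \<open>rel_kernel\<close>. The equality of normalised kernel sizes then gives the
  estimate.\<close>

lemma card_sat_pair:
  fixes q q' :: "'a::{field,finite} poly ^ 'm"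
  assumes deg: "\<And>i. degree (q $ i) \<le> d" "\<And>i. degree (q' $ i) \<le> d"
  shows "CARD('a) ^ (2 * u * CARD('n)) * card {ys :: ('a ^ 'n ^ 'm) list. length ys = d + u \<and> sat d q u ys \<and> sat d q' u ys}
       \<le> CARD('a ^ 'n ^ 'm) ^ (d + u) * card (rel_kernel u q q') ^ CARD('n)"
proof -
  define V where "V = {ys :: ('a ^ 'n ^ 'm) list. length ys = d + u}"
  define W :: "(('a poly \<times> 'a poly) ^ 'n) set" where "W = {w. \<forall>j. w $ j \<in> polys_below u \<times> polys_below u}"
  define cf where "cf w j i l = coeff (fst (w $ j) * q $ i + snd (w $ j) * q' $ i) l"
    for w :: "('a poly \<times> 'a poly) ^ 'n" and j i l
  define \<beta> where "\<beta> ys w = (\<Sum>j\<in>UNIV. \<Sum>i\<in>UNIV. \<Sum>l<d + u. cf w j i l * (ys ! l) $ i $ j)"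
    for ys :: "('a ^ 'n ^ 'm) list" and w
  have finV: "finite V" and cardV: "card V = CARD('a ^ 'n ^ 'm) ^ (d + u)"
    using finite_lists_length_eq[of "UNIV :: ('a ^ 'n ^ 'm) set" "d + u"]
      card_lists_length_eq[of "UNIV :: ('a ^ 'n ^ 'm) set" "d + u"] by (auto simp: V_def)
  have finW: "finite W" unfolding W_def by (intro finite_vec_components finite_cartesian_product card_polys_below)
  have cardW: "card W = CARD('a) ^ (2 * u * CARD('n))"
    unfolding W_def by (simp add: card_vec_components card_cartesian_product card_polys_below power_mult
        power_mult_distrib power2_eq_square flip: power_add)
  have "card W * card {ys\<in>V. \<forall>w\<in>W. \<beta> ys w = 0} = card V * card {w\<in>W. \<forall>ys\<in>V. \<beta> ys w = 0}"
  proof (rule card_left_right_kernel[OF finV finW])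
    fix ys assume ys: "ys \<in> V" and "\<exists>w\<in>W. \<beta> ys w \<noteq> 0"
    then obtain w where w: "w \<in> W" "\<beta> ys w \<noteq> 0" by blast
    show "CARD('a) * card {w\<in>W. \<beta> ys w = 0} = card W"
    proof (rule card_zero_fibre[OF finW])
      fix c
      \<comment> \<open>Adding \<open>e\<close> times \<open>w\<close> changes the pairing by
        \<open>e * \<beta> ys w\<close>, which is the wanted \<open>c\<close>.\<close>
      define e where "e = c / \<beta> ys w"
      define z where "z = (\<chi> j. (smult e (fst (w $ j)), smult e (snd (w $ j))))"
      have zW: "z \<in> W" using w(1) by (auto simp: z_def W_def mem_Times_iff polys_below_closed)
      have "bij_betw (\<lambda>w'. w' + z) W W"
        by (rule bij_betw_byWitness[where f'="\<lambda>w'. w' - z"])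
           (use zW in \<open>auto simp: W_def mem_Times_iff intro!: polys_below_closed\<close>)
      moreover have "\<beta> ys (w' + z) = \<beta> ys w' + c" for w'
      proof -
        have "cf (w' + z) j i l = cf w' j i l + e * cf w j i l" for j i l
          by (simp add: cf_def z_def algebra_simps)
        hence "\<beta> ys (w' + z) = \<beta> ys w' + e * \<beta> ys w"
          by (simp add: \<beta>_def algebra_simps sum.distrib sum_distrib_left)
        thus ?thesis using w(2) by (simp add: e_def)
      qed
      ultimately show "\<exists>g. bij_betw g W W \<and> (\<forall>w'\<in>W. \<beta> ys (g w') = \<beta> ys w' + c)" by blast
    qed
  next
    fix w assume w: "w \<in> W" and "\<exists>ys\<in>V. \<beta> ys w \<noteq> 0"
    then obtain ys where "\<beta> ys w \<noteq> 0" by blast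
    then obtain j where "(\<Sum>i\<in>UNIV. \<Sum>l<d + u. cf w j i l * (ys ! l) $ i $ j) \<noteq> 0"
      unfolding \<beta>_def by (rule sum.not_neutral_contains_not_neutral)
    then obtain i where "(\<Sum>l<d + u. cf w j i l * (ys ! l) $ i $ j) \<noteq> 0"
      by (rule sum.not_neutral_contains_not_neutral)
    then obtain l where l: "l < d + u" "cf w j i l * (ys ! l) $ i $ j \<noteq> 0"
      by (rule sum.not_neutral_contains_not_neutral) auto
    hence cf0: "cf w j i l \<noteq> 0" by auto
    show "CARD('a) * card {ys\<in>V. \<beta> ys w = 0} = card V"
    proof (rule card_zero_fibre[OF finV])
      fix c
      \<comment> \<open>Only one entry of digit \<open>l\<close> is altered, the one that the
        pairing multiplies by the nonzero \<open>cf w j i l\<close>.\<close>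
      define z :: "'a ^ 'n ^ 'm" where "z = (\<chi> i' j'. if i' = i then if j' = j then c / cf w j i l else 0 else 0)"
      define g where "g ys = ys[l := ys ! l + z]" for ys
      have "bij_betw g V V"
        by (rule bij_betw_byWitness[where f'="\<lambda>ys. ys[l := ys ! l - z]"])
           (use l(1) in \<open>auto simp: g_def V_def\<close>)
      moreover have "\<beta> (g ys) w = \<beta> ys w + c" if "ys \<in> V" for ys
      proof -
        have "(\<Sum>l'<d + u. cf w j' i' l' * (g ys ! l') $ i' $ j') = (\<Sum>l'<d + u. cf w j' i' l' * (ys ! l') $ i' $ j')
           + (if i' = i then if j' = j then c else 0 else 0)" for i' j'
        proof -
          have "(\<Sum>l'<d + u. cf w j' i' l' * (g ys ! l') $ i' $ j') = (\<Sum>l'<d + u. cf w j' i' l' * (ys ! l') $ i' $ j'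
             + (if l' = l then cf w j' i' l * z $ i' $ j' else 0))"
            using that l(1) by (intro sum.cong) (auto simp: g_def V_def nth_list_update algebra_simps)
          also have "\<dots> = (\<Sum>l'<d + u. cf w j' i' l' * (ys ! l') $ i' $ j') + cf w j' i' l * z $ i' $ j'"
            using l(1) by (simp add: sum.distrib)
          finally show ?thesis using cf0 by (simp add: z_def)
        qed
        thus ?thesis by (simp add: \<beta>_def sum.distrib)
      qed
      ultimately show "\<exists>g. bij_betw g V V \<and> (\<forall>ys\<in>V. \<beta> (g ys) w = \<beta> ys w + c)" by blast
    qed
  qed
  note dual = this
  have A: "{ys. length ys = d + u \<and> sat d q u ys \<and> sat d q' u ys} \<subseteq> {ys\<in>V. \<forall>w\<in>W. \<beta> ys w = 0}"
  proof clarify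
    fix ys :: "('a ^ 'n ^ 'm) list" assume ys: "length ys = d + u" "sat d q u ys" "sat d q' u ys"
    have "\<beta> ys w = 0" if "w \<in> W" for w
    proof -
      have wj: "fst (w $ j) \<in> polys_below u" "snd (w $ j) \<in> polys_below u" for j
        using that by (auto simp: W_def mem_Times_iff)
      have "\<beta> ys w = (\<Sum>j\<in>UNIV. (\<Sum>i\<in>UNIV. \<Sum>l<d + u. coeff (fst (w $ j) * q $ i) l * (ys ! l) $ i $ j) +
         (\<Sum>i\<in>UNIV. \<Sum>l<d + u. coeff (snd (w $ j) * q' $ i) l * (ys ! l) $ i $ j))"
        by (simp add: \<beta>_def cf_def algebra_simps sum.distrib)
      also have "\<dots> = 0" using sat_imp_sum_eq_0[OF ys(2) wj(1) deg(1)] sat_imp_sum_eq_0[OF ys(3) wj(2) deg(2)]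
        by simp
      finally show ?thesis .
    qed
    with ys(1) show "ys \<in> V \<and> (\<forall>w\<in>W. \<beta> ys w = 0)" by (simp add: V_def)
  qed
  have B: "{w\<in>W. \<forall>ys\<in>V. \<beta> ys w = 0} \<subseteq> {w. \<forall>j. w $ j \<in> rel_kernel u q q'}"
  proof clarify
    fix w j assume w: "w \<in> W" "\<forall>ys\<in>V. \<beta> ys w = 0"
    have wj: "fst (w $ j) \<in> polys_below u" "snd (w $ j) \<in> polys_below u"
      using w by (auto simp: W_def mem_Times_iff)
    have "fst (w $ j) * q $ i + snd (w $ j) * q' $ i = 0" for i
    proof (rule poly_eqI)
      fix l
      show "coeff (fst (w $ j) * q $ i + snd (w $ j) * q' $ i) l = coeff 0 l"
      proof (cases "l < d + u")
        case True
        \<comment> \<open>A string with a single entry 1 reads off one coefficient.\<close>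
        define y :: "'a ^ 'n ^ 'm" where "y = (\<chi> i' j'. if i' = i then if j' = j then 1 else 0 else 0)"
        define ys where "ys = (replicate (d + u) (0 :: 'a ^ 'n ^ 'm))[l := y]"
        have "ys \<in> V" by (simp add: ys_def V_def)
        hence "\<beta> ys w = 0" using w(2) by blast
        moreover have "\<beta> ys w = cf w j i l"
        proof -
          have "(\<Sum>l'<d + u. cf w j' i' l' * (ys ! l') $ i' $ j') = (if i' = i then if j' = j then cf w j' i' l else 0 else 0)" for i' j'
          proof -
            have "(\<Sum>l'<d + u. cf w j' i' l' * (ys ! l') $ i' $ j') = (\<Sum>l'<d + u. if l' = l then cf w j' i' l * y $ i' $ j' else 0)"
              using True by (intro sum.cong) (auto simp: ys_def nth_list_update)
            also have "\<dots> = cf w j' i' l * y $ i' $ j'" using True by simp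
            finally show ?thesis by (simp add: y_def)
          qed
          thus ?thesis by (simp add: \<beta>_def)
        qed
        ultimately show ?thesis by (simp add: cf_def)
      next
        case False
        \<comment> \<open>From \<open>d + u\<close> on, coefficients vanish for reasons of
          degree.\<close>
        have z: "coeff (a * p) l = 0" if "a \<in> polys_below u" "degree p \<le> d" for a p :: "'a poly"
          unfolding coeff_mult
        proof (rule sum.neutral, rule ballI)
          fix v assume "v \<in> {..l}"
          show "coeff a v * coeff p (l - v) = 0"
          proof (cases "v < u")
            case True
            hence "coeff p (l - v) = 0" using False that(2) by (intro coeff_eq_0) simp
            thus ?thesis by simp
          qed (use that(1) in \<open>simp add: polys_below_def\<close>)
        qed
        show ?thesis using z[OF wj(1) deg(1)] z[OF wj(2) deg(2)] by simp
      qed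
    qed
    thus "w $ j \<in> rel_kernel u q q'" using wj by (cases "w $ j") (auto simp: rel_kernel_def)
  qed
  have "CARD('a) ^ (2 * u * CARD('n)) * card {ys :: ('a ^ 'n ^ 'm) list. length ys = d + u \<and> sat d q u ys \<and> sat d q' u ys}
     \<le> card W * card {ys\<in>V. \<forall>w\<in>W. \<beta> ys w = 0}"
    unfolding cardW using A finV by (intro mult_le_mono2 card_mono) auto
  also have "\<dots> = card V * card {w\<in>W. \<forall>ys\<in>V. \<beta> ys w = 0}" by (rule dual)
  also have "\<dots> \<le> card V * card {w :: ('a poly \<times> 'a poly) ^ 'n. \<forall>j. w $ j \<in> rel_kernel u q q'}"
    using B by (intro mult_le_mono2 card_mono finite_vec_components finite_rel_kernel)
  finally show ?thesis by (simp add: cardV card_vec_components)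
qed

section \<open>Energies of node masses\<close>

text \<open>Asking for a nonzero coefficient at \<open>d\<close>, rather than for a component of
  degree \<open>d\<close>, excludes the zero vector when \<open>d = 0\<close>.\<close>

definition exact_deg :: "nat \<Rightarrow> 'a::zero poly ^ 'm \<Rightarrow> bool" where
  "exact_deg d q \<longleftrightarrow> (\<forall>i. degree (q $ i) \<le> d) \<and> (\<exists>i. coeff (q $ i) d \<noteq> 0)"

text \<open>The average over \<^term>\<open>q \<in> Q\<close> of the uniform probability measures on $\{A : \|qA\| < k^{-r}\}$;
  on strings of length at most $d + r$ it does not depend on $r$.\<close>

definition node_mass :: "nat \<Rightarrow> ('a::{field,finite} poly ^ 'm) set \<Rightarrow> ('a ^ 'n ^ 'm) list \<Rightarrow> real" where
  "node_mass d Q ys = real CARD('a) ^ (CARD('n) * (length ys - d)) / real CARD('a ^ 'n ^ 'm) ^ length ys *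
     (real (card {q\<in>Q. sat d q (length ys - d) ys}) / real (card Q))"

context
  fixes d :: nat and Q :: "('a::{field,finite} poly ^ 'm) set"
  assumes finite_Q: "finite Q" and Q_nonempty: "Q \<noteq> {}" and Q_deg: "\<And>q. q \<in> Q \<Longrightarrow> exact_deg d q"
begin

lemma card_Q_pos: "card Q > 0"
  using finite_Q Q_nonempty by (simp add: card_gt_0_iff)

lemma node_mass_le_degree: "length ys \<le> d \<Longrightarrow>
    node_mass d Q (ys :: ('a ^ 'n ^ 'm) list) = 1 / real CARD('a ^ 'n ^ 'm) ^ length ys"
  using card_Q_pos by (simp add: node_mass_def sat_def)

text \<open>At depth less than \<open>d\<close> the measure is uniform. From depth \<open>d\<close>
  on, a vector satisfied at \<open>ys\<close> stays satisfied at the fraction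
  \<open>k ^ (- n)\<close> of the children, and the additional factor \<open>k ^ n\<close> in the
  density compensates for this.\<close>

lemma node_mass_additive:
  fixes ys :: "('a ^ 'n ^ 'm) list"
  shows "node_mass d Q ys = (\<Sum>y\<in>UNIV. node_mass d Q (ys @ [y]))"
proof (cases "length ys < d")
  case True
  have "card (UNIV :: ('a ^ 'n ^ 'm) set) > 0" by (rule finite_UNIV_card_ge_0) simp
  with True show ?thesis by (simp add: node_mass_le_degree del: CARD_vec)
next
  case False
  define u where "u = length ys - d"
  have len: "length ys = d + u" using False by (simp add: u_def)
  define N where "N = CARD('a ^ 'n ^ 'm)"
  have N: "N > 0" unfolding N_def by (rule finite_UNIV_card_ge_0) simp
  have card_ch: "CARD('a) ^ CARD('n) * card {y. lin_form d q (ys @ [y]) u = 0} = N" if q: "q \<in> Q" for q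
  proof -
    obtain i0 where "coeff (q $ i0) d \<noteq> 0" using Q_deg[OF q] by (auto simp: exact_deg_def)
    from card_sat_children[OF len this] show ?thesis by (simp only: N_def)
  qed
  have "(\<Sum>y\<in>UNIV. card {q\<in>Q. sat d q (Suc u) (ys @ [y])}) =
      (\<Sum>y\<in>UNIV. \<Sum>q\<in>Q. if sat d q u ys \<and> lin_form d q (ys @ [y]) u = 0 then 1 else 0)"
    using finite_Q by (intro sum.cong) (auto simp: sat_snoc[OF len] sum.If_cases Int_def)
  also have "\<dots> = (\<Sum>q\<in>Q. \<Sum>y\<in>UNIV. if sat d q u ys \<and> lin_form d q (ys @ [y]) u = 0 then 1 else 0)"
    by (rule sum.swap)
  also have "\<dots> = (\<Sum>q\<in>Q. if sat d q u ys then card {y. lin_form d q (ys @ [y]) u = 0} else 0)"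
    by (intro sum.cong) (auto simp: sum.If_cases)
  finally have "CARD('a) ^ CARD('n) * (\<Sum>y\<in>UNIV. card {q\<in>Q. sat d q (Suc u) (ys @ [y])}) =
     (\<Sum>q\<in>Q. if sat d q u ys then CARD('a) ^ CARD('n) * card {y. lin_form d q (ys @ [y]) u = 0} else 0)"
    by (simp add: sum_distrib_left if_distrib cong: if_cong)
  also have "\<dots> = (\<Sum>q\<in>Q. if sat d q u ys then N else 0)"
    by (intro sum.cong) (auto simp: card_ch)
  also have "\<dots> = N * card {q\<in>Q. sat d q u ys}"
    using finite_Q by (simp add: sum.If_cases Int_def)
  finally have key: "real CARD('a) ^ CARD('n) * (\<Sum>y\<in>UNIV. real (card {q\<in>Q. sat d q (Suc u) (ys @ [y])}))
      = real N * real (card {q\<in>Q. sat d q u ys})"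
    by (simp flip: of_nat_power of_nat_mult of_nat_sum)
  have "(\<Sum>y\<in>UNIV. node_mass d Q (ys @ [y])) = real CARD('a) ^ (CARD('n) * u) / real N ^ Suc (d + u) / real (card Q) *
     (real CARD('a) ^ CARD('n) * (\<Sum>y\<in>UNIV. real (card {q\<in>Q. sat d q (Suc u) (ys @ [y])})))"
    unfolding node_mass_def N_def[symmetric]
    by (simp add: len power_add sum_distrib_left algebra_simps Suc_diff_le del: CARD_vec)
  also have "\<dots> = node_mass d Q ys"
    unfolding key node_mass_def N_def[symmetric] using N by (simp add: len del: CARD_vec)
  finally show ?thesis ..
qed

text \<open>Expanding the square counts pairs of vectors satisfied at the same string;
  \<open>card_sat_pair\<close> turns each pair into a kernel size and
  \<open>sum_rel_kernel_le\<close> adds these up. The summand 1 comes from independent pairs, the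
  term with \<open>T\<close> is the excess due to proportional ones.\<close>

lemma sum_node_mass_sq_le:
  assumes T: "\<And>q i. q \<in> Q \<Longrightarrow> degree (q $ i) \<le> d \<Longrightarrow> q $ i \<noteq> 0 \<Longrightarrow> real (card (monic_divisors (q $ i))) \<le> T"
  shows "(\<Sum>ys | length ys = d + u. (node_mass d Q (ys :: ('a ^ 'n ^ 'm) list))\<^sup>2)
     \<le> (1 + T * real CARD('a) ^ (u * CARD('n) + 1) / real (card Q)) / real CARD('a ^ 'n ^ 'm) ^ (d + u)"
proof -
  define N where "N = CARD('a ^ 'n ^ 'm)"
  define k where "k = CARD('a)"
  define n where "n = CARD('n)"
  have N: "N > 0" unfolding N_def by (rule finite_UNIV_card_ge_0) simp
  have k: "k > 0" unfolding k_def by (rule finite_UNIV_card_ge_0) simp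
  have n: "n \<ge> 1" unfolding n_def by (simp add: Suc_leI)
  define Y where "Y = {ys :: ('a ^ 'n ^ 'm) list. length ys = d + u}"
  have finY: "finite Y" using finite_lists_length_eq[of "UNIV :: ('a ^ 'n ^ 'm) set" "d + u"] by (simp add: Y_def)
  have "(\<Sum>ys\<in>Y. (card {q\<in>Q. sat d q u ys})\<^sup>2) =
      (\<Sum>ys\<in>Y. \<Sum>q\<in>Q. \<Sum>q'\<in>Q. if sat d q u ys \<and> sat d q' u ys then 1 else 0)"
  proof (rule sum.cong)
    fix ys
    have "card {q\<in>Q. sat d q u ys} = (\<Sum>q\<in>Q. if sat d q u ys then 1 else 0)"
      using finite_Q by (simp add: sum.If_cases Int_def)
    hence "(card {q\<in>Q. sat d q u ys})\<^sup>2 =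
       (\<Sum>q\<in>Q. \<Sum>q'\<in>Q. (if sat d q u ys then 1 else 0) * (if sat d q' u ys then 1 else 0))"
      by (simp add: power2_eq_square sum_product)
    also have "\<dots> = (\<Sum>q\<in>Q. \<Sum>q'\<in>Q. if sat d q u ys \<and> sat d q' u ys then 1 else 0)"
      by (intro sum.cong) auto
    finally show "(card {q\<in>Q. sat d q u ys})\<^sup>2 = \<dots>" .
  qed simp
  also have "\<dots> = (\<Sum>q\<in>Q. \<Sum>ys\<in>Y. \<Sum>q'\<in>Q. if sat d q u ys \<and> sat d q' u ys then 1 else 0)"
    by (rule sum.swap)
  also have "\<dots> = (\<Sum>q\<in>Q. \<Sum>q'\<in>Q. \<Sum>ys\<in>Y. if sat d q u ys \<and> sat d q' u ys then 1 else 0)"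
    by (intro sum.cong refl) (rule sum.swap)
  also have "\<dots> = (\<Sum>q\<in>Q. \<Sum>q'\<in>Q. card {ys \<in> Y. sat d q u ys \<and> sat d q' u ys})"
    using finY by (intro sum.cong) (auto simp: sum.If_cases Int_def)
  finally have "k ^ (2 * u * n) * (\<Sum>ys\<in>Y. (card {q\<in>Q. sat d q u ys})\<^sup>2) =
      (\<Sum>q\<in>Q. \<Sum>q'\<in>Q. k ^ (2 * u * n) * card {ys \<in> Y. sat d q u ys \<and> sat d q' u ys})"
    by (simp add: sum_distrib_left)
  also have "\<dots> \<le> (\<Sum>q\<in>Q. \<Sum>q'\<in>Q. N ^ (d + u) * card (rel_kernel u q q') ^ n)"
  proof (intro sum_mono)
    fix q q' assume "q \<in> Q" "q' \<in> Q"
    hence "\<And>i. degree (q $ i) \<le> d" "\<And>i. degree (q' $ i) \<le> d" using Q_deg by (auto simp: exact_deg_def)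
    from card_sat_pair[OF this]
    show "k ^ (2 * u * n) * card {ys \<in> Y. sat d q u ys \<and> sat d q' u ys} \<le> N ^ (d + u) * card (rel_kernel u q q') ^ n"
      unfolding k_def n_def N_def Y_def by simp
  qed
  also have "\<dots> = N ^ (d + u) * (\<Sum>q\<in>Q. \<Sum>q'\<in>Q. card (rel_kernel u q q') ^ n)"
    by (simp add: sum_distrib_left)
  finally have 1: "k ^ (2 * u * n) * (\<Sum>ys\<in>Y. (card {q\<in>Q. sat d q u ys})\<^sup>2)
      \<le> N ^ (d + u) * (\<Sum>q\<in>Q. \<Sum>q'\<in>Q. card (rel_kernel u q q') ^ n)" .
  have "real (\<Sum>q\<in>Q. \<Sum>q'\<in>Q. card (rel_kernel u q q') ^ n) \<le> (\<Sum>q\<in>Q. real (card Q) + T * real k ^ (u * n + 1))"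
    unfolding of_nat_sum
  proof (rule sum_mono)
    fix q assume q: "q \<in> Q"
    then obtain i0 where i0: "coeff (q $ i0) d \<noteq> 0" and le: "degree (q $ i0) \<le> d"
      using Q_deg by (auto simp: exact_deg_def)
    hence i0': "degree (q $ i0) = d" "q $ i0 \<noteq> 0" using le_degree[OF i0] by auto
    have z: "0 \<notin> Q"
    proof
      assume "0 \<in> Q"
      from Q_deg[OF this] show False by (simp add: exact_deg_def)
    qed
    have "(\<Sum>q'\<in>Q. card (rel_kernel u q q') ^ n) \<le> card Q + card (monic_divisors (q $ i0)) * k ^ (u * n + 1)"
      unfolding k_def by (rule sum_rel_kernel_le[OF finite_Q n i0']) (use Q_deg z in \<open>auto simp: exact_deg_def\<close>)
    hence "real (\<Sum>q'\<in>Q. card (rel_kernel u q q') ^ n) \<le> real (card Q + card (monic_divisors (q $ i0)) * k ^ (u * n + 1))"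
      by (simp only: of_nat_le_iff)
    also have "\<dots> = real (card Q) + real (card (monic_divisors (q $ i0))) * real k ^ (u * n + 1)" by simp
    also have "\<dots> \<le> real (card Q) + T * real k ^ (u * n + 1)"
      using T[OF q le i0'(2)] by (intro add_left_mono mult_right_mono) auto
    finally show "(\<Sum>q'\<in>Q. real (card (rel_kernel u q q') ^ n)) \<le> real (card Q) + T * real k ^ (u * n + 1)"
      unfolding of_nat_sum .
  qed
  hence 2: "real (\<Sum>q\<in>Q. \<Sum>q'\<in>Q. card (rel_kernel u q q') ^ n) \<le> real (card Q) * (real (card Q) + T * real k ^ (u * n + 1))"
    by simp
  let ?S = "real (\<Sum>ys\<in>Y. (card {q\<in>Q. sat d q u ys})\<^sup>2)"
  have "real (k ^ (2 * u * n)) * ?S \<le> real (N ^ (d + u)) * real (\<Sum>q\<in>Q. \<Sum>q'\<in>Q. card (rel_kernel u q q') ^ n)"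
    using 1 by (simp only: of_nat_le_iff flip: of_nat_mult)
  also have "\<dots> \<le> real (N ^ (d + u)) * (real (card Q) * (real (card Q) + T * real k ^ (u * n + 1)))"
    by (rule mult_left_mono[OF 2]) simp
  finally have 3: "real k ^ (2 * u * n) * ?S \<le> real N ^ (d + u) * (real (card Q) * (real (card Q) + T * real k ^ (u * n + 1)))"
    by simp
  have "(\<Sum>ys\<in>Y. (node_mass d Q ys)\<^sup>2) = (\<Sum>ys\<in>Y. real k ^ (2 * u * n) / (real N ^ (d + u) * real (card Q))\<^sup>2 *
      real ((card {q\<in>Q. sat d q u ys})\<^sup>2))"
  proof (rule sum.cong)
    fix ys assume "ys \<in> Y"
    hence len: "length ys = d + u" by (simp add: Y_def)
    have "real k ^ (2 * u * n) = (real k ^ (n * u))\<^sup>2"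
      by (simp add: mult_ac flip: power_mult)
    thus "(node_mass d Q ys)\<^sup>2 = real k ^ (2 * u * n) / (real N ^ (d + u) * real (card Q))\<^sup>2 *
      real ((card {q\<in>Q. sat d q u ys})\<^sup>2)"
      unfolding node_mass_def N_def[symmetric] k_def[symmetric] n_def[symmetric]
      by (simp add: len power_mult_distrib power_divide del: CARD_vec)
  qed simp
  also have "\<dots> = (real k ^ (2 * u * n) * ?S) / (real N ^ (d + u) * real (card Q))\<^sup>2"
    by (simp add: sum_distrib_left sum_divide_distrib)
  also have "\<dots> \<le> (real N ^ (d + u) * (real (card Q) * (real (card Q) + T * real k ^ (u * n + 1)))) / (real N ^ (d + u) * real (card Q))\<^sup>2"
    by (rule divide_right_mono[OF 3]) simp
  also have "\<dots> = (1 + T * real k ^ (u * n + 1) / real (card Q)) / real N ^ (d + u)"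
    using N card_Q_pos by (simp add: field_simps power2_eq_square)
  finally show ?thesis by (simp only: Y_def k_def n_def N_def)
qed

end

text \<open>A discrete \<open>s\<close>-energy restricted to depths \<open>d\<close> to
  \<open>d + r\<close>, as the measure is uniform above them. The type argument fixes the number of
  columns, which \<open>Q\<close> does not determine.\<close>

definition energy :: "'n::finite itself \<Rightarrow> real \<Rightarrow> nat \<Rightarrow> nat \<Rightarrow> ('a::{field,finite} poly ^ 'm) set \<Rightarrow> real" where
  "energy _ s d r Q = (\<Sum>u\<le>r. real CARD('a) powr (s * real (d + u)) *
     (\<Sum>ys | length ys = d + u. (node_mass d Q (ys :: ('a ^ 'n ^ 'm) list))\<^sup>2))"

lemma real_card_mat: "real CARD('a::finite ^ 'n ^ 'm) ^ t = real CARD('a) powr (real (CARD('m) * CARD('n)) * real t)"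
proof -
  have "real CARD('a) > 0" by (simp add: finite_UNIV_card_ge_0)
  moreover have "real CARD('a ^ 'n ^ 'm) ^ t = real CARD('a) ^ (CARD('m) * CARD('n) * t)"
    by (simp add: mult_ac flip: power_mult)
  ultimately show ?thesis by (simp add: powr_realpow flip: of_nat_mult)
qed

lemma exists_point_in_limsup_avoiding_cover:
  fixes P :: "nat \<Rightarrow> 'a::{field,finite} poly ^ 'm \<Rightarrow> bool" and C :: "nat \<Rightarrow> ('a ^ 'n ^ 'm) list"
  assumes s: "0 < s" "s \<le> real (CARD('m) * CARD('n))"
    and energy: "\<And>\<epsilon> D. \<epsilon> > 0 \<Longrightarrow> \<exists>d\<ge>D. \<exists>r Q. finite Q \<and> Q \<noteq> {} \<and> (\<forall>q\<in>Q. exact_deg d q \<and> P r q) \<and>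
        energy TYPE('n) s d r Q \<le> \<epsilon>"
    and summable: "summable (\<lambda>i. real CARD('a) powr (- s * real (length (C i))))"
    and small: "(\<Sum>i. real CARD('a) powr (- s * real (length (C i)))) < 1 / 2"
  shows "\<exists>x. (\<forall>i. map x [0..<length (C i)] \<noteq> C i) \<and>
    (\<forall>D. \<exists>d\<ge>D. \<exists>q r. exact_deg d q \<and> P r q \<and> sat d q r (map x [0..<d + r]))"
proof -
  define k where "k = real CARD('a)"
  define N where "N = real CARD('a ^ 'n ^ 'm)"
  define w where "w t = k powr (- s * real t)" for t :: nat
  have k: "k > 1" using card_field_ge_2[where 'a='a] by (simp add: k_def)
  have N: "N > 0" unfolding N_def by (simp add: finite_UNIV_card_ge_0 del: CARD_vec)
  have w_pos: "w t > 0" for t using k by (simp add: w_def)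
  define Ev where "Ev D Z \<longleftrightarrow> (\<exists>d\<ge>D. \<exists>q r. exact_deg d q \<and> P r q \<and> sat d q r Z \<and> length Z = d + r)"
    for D and Z :: "('a ^ 'n ^ 'm) list"
  have "\<exists>x. (\<forall>i. map x [0..<length (C i)] \<noteq> C i) \<and> (\<forall>D. \<exists>t. Ev D (map x [0..<t]))"
  proof (rule exists_point_avoiding_cover[of w C Ev, OF w_pos])
    show "summable (\<lambda>i. w (length (C i)))" using summable by (simp add: w_def k_def)
    show "(\<Sum>i. w (length (C i))) < w 0 / 2" using small k by (simp add: w_def k_def)
    fix B :: "('a ^ 'n ^ 'm) list" and D :: nat
    define b where "b = length B"
    have "w b / N ^ (2 * b) > 0 " using w_pos N by simp
    \<comment> \<open>The tolerance anticipates that conditioning on \<open>B\<close> multiplies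
      squared masses by \<open>N ^ (2 * b)\<close> and that \<open>L = 1 / w b\<close> multiplies
      the error by \<open>w b\<close>.\<close>
    then obtain d r Q where d: "d \<ge> max D (Suc b)" and Q: "finite Q" "Q \<noteq> {}" "\<And>q. q \<in> Q \<Longrightarrow> exact_deg d q"
        "\<And>q. q \<in> Q \<Longrightarrow> P r q" and en: "energy TYPE('n) s d r Q \<le> 1 / (w b * N ^ (2 * b))"
      using energy[of "1 / (w b * N ^ (2 * b))" "max D (Suc b)"] w_pos[of b] N by auto
    define L where "L = 1 / w b"
    \<comment> \<open>The measure conditioned on \<open>B\<close>: as \<open>b < d\<close>, the node
      \<open>B\<close> has mass \<open>1 / N ^ b\<close>.\<close>
    define \<nu> where "\<nu> ys = N ^ b * node_mass d Q ys" for ys :: "('a ^ 'n ^ 'm) list"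
    define e where "e ys = (if length ys < d then 0 else (\<nu> ys)\<^sup>2 / (2 * (L * w (length ys))))" for ys
    have L: "L > 0" using w_pos by (simp add: L_def)
    have bd: "b < d" using d by simp
    have \<nu>_low: "\<nu> Z = 1 / N ^ (length Z - b)" if "length Z \<le> d" "prefix B Z" for Z
    proof -
      have "b \<le> length Z" using that(2) by (simp add: b_def prefix_length_le)
      thus ?thesis using N node_mass_le_degree[OF Q(1-3) that(1)]
        by (simp add: \<nu>_def N_def[symmetric] power_diff del: CARD_vec)
    qed
    have Lw: "L * w (length Z) > 0" for Z using L w_pos by simp
    have e0: "e Z \<ge> 0" for Z unfolding e_def using L w_pos by (auto intro!: divide_nonneg_nonneg simp: less_imp_le)
    \<comment> \<open>This follows from \<open>(\<nu> Z - L * w (length Z))\<^sup>2 \<ge> 0\<close>,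
      which is the origin of the square in \<open>e\<close>.\<close>
    have half: "\<nu> Z \<le> L * w (length Z) / 2 + e Z" if "length Z \<ge> d" for Z
    proof -
      have "0 \<le> (\<nu> Z - L * w (length Z))\<^sup>2" by simp
      hence "\<nu> Z * (2 * (L * w (length Z))) \<le> (\<nu> Z)\<^sup>2 + (L * w (length Z))\<^sup>2"
        by (simp add: power2_eq_square algebra_simps)
      hence "\<nu> Z \<le> ((\<nu> Z)\<^sup>2 + (L * w (length Z))\<^sup>2) / (2 * (L * w (length Z)))"
        using Lw[of Z] by (subst pos_le_divide_eq) simp_all
      also have "\<dots> = L * w (length Z) / 2 + (\<nu> Z)\<^sup>2 / (2 * (L * w (length Z)))"
        using Lw[of Z] L w_pos[of "length Z"] by (simp add: add_divide_distrib power2_eq_square)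
      finally show ?thesis using that by (simp add: e_def)
    qed
    \<comment> \<open>At depth less than \<open>d\<close> the measure is uniform, and
      \<open>s \<le> m * n\<close> gives the bound without any error.\<close>
    have low: "\<nu> Z \<le> L * w (length Z) + e Z" if Z: "prefix B Z" for Z
    proof (cases "length Z < d")
      case True
      have lb: "b \<le> length Z" using Z by (simp add: b_def prefix_length_le)
      have "N ^ (length Z - b) = k powr (real (CARD('m) * CARD('n)) * real (length Z - b))"
        unfolding N_def k_def by (rule real_card_mat)
      also have "\<dots> \<ge> k powr (s * real (length Z - b))"
        using k s by (intro powr_mono mult_right_mono) auto
      finally have "1 / N ^ (length Z - b) \<le> 1 / k powr (s * real (length Z - b))"
        using k by (intro divide_left_mono) (auto simp: N)
      also have "\<dots> = L * w (length Z)"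
        using lb by (simp add: L_def w_def of_nat_diff algebra_simps powr_diff powr_minus_divide)
      finally show ?thesis using \<nu>_low[OF _ Z] True e0[of Z] by simp
    next
      case False
      hence "\<nu> Z \<le> L * w (length Z) / 2 + e Z" by (intro half) simp
      also have "\<dots> \<le> L * w (length Z) + e Z" using Lw[of Z] by simp
      finally show ?thesis .
    qed
    have esum: "(\<Sum>Y | length Y \<le> d + r \<and> prefix B Y. e Y) \<le> 1 / 2"
    proof -
      have fin: "finite {Y :: ('a ^ 'n ^ 'm) list. length Y = t}" for t
        using finite_lists_length_eq_UNIV[of t "\<lambda>_. True"] by simp
      have "(\<Sum>Y | length Y \<le> d + r \<and> prefix B Y. e Y) = (\<Sum>Y | length Y \<le> d + r \<and> prefix B Y \<and> d \<le> length Y. e Y)"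
        by (rule sum.mono_neutral_right) (auto simp: finite_lists_length_le_UNIV e_def)
      also have "\<dots> \<le> (\<Sum>Y\<in>(\<Union>u\<in>{..r}. {Y. length Y = d + u}). e Y)"
      proof (rule sum_mono2)
        show "{Y. length Y \<le> d + r \<and> prefix B Y \<and> d \<le> length Y} \<subseteq> (\<Union>u\<in>{..r}. {Y. length Y = d + u})"
          by (auto simp: le_iff_add)
      qed (use e0 fin in auto)
      also have "\<dots> = (\<Sum>u\<le>r. \<Sum>Y | length Y = d + u. e Y)"
        by (rule sum.UNION_disjoint) (use fin in auto)
      also have "\<dots> = (\<Sum>u\<le>r. \<Sum>Y | length Y = d + u. w b * N ^ (2 * b) / 2 * (k powr (s * real (d + u)) * (node_mass d Q (Y :: ('a ^ 'n ^ 'm) list))\<^sup>2))"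
      proof (intro sum.cong refl)
        fix u and Y :: "('a ^ 'n ^ 'm) list" assume "Y \<in> {Y. length Y = d + u}"
        hence len: "length Y = d + u" by simp
        have "k powr (s * real (d + u)) = 1 / w (d + u)"
          using k by (simp add: w_def powr_minus_divide)
        thus "e Y = w b * N ^ (2 * b) / 2 * (k powr (s * real (d + u)) * (node_mass d Q Y)\<^sup>2)"
          unfolding e_def \<nu>_def L_def using len by (simp add: power_mult_distrib power_mult mult_ac)
      qed
      also have "\<dots> = w b * N ^ (2 * b) / 2 * energy TYPE('n) s d r Q"
        by (simp add: energy_def k_def[symmetric] sum_distrib_left mult_ac)
      also have "\<dots> \<le> w b * N ^ (2 * b) / 2 * (1 / (w b * N ^ (2 * b)))"
        using en w_pos[of b] N by (intro mult_left_mono) auto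
      also have "\<dots> = 1 / 2" using w_pos[of b] N by (simp add: field_simps)
      finally show ?thesis .
    qed
    show "\<exists>\<rho> \<nu> e L. length B < \<rho> \<and> L > 0 \<and> (\<forall>Z. e Z \<ge> (0::real)) \<and>
      (\<forall>Z. prefix B Z \<longrightarrow> length Z < \<rho> \<longrightarrow> \<nu> Z = (\<Sum>v\<in>UNIV. \<nu> (Z @ [v]))) \<and>
      (\<forall>Z. prefix B Z \<longrightarrow> length Z < \<rho> \<longrightarrow> \<nu> Z \<le> L * w (length Z) + e Z) \<and>
      (\<forall>Z. prefix B Z \<longrightarrow> length Z = \<rho> \<longrightarrow> \<nu> Z \<le> L * w \<rho> / 2 + e Z) \<and>
      \<nu> B = 1 \<and> L * w (length B) \<le> 1 \<and> (\<Sum>Y | length Y \<le> \<rho> \<and> prefix B Y. e Y) \<le> 1 / 2 \<and>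
      (\<forall>Z. prefix B Z \<longrightarrow> length Z = \<rho> \<longrightarrow> \<nu> Z > 0 \<longrightarrow> Ev D Z)"
    proof (rule exI[of _ "d + r"], rule exI[of _ \<nu>], rule exI[of _ e], rule exI[of _ L], intro conjI allI impI)
      show "length B < d + r" using bd by (simp add: b_def)
      show "\<nu> Z = (\<Sum>v\<in>UNIV. \<nu> (Z @ [v]))" for Z
        using node_mass_additive[OF Q(1-3), of Z] by (simp add: \<nu>_def sum_distrib_left)
      show "\<nu> Z \<le> L * w (d + r) / 2 + e Z" if "length Z = d + r" for Z using half[of Z] that by simp
      show "\<nu> B = 1" using \<nu>_low[of B] bd by (simp add: b_def)
      show "L * w (length B) \<le> 1" using w_pos[of b] by (simp add: L_def b_def)
      show "Ev D Z" if "length Z = d + r" "\<nu> Z > 0" for Z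
      proof -
        have "card {q\<in>Q. sat d q r Z} \<noteq> 0"
        proof
          assume "card {q\<in>Q. sat d q r Z} = 0"
          hence "\<nu> Z = 0" unfolding \<nu>_def node_mass_def using that(1) by simp
          with that(2) show False by simp
        qed
        hence "{q\<in>Q. sat d q r Z} \<noteq> {}" by (metis card.empty)
        then obtain q where "q \<in> Q" "sat d q r Z" by blast
        with Q d that(1) show ?thesis unfolding Ev_def by (metis max.bounded_iff)
      qed
    qed (use L e0 low esum in auto)
  qed
  then obtain x where x: "\<forall>i. map x [0..<length (C i)] \<noteq> C i" "\<And>D. \<exists>t. Ev D (map x [0..<t])" by blast
  have "\<exists>d\<ge>D. \<exists>q r. exact_deg d q \<and> P r q \<and> sat d q r (map x [0..<d + r])" for D
    using x(2)[of D] unfolding Ev_def by (metis diff_zero length_map length_upt)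
  with x(1) show ?thesis by blast
qed

section \<open>Choosing the degree and the approximation exponent\<close>

lemma geometric_sum_le:
  assumes "0 \<le> x" "x < (1::real)"
  shows "(\<Sum>u\<le>r. x ^ u) \<le> 1 / (1 - x)"
proof -
  have "(\<Sum>u\<le>r. x ^ u) \<le> (\<Sum>u. x ^ u)"
    using assms by (intro sum_le_suminf summable_geometric) auto
  thus ?thesis using assms by (simp add: suminf_geometric)
qed

lemma geometric_sum_le':
  assumes "x > (1::real)"
  shows "(\<Sum>u\<le>r. x ^ u) \<le> x / (x - 1) * x ^ r"
proof -
  have "(\<Sum>u\<le>r. x ^ u) = (x ^ Suc r - 1) / (x - 1)"
    using assms geometric_sum[of x "Suc r"] by (simp add: lessThan_Suc_atMost)
  also have "\<dots> \<le> x ^ Suc r / (x - 1)" using assms by (intro divide_right_mono) auto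
  finally show ?thesis by simp
qed

lemma powr_decay:
  assumes "k > (1::real)" "\<delta> > 0" "\<epsilon> > 0" "c \<ge> 0"
  obtains D0 :: nat where "\<And>d. d \<ge> D0 \<Longrightarrow> c * k powr (- \<delta> * real d) \<le> \<epsilon>"
proof -
  have "k powr (- \<delta>) < 1" using assms by (simp add: powr_less_one)
  hence "(\<lambda>d. c * (k powr (- \<delta>)) ^ d) \<longlonglongrightarrow> c * 0"
    using assms by (intro tendsto_intros LIMSEQ_realpow_zero) auto
  hence "eventually (\<lambda>d. c * (k powr (- \<delta>)) ^ d < \<epsilon>) sequentially"
    using assms by (intro order_tendstoD(2)) auto
  then obtain D0 where "\<And>d. d \<ge> D0 \<Longrightarrow> c * (k powr (- \<delta>)) ^ d < \<epsilon>"
    by (auto simp: eventually_sequentially)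
  moreover have "(k powr (- \<delta>)) ^ d = k powr (- \<delta> * real d)" for d
    using assms by (simp add: powr_powr flip: powr_realpow)
  ultimately show ?thesis using that by (metis less_imp_le)
qed

section \<open>Degrees of polynomial vectors and sufficient conditions for small energy\<close>

definition vdeg :: "'a::zero poly ^ 'm \<Rightarrow> nat" where
  "vdeg q = Max (range (\<lambda>i. degree (q $ i)))"

lemma degree_le_vdeg: "degree (q $ i) \<le> vdeg q"
  unfolding vdeg_def by (rule Max_ge) auto

lemma vdeg_attained: obtains i where "degree (q $ i) = vdeg q"
proof -
  have "vdeg q \<in> range (\<lambda>i. degree (q $ i))" unfolding vdeg_def by (rule Max_in) auto
  thus ?thesis using that by auto
qed

lemma exact_deg_vdeg: assumes "q \<noteq> 0" shows "exact_deg (vdeg q) q"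
proof -
  obtain i where i: "degree (q $ i) = vdeg q" by (rule vdeg_attained)
  have "\<exists>i. coeff (q $ i) (vdeg q) \<noteq> 0"
  proof (cases "vdeg q = 0")
    case True
    obtain j where "q $ j \<noteq> 0" using assms by (auto simp: vec_eq_iff)
    moreover have "degree (q $ j) = vdeg q" using degree_le_vdeg[of q j] True by simp
    ultimately show ?thesis by (metis leading_coeff_0_iff)
  next
    case False
    hence "q $ i \<noteq> 0" using i by auto
    thus ?thesis using i by (metis leading_coeff_0_iff)
  qed
  thus ?thesis by (simp add: exact_deg_def degree_le_vdeg)
qed

lemma exact_deg_unique: "exact_deg d q \<Longrightarrow> vdeg q = d"
proof -
  assume d: "exact_deg d q"
  then obtain i where "coeff (q $ i) d \<noteq> 0" by (auto simp: exact_deg_def)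
  hence "d \<le> degree (q $ i)" by (rule le_degree)
  moreover obtain j where "degree (q $ j) = vdeg q" by (rule vdeg_attained)
  ultimately show ?thesis using d degree_le_vdeg[of q i] unfolding exact_deg_def
    by (metis le_antisym le_trans)
qed

lemma finite_vdeg_less: "finite {q :: 'a::{field,finite} poly ^ 'm. vdeg q < D}"
proof (rule finite_subset)
  show "{q :: 'a poly ^ 'm. vdeg q < D} \<subseteq> {q. \<forall>i. q $ i \<in> polys_below (Suc D)}"
    using degree_le_vdeg by (fastforce simp: polys_below_iff intro: order_trans less_imp_le)
qed (intro finite_vec_components card_polys_below)

lemma vec_poly_abs_eq:
  fixes q :: "'a::{field,finite} poly ^ 'm"
  assumes "q \<noteq> 0"
  shows "vec_poly_abs q = real CARD('a) ^ vdeg q"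
  unfolding vec_poly_abs_def
proof (rule Max_eqI)
  have k: "real CARD('a) \<ge> 1" using card_field_ge_2[where 'a='a] by simp
  show "y \<le> real CARD('a) ^ vdeg q" if "y \<in> range (\<lambda>i. poly_abs (q $ i))" for y
    using that k degree_le_vdeg[of q] by (auto simp: poly_abs_def intro!: power_increasing)
  obtain i where i: "coeff (q $ i) (vdeg q) \<noteq> 0" using exact_deg_vdeg[OF assms] by (auto simp: exact_deg_def)
  hence "q $ i \<noteq> 0" by auto
  moreover have "degree (q $ i) = vdeg q" using le_degree[OF i] degree_le_vdeg[of q i] by simp
  ultimately show "real CARD('a) ^ vdeg q \<in> range (\<lambda>i. poly_abs (q $ i))"
    by (metis poly_abs_def rangeI)
qed simp

text \<open>With codimension \<open>\<theta>\<close>, dividing \<open>k powr (s * t)\<close> by the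
  number of nodes at depth \<open>t\<close> gives \<open>k powr (- \<theta> * t)\<close>. The
  geometric sum left over has ratio \<open>k powr (n - \<theta>)\<close>: bounded for
  \<open>\<theta> > n\<close>, comparable to its last term for \<open>\<theta> < n\<close>. The next
  two lemmas treat these cases.\<close>

lemma energy_le:
  fixes Q :: "('a::{field,finite} poly ^ 'm) set"
  assumes Q: "finite Q" "Q \<noteq> {}" "\<And>q. q \<in> Q \<Longrightarrow> exact_deg d q"
    and T: "\<And>q i. q \<in> Q \<Longrightarrow> degree (q $ i) \<le> d \<Longrightarrow> q $ i \<noteq> 0 \<Longrightarrow> real (card (monic_divisors (q $ i))) \<le> T"
    and \<theta>: "\<theta> > 0" "s = real (CARD('m) * CARD('n)) - \<theta>"
  shows "energy TYPE('n::finite) s d r Q \<le>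
     1 / (1 - real CARD('a) powr (- \<theta>)) * real CARD('a) powr (- \<theta> * real d) +
     T * real CARD('a) / real (card Q) * real CARD('a) powr (- \<theta> * real d) *
       (\<Sum>u\<le>r. (real CARD('a) powr (real CARD('n) - \<theta>)) ^ u)"
proof -
  define k where "k = real CARD('a)"
  define n where "n = CARD('n)"
  have k: "k > 1" using card_field_ge_2[where 'a='a] by (simp add: k_def)
  have "energy TYPE('n) s d r Q \<le> (\<Sum>u\<le>r. k powr (s * real (d + u)) *
     ((1 + T * k ^ (u * n + 1) / real (card Q)) / real CARD('a ^ 'n ^ 'm) ^ (d + u)))"
    unfolding energy_def k_def n_def
    by (intro sum_mono mult_left_mono sum_node_mass_sq_le Q T) auto
  also have "\<dots> = (\<Sum>u\<le>r. k powr (- \<theta> * real d) * (k powr (- \<theta>)) ^ u +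
     T * k / real (card Q) * k powr (- \<theta> * real d) * (k powr (real n - \<theta>)) ^ u)"
  proof (intro sum.cong refl)
    fix u
    have "k powr (s * real (d + u)) / real CARD('a ^ 'n ^ 'm) ^ (d + u) = k powr (- \<theta> * real (d + u))"
      unfolding real_card_mat k_def[symmetric] \<theta>(2) by (simp add: algebra_simps flip: powr_diff)
    hence 1: "k powr (s * real (d + u)) * ((1 + T * k ^ (u * n + 1) / real (card Q)) / real CARD('a ^ 'n ^ 'm) ^ (d + u))
       = k powr (- \<theta> * real (d + u)) * (1 + T * k ^ (u * n + 1) / real (card Q))"
      by (metis (no_types, lifting) mult.commute times_divide_eq_left times_divide_eq_right)
    have 2: "k powr (- \<theta> * real (d + u)) = k powr (- \<theta> * real d) * (k powr (- \<theta>)) ^ u"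
      using k by (simp add: powr_powr algebra_simps flip: powr_realpow powr_add)
    have 3: "(k powr (- \<theta>)) ^ u * k ^ (u * n + 1) = k * (k powr (real n - \<theta>)) ^ u"
      using k by (simp add: powr_powr algebra_simps flip: powr_realpow powr_add)
    show "k powr (s * real (d + u)) * ((1 + T * k ^ (u * n + 1) / real (card Q)) / real CARD('a ^ 'n ^ 'm) ^ (d + u))
      = k powr (- \<theta> * real d) * (k powr (- \<theta>)) ^ u +
     T * k / real (card Q) * k powr (- \<theta> * real d) * (k powr (real n - \<theta>)) ^ u" (is "_ = ?R")
    proof -
      have "k powr (- \<theta> * real d) * (k powr (- \<theta>)) ^ u * (1 + T * k ^ (u * n + 1) / real (card Q))
         = k powr (- \<theta> * real d) * (k powr (- \<theta>)) ^ u +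
           T / real (card Q) * k powr (- \<theta> * real d) * ((k powr (- \<theta>)) ^ u * k ^ (u * n + 1))"
        by (simp add: distrib_left mult_ac)
      also have "\<dots> = ?R" unfolding 3 by (simp add: mult_ac)
      finally show ?thesis unfolding 1 2 .
    qed
  qed
  also have "\<dots> = k powr (- \<theta> * real d) * (\<Sum>u\<le>r. (k powr (- \<theta>)) ^ u) +
     T * k / real (card Q) * k powr (- \<theta> * real d) * (\<Sum>u\<le>r. (k powr (real n - \<theta>)) ^ u)"
    by (simp add: sum.distrib sum_distrib_left)
  also have "\<dots> \<le> k powr (- \<theta> * real d) * (1 / (1 - k powr (- \<theta>))) +
     T * k / real (card Q) * k powr (- \<theta> * real d) * (\<Sum>u\<le>r. (k powr (real n - \<theta>)) ^ u)"
    using k \<theta> by (intro add_right_mono mult_left_mono geometric_sum_le) (auto simp: powr_less_one)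
  finally show ?thesis by (simp add: k_def n_def mult_ac)
qed

text \<open>The hypothesis on \<open>s\<close> says that the codimension exceeds \<open>n\<close>,
  so the energy of one vector is bounded uniformly in \<open>r\<close>, whence the arbitrary
  \<open>f\<close>, and decays in \<open>d\<close>. Half of the decay rate \<open>\<theta>\<close>
  pays for the divisor bound.\<close>

lemma energy_small_singleton:
  fixes S :: "('a::{field,finite} poly ^ 'm) set"
  assumes S: "infinite S" and s: "s < real CARD('n) * (real CARD('m) - 1)" and \<epsilon>: "\<epsilon> > 0"
  shows "\<exists>d\<ge>D. \<exists>q\<in>S. exact_deg d q \<and> energy TYPE('n::finite) s d (f q) {q} \<le> \<epsilon>"
proof -
  define k where "k = real CARD('a)"
  have k: "k > 1" using card_field_ge_2[where 'a='a] by (simp add: k_def)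
  define \<theta> where "\<theta> = real (CARD('m) * CARD('n)) - s"
  have \<theta>n: "\<theta> > real CARD('n)" using s by (simp add: \<theta>_def algebra_simps)
  hence \<theta>: "\<theta> > 0" "s = real (CARD('m) * CARD('n)) - \<theta>" by (auto simp: \<theta>_def intro: le_less_trans[rotated])
  obtain C where C: "C \<ge> 1" "\<And>q :: 'a poly. q \<noteq> 0 \<Longrightarrow> real (card (monic_divisors q)) \<le> C * k powr (\<theta> / 2 * real (degree q))"
    using divisor_bound[of "\<theta> / 2"] \<theta>(1) unfolding k_def by (metis half_gt_zero)
  define x where "x = k powr (real CARD('n) - \<theta>)"
  have x: "0 \<le> x" "x < 1" using \<theta>n k by (auto simp: x_def powr_less_one)
  obtain D1 where D1: "\<And>d. d \<ge> D1 \<Longrightarrow> 1 / (1 - k powr (- \<theta>)) * k powr (- \<theta> * real d) \<le> \<epsilon> / 2"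
    using powr_decay[of k \<theta> "\<epsilon> / 2" "1 / (1 - k powr (- \<theta>))"] k \<theta> \<epsilon> by (auto simp: powr_less_one less_imp_le)
  obtain D2 where D2: "\<And>d. d \<ge> D2 \<Longrightarrow> C * k * (1 / (1 - x)) * k powr (- (\<theta> / 2) * real d) \<le> \<epsilon> / 2"
    using powr_decay[of k "\<theta> / 2" "\<epsilon> / 2" "C * k * (1 / (1 - x))"] k \<theta> \<epsilon> x C by auto
  \<comment> \<open>The \<open>Suc\<close> keeps out the zero vector, whose \<open>vdeg\<close> is
    0.\<close>
  have "infinite (S - {q. vdeg q < Suc (max D (max D1 D2))})"
    using S finite_vdeg_less by (rule Diff_infinite_finite[rotated])
  then obtain q where q: "q \<in> S" "vdeg q \<ge> Suc (max D (max D1 D2))"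
    using not_finite_existsD by (metis (mono_tags, lifting) DiffE infinite_imp_nonempty all_not_in_conv mem_Collect_eq not_less)
  define d where "d = vdeg q"
  have "q \<noteq> 0" using q(2) by (auto simp: vdeg_def)
  hence ed: "exact_deg d q" unfolding d_def by (rule exact_deg_vdeg)
  have d: "d \<ge> D" "d \<ge> D1" "d \<ge> D2" using q(2) by (auto simp: d_def)
  have "energy TYPE('n) s d r {q} \<le> \<epsilon>" for r
  proof -
    have "energy TYPE('n) s d r {q} \<le> 1 / (1 - k powr (- \<theta>)) * k powr (- \<theta> * real d) +
       (C * k powr (\<theta> / 2 * real d)) * k / real (card {q}) * k powr (- \<theta> * real d) * (\<Sum>u\<le>r. x ^ u)"
      unfolding k_def x_def
    proof (rule energy_le[OF _ _ _ _ \<theta>])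
      fix q' :: "'a poly ^ 'm" and i assume *: "q' \<in> {q}" "degree (q' $ i) \<le> d" "q' $ i \<noteq> 0"
      have "real (card (monic_divisors (q' $ i))) \<le> C * k powr (\<theta> / 2 * real (degree (q' $ i)))"
        using C(2) *(3) .
      also have "\<dots> \<le> C * k powr (\<theta> / 2 * real d)"
        using *(2) C(1) k \<theta>(1) by (intro mult_left_mono powr_mono) auto
      finally show "real (card (monic_divisors (q' $ i))) \<le> C * real CARD('a) powr (\<theta> / 2 * real d)"
        by (simp add: k_def)
    qed (use ed in auto)
    also have "\<dots> \<le> \<epsilon> / 2 + (C * k powr (\<theta> / 2 * real d)) * k / real (card {q}) * k powr (- \<theta> * real d) * (1 / (1 - x))"
      using D1[OF d(2)] C k x by (intro add_mono mult_left_mono geometric_sum_le) auto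
    also have "(C * k powr (\<theta> / 2 * real d)) * k / real (card {q}) * k powr (- \<theta> * real d) * (1 / (1 - x))
        = C * k * (1 / (1 - x)) * (k powr (\<theta> / 2 * real d) * k powr (- \<theta> * real d))" by simp
    also have "k powr (\<theta> / 2 * real d) * k powr (- \<theta> * real d) = k powr (- (\<theta> / 2) * real d)"
      by (simp add: flip: powr_add)
    also have "\<epsilon> / 2 + C * k * (1 / (1 - x)) * k powr (- (\<theta> / 2) * real d) \<le> \<epsilon>"
      using D2[OF d(3)] by linarith
    finally show ?thesis .
  qed
  with q(1) ed d(1) show ?thesis by blast
qed

text \<open>By contraposition. If every admissible \<open>Q\<close> of large degree had energy above
  \<open>\<epsilon>\<close>, then \<open>card Q\<close> would be at most a constant times
  \<open>k powr (\<delta> / 2 * d - n * d + \<eta> * (d + r))\<close>. A term of the series with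
  degree \<open>d\<close> and exponent \<open>r\<close> is at most a constant times
  \<open>k powr (n * d - \<eta>2 * (d + r))\<close>, so the cell \<open>(d, r)\<close> contributes
  \<open>k powr (- \<delta> / 2 * d - \<delta> * r)\<close> up to a constant, and the series would
  converge.\<close>

lemma energy_small_of_divergent_sum:
  fixes \<psi> :: "'a::{field,finite} poly ^ 'm \<Rightarrow> real" and rt :: "'a poly ^ 'm \<Rightarrow> nat"
  assumes \<psi>: "\<And>q. \<psi> q \<ge> 0" "\<And>q. \<psi> q \<le> B * real CARD('a) powr (- real (rt q))" and B: "B > 0"
    and \<eta>: "0 < \<eta>" "\<eta> < \<eta>2" "\<eta> < real CARD('n)" and s: "s = real (CARD('m) * CARD('n)) - (real CARD('n) - \<eta>)"
    and div: "\<not> (\<lambda>q. vec_poly_abs q ^ CARD('n) * (\<psi> q / vec_poly_abs q) powr \<eta>2) summable_on (UNIV - {0})"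
    and \<epsilon>: "\<epsilon> > 0"
  shows "\<exists>d\<ge>D. \<exists>r Q. finite Q \<and> Q \<noteq> {} \<and> (\<forall>q\<in>Q. exact_deg d q \<and> rt q = r \<and> \<psi> q > 0) \<and>
     energy TYPE('n::finite) s d r Q \<le> \<epsilon>"
proof (rule ccontr)
  assume neg: "\<not> ?thesis"
  define k where "k = real CARD('a)"
  define n where "n = real CARD('n)"
  have k: "k > 1" using card_field_ge_2[where 'a='a] by (simp add: k_def)
  define \<theta> where "\<theta> = n - \<eta>"
  have \<theta>: "\<theta> > 0" "s = real (CARD('m) * CARD('n)) - \<theta>" using \<eta> s by (auto simp: \<theta>_def n_def)
  \<comment> \<open>Half of this gap absorbs the divisor bound, the other half makes the sum over
    \<open>d\<close> converge.\<close>
  define \<delta> where "\<delta> = \<eta>2 - \<eta>"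
  have \<delta>: "\<delta> > 0" using \<eta> by (simp add: \<delta>_def)
  obtain C where C: "C \<ge> 1" "\<And>q :: 'a poly. q \<noteq> 0 \<Longrightarrow> real (card (monic_divisors q)) \<le> C * k powr (\<delta> / 2 * real (degree q))"
    using divisor_bound[of "\<delta> / 2"] \<delta>(1) unfolding k_def by (metis half_gt_zero)
  define x where "x = k powr \<eta>"
  have x: "x > 1" unfolding x_def using gr_one_powr[OF k \<eta>(1)] .
  obtain D1 where D1: "\<And>d. d \<ge> D1 \<Longrightarrow> 1 / (1 - k powr (- \<theta>)) * k powr (- \<theta> * real d) \<le> \<epsilon> / 2"
    using powr_decay[of k \<theta> "\<epsilon> / 2" "1 / (1 - k powr (- \<theta>))"] k \<theta> \<epsilon> by (auto simp: powr_less_one less_imp_le)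
  \<comment> \<open>From this degree on the uniform part of the energy is at most
    \<open>\<epsilon> / 2\<close>, so proportional pairs must account for the rest.\<close>
  define D' where "D' = max D D1"
  define M where "M = 2 / \<epsilon> * C * k * (x / (x - 1))"
  have M: "M \<ge> 0" using \<epsilon> C k x by (simp add: M_def)
  have cardQ: "real (card Q) \<le> M * k powr (\<delta> / 2 * real d - n * real d + \<eta> * real (d + r))"
    if Q: "finite Q" "\<And>q. q \<in> Q \<Longrightarrow> exact_deg d q \<and> rt q = r \<and> \<psi> q > 0" and d: "d \<ge> D'" for Q d r
  proof (cases "Q = {}")
    case True
    thus ?thesis using M by simp
  next
    case False
    have cQ: "real (card Q) > 0" using Q False by (simp add: card_gt_0_iff)
    define T where "T = C * k powr (\<delta> / 2 * real d)"
    have "\<epsilon> < energy TYPE('n) s d r Q"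
    proof (rule ccontr)
      assume "\<not> ?thesis"
      hence le: "energy TYPE('n) s d r Q \<le> \<epsilon>" by simp
      have "D \<le> d" using d by (simp add: D'_def)
      moreover have "\<forall>q\<in>Q. exact_deg d q \<and> rt q = r \<and> \<psi> q > 0" using Q(2) by blast
      ultimately show False using neg le Q(1) False by blast
    qed
    also have "\<dots> \<le> 1 / (1 - k powr (- \<theta>)) * k powr (- \<theta> * real d) +
       T * k / real (card Q) * k powr (- \<theta> * real d) * (\<Sum>u\<le>r. (k powr (real CARD('n) - \<theta>)) ^ u)"
      unfolding k_def
    proof (rule energy_le[OF Q(1) False _ _ \<theta>])
      fix q' :: "'a poly ^ 'm" and i assume *: "q' \<in> Q" "degree (q' $ i) \<le> d" "q' $ i \<noteq> 0"
      have "real (card (monic_divisors (q' $ i))) \<le> C * k powr (\<delta> / 2 * real (degree (q' $ i)))"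
        using C(2) *(3) .
      also have "\<dots> \<le> T" unfolding T_def
        using *(2) C(1) k \<delta>(1) by (intro mult_left_mono powr_mono) auto
      finally show "real (card (monic_divisors (q' $ i))) \<le> T" .
    qed (use Q in auto)
    also have "k powr (real CARD('n) - \<theta>) = x" by (simp add: x_def \<theta>_def n_def)
    finally have "\<epsilon> < 1 / (1 - k powr (- \<theta>)) * k powr (- \<theta> * real d) +
       T * k / real (card Q) * k powr (- \<theta> * real d) * (\<Sum>u\<le>r. x ^ u)" .
    moreover have "1 / (1 - k powr (- \<theta>)) * k powr (- \<theta> * real d) \<le> \<epsilon> / 2"
      using D1 d by (simp add: D'_def)
    ultimately have "\<epsilon> / 2 \<le> T * k / real (card Q) * k powr (- \<theta> * real d) * (\<Sum>u\<le>r. x ^ u)" by linarith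
    also have "\<dots> \<le> T * k / real (card Q) * k powr (- \<theta> * real d) * (x / (x - 1) * x ^ r)"
      using C k x by (intro mult_left_mono geometric_sum_le') (auto simp: T_def)
    finally have "real (card Q) * (\<epsilon> / 2) \<le> real (card Q) * (T * k / real (card Q) * k powr (- \<theta> * real d) * (x / (x - 1) * x ^ r))"
      using cQ by (intro mult_left_mono) auto
    also have "\<dots> = T * k * k powr (- \<theta> * real d) * (x / (x - 1) * x ^ r)" using cQ by simp
    finally have half: "real (card Q) * (\<epsilon> / 2) \<le> T * k * k powr (- \<theta> * real d) * (x / (x - 1) * x ^ r)" .
    have "a \<le> 2 / \<epsilon> * X" if "a * (\<epsilon> / 2) \<le> X" for a X :: real
      using that \<epsilon> by (simp add: field_simps)
    from this[OF half] have "real (card Q) \<le> 2 / \<epsilon> * (T * k * k powr (- \<theta> * real d) * (x / (x - 1) * x ^ r))" .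
    also have "\<dots> = M * (k powr (\<delta> / 2 * real d) * k powr (- \<theta> * real d) * x ^ r)"
      by (simp add: M_def T_def)
    also have "x ^ r = k powr (\<eta> * real r)" using k by (simp add: x_def powr_powr flip: powr_realpow)
    also have "k powr (\<delta> / 2 * real d) * k powr (- \<theta> * real d) * k powr (\<eta> * real r) =
        k powr (\<delta> / 2 * real d - n * real d + \<eta> * real (d + r))"
      by (simp add: \<theta>_def algebra_simps flip: powr_add)
    finally show ?thesis .
  qed
  define f where "f q = vec_poly_abs q ^ CARD('n) * (\<psi> q / vec_poly_abs q) powr \<eta>2" for q
  have abs0: "vec_poly_abs q \<ge> 0" for q :: "'a poly ^ 'm"
    unfolding vec_poly_abs_def by (rule order_trans[OF _ Max_ge[OF _ rangeI]]) (auto simp: poly_abs_def)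
  have f0: "f q \<ge> 0" for q unfolding f_def using abs0 by simp
  have fle: "f q \<le> B powr \<eta>2 * k powr (n * real (vdeg q) - \<eta>2 * real (vdeg q + rt q))" if "q \<noteq> 0" for q
  proof -
    have v: "vec_poly_abs q = k powr real (vdeg q)" using k that by (simp add: vec_poly_abs_eq k_def powr_realpow)
    have "\<psi> q / vec_poly_abs q \<le> B * k powr (- real (rt q)) / k powr real (vdeg q)"
      unfolding v using \<psi>(2)[of q] by (intro divide_right_mono) (auto simp: k_def)
    also have "\<dots> = B * k powr (- real (vdeg q + rt q))"
      by (simp add: powr_minus powr_diff divide_simps)
    finally have "(\<psi> q / vec_poly_abs q) powr \<eta>2 \<le> (B * k powr (- real (vdeg q + rt q))) powr \<eta>2"
      using \<eta> \<psi>(1)[of q] abs0 by (intro powr_mono2) auto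
    also have "\<dots> = B powr \<eta>2 * k powr (- \<eta>2 * real (vdeg q + rt q))"
    proof -
      have "- real (vdeg q + rt q) * \<eta>2 = - \<eta>2 * real (vdeg q + rt q)" by (simp add: algebra_simps)
      thus ?thesis using B by (simp only: powr_mult powr_powr less_imp_le powr_ge_zero)
    qed
    finally have "f q \<le> vec_poly_abs q ^ CARD('n) * (B powr \<eta>2 * k powr (- \<eta>2 * real (vdeg q + rt q)))"
      unfolding f_def using abs0 by (intro mult_left_mono) auto
    also have "vec_poly_abs q ^ CARD('n) = k powr (n * real (vdeg q))"
      unfolding v using k by (simp add: n_def powr_powr mult_ac flip: powr_realpow)
    also have "k powr (n * real (vdeg q)) * (B powr \<eta>2 * k powr (- \<eta>2 * real (vdeg q + rt q))) =
       B powr \<eta>2 * k powr (n * real (vdeg q) - \<eta>2 * real (vdeg q + rt q))"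
      by (simp add: powr_add[symmetric] mult.left_commute algebra_simps)
    finally show ?thesis .
  qed
  define M2 where "M2 = M * B powr \<eta>2"
  define G1 where "G1 = 1 / (1 - k powr (- \<delta> / 2))"
  define G2 where "G2 = 1 / (1 - k powr (- \<delta>))"
  have "bdd_above (sum f ` {F. F \<subseteq> UNIV - {0} \<and> finite F})"
  proof (rule bdd_aboveI2)
    fix F :: "('a poly ^ 'm) set" assume "F \<in> {F. F \<subseteq> UNIV - {0} \<and> finite F}"
    hence F: "finite F" "0 \<notin> F" by auto
    define F2 where "F2 = {q\<in>F. vdeg q \<ge> D'}"
    have finF2: "finite F2" using F by (simp add: F2_def)
    define R where "R = Max (insert 0 ((\<lambda>q. max (vdeg q) (rt q)) ` F2))"
    have R: "vdeg q \<le> R \<and> rt q \<le> R" if "q \<in> F2" for q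
    proof -
      have "max (vdeg q) (rt q) \<le> R" unfolding R_def using finF2 that by (intro Max_ge) auto
      thus ?thesis by simp
    qed
    have cell: "sum f {q\<in>F2. (vdeg q, rt q) = y} \<le> M2 * ((k powr (- \<delta> / 2)) ^ fst y * (k powr (- \<delta>)) ^ snd y)" for y
    proof -
      obtain d r where y: "y = (d, r)" by fastforce
      \<comment> \<open>Vectors with \<open>\<psi> q = 0\<close> are dropped: their terms vanish,
        and \<open>neg\<close> concerns positive values only.\<close>
      define Q where "Q = {q\<in>F2. vdeg q = d \<and> rt q = r \<and> \<psi> q > 0}"
      define c where "c = B powr \<eta>2 * k powr (n * real d - \<eta>2 * real (d + r))"
      have "sum f {q\<in>F2. (vdeg q, rt q) = y} = sum f Q"
      proof (rule sum.mono_neutral_right)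
        show "\<forall>q\<in>{q \<in> F2. (vdeg q, rt q) = y} - Q. f q = 0"
        proof
          fix q assume "q \<in> {q \<in> F2. (vdeg q, rt q) = y} - Q"
          hence "\<not> \<psi> q > 0" by (auto simp: Q_def y)
          hence "\<psi> q = 0" using \<psi>(1)[of q] by simp
          thus "f q = 0" by (simp add: f_def)
        qed
      qed (auto simp: Q_def y finF2)
      also have "\<dots> \<le> (\<Sum>q\<in>Q. c)"
      proof (rule sum_mono)
        fix q assume "q \<in> Q"
        hence "q \<noteq> 0" "vdeg q = d" "rt q = r" using F by (auto simp: Q_def F2_def)
        with fle[of q] show "f q \<le> c" by (simp add: c_def)
      qed
      also have "\<dots> = real (card Q) * c" by simp
      also have "\<dots> \<le> M2 * ((k powr (- \<delta> / 2)) ^ d * (k powr (- \<delta>)) ^ r)"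
      proof (cases "Q = {}")
        case True
        thus ?thesis using M by (simp add: M2_def)
      next
        case False
        then obtain q where "q \<in> Q" by blast
        hence dD: "d \<ge> D'" by (auto simp: Q_def F2_def)
        have ed: "exact_deg d q \<and> rt q = r \<and> \<psi> q > 0" if "q \<in> Q" for q
        proof -
          have "q \<noteq> 0" using that F by (auto simp: Q_def F2_def)
          thus ?thesis using that exact_deg_vdeg[of q] by (auto simp: Q_def)
        qed
        have "finite Q" using finF2 by (simp add: Q_def)
        from cardQ[OF this ed dD]
        have "real (card Q) * c \<le> M * k powr (\<delta> / 2 * real d - n * real d + \<eta> * real (d + r)) * c"
          by (intro mult_right_mono) (auto simp: c_def)
        also have "\<dots> = M2 * (k powr (\<delta> / 2 * real d - n * real d + \<eta> * real (d + r)) * k powr (n * real d - \<eta>2 * real (d + r)))"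
          by (simp add: c_def M2_def)
        also have "k powr (\<delta> / 2 * real d - n * real d + \<eta> * real (d + r)) * k powr (n * real d - \<eta>2 * real (d + r))
            = k powr (- \<delta> / 2 * real d) * k powr (- \<delta> * real r)"
          by (simp add: \<delta>_def algebra_simps flip: powr_add) (simp add: field_simps)
        also have "k powr (- \<delta> / 2 * real d) * k powr (- \<delta> * real r) = (k powr (- \<delta> / 2)) ^ d * (k powr (- \<delta>)) ^ r"
          using k by (simp add: powr_powr flip: powr_realpow)
        finally show ?thesis .
      qed
      finally show ?thesis by (simp add: y)
    qed
    have "sum f F = sum f (F - F2) + sum f F2"
      using F by (intro sum.subset_diff) (auto simp: F2_def)
    \<comment> \<open>Degrees below \<open>D'\<close> escape the bound on \<open>card Q\<close>, but
      only finitely many vectors have them.\<close>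
    also have "sum f (F - F2) \<le> sum f {q. vdeg q < D'}"
      using f0 by (intro sum_mono2 finite_vdeg_less) (auto simp: F2_def)
    also have "sum f F2 = (\<Sum>y\<in>{..R} \<times> {..R}. sum f {q\<in>F2. (vdeg q, rt q) = y})"
      by (rule sum.group[symmetric]) (use finF2 R in auto)
    also have "\<dots> \<le> (\<Sum>y\<in>{..R} \<times> {..R}. M2 * ((k powr (- \<delta> / 2)) ^ fst y * (k powr (- \<delta>)) ^ snd y))"
      by (rule sum_mono) (rule cell)
    also have "\<dots> = M2 * ((\<Sum>d\<le>R. (k powr (- \<delta> / 2)) ^ d) * (\<Sum>r\<le>R. (k powr (- \<delta>)) ^ r))"
      unfolding sum_product sum.cartesian_product by (simp add: split_beta sum_distrib_left)
    also have "\<dots> \<le> M2 * (G1 * G2)"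
      unfolding G1_def G2_def using M \<delta> k
      by (intro mult_left_mono mult_mono geometric_sum_le)
         (auto simp: M2_def powr_less_one less_imp_le intro!: sum_nonneg)
    finally show "sum f F \<le> sum f {q. vdeg q < D'} + M2 * (G1 * G2)" by simp
  qed
  hence "f summable_on (UNIV - {0})" using f0 by (intro nonneg_bdd_above_summable_on) auto
  with div show False by (simp add: f_def[abs_def])
qed

section \<open>Matrices of Laurent series and their digits\<close>

lemma poly_to_lx_nth: "fls_nth (poly_to_lx p) j = (if j \<le> 0 then coeff p (nat (- j)) else 0)"
  unfolding poly_to_lx_def
  by (rule nth_Abs_fls_lower_bound[of "- int (degree p)"]) (auto intro: coeff_eq_0)

lemma poly_to_lx_times_nth:
  fixes f :: "'a::comm_ring_1 fls"
  assumes "degree p \<le> d"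
  shows "fls_nth (poly_to_lx p * f) n = (\<Sum>c\<le>d. coeff p c * fls_nth f (n + int c))"
proof -
  have "poly_to_lx p = (\<Sum>c\<le>d. fls_shift (int c) (fls_const (coeff p c)))"
  proof (rule fls_eqI)
    fix j
    have "fls_nth (\<Sum>c\<le>d. fls_shift (int c) (fls_const (coeff p c))) j =
       (\<Sum>c\<le>d. if c = nat (- j) \<and> j \<le> 0 then coeff p c else 0)"
      unfolding fls_nth_sum by (intro sum.cong) (auto simp: fls_shift_const_nth)
    also have "\<dots> = (if j \<le> 0 then (\<Sum>c\<le>d. if c = nat (- j) then coeff p c else 0) else 0)"
      by (auto intro!: sum.cong)
    also have "\<dots> = fls_nth (poly_to_lx p) j"
      using assms by (auto simp: poly_to_lx_nth intro!: coeff_eq_0)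
    finally show "fls_nth (poly_to_lx p) j = fls_nth (\<Sum>c\<le>d. fls_shift (int c) (fls_const (coeff p c))) j" ..
  qed
  thus ?thesis by (simp add: sum_distrib_right fls_nth_sum fls_shifted_times_simps)
qed

text \<open>Nonpositive exponents of \<open>T = X^(-1)\<close> are nonnegative exponents of
  \<open>X\<close>, and only finitely many of them occur.\<close>

lemma exists_poly_part:
  fixes f :: "'a::comm_ring_1 fls"
  obtains p where "\<And>l. l \<le> 0 \<Longrightarrow> fls_nth (poly_to_lx p) l = fls_nth f l"
proof -
  obtain K where K: "\<And>n. n < K \<Longrightarrow> fls_nth f n = 0" using fls_nth_vanishes_belowE by blast
  define p where "p = Poly (map (\<lambda>c. fls_nth f (- int c)) [0..<nat (1 - K)])"
  have "fls_nth (poly_to_lx p) l = fls_nth f l" if "l \<le> 0" for l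
    using that K[of l] by (auto simp: poly_to_lx_nth p_def nth_default_def)
  thus ?thesis using that by blast
qed

text \<open>A nonzero \<open>f\<close> has absolute value \<open>k powr (- e)\<close> with
  \<open>e\<close> its subdegree, so the strict inequality means \<open>r < e\<close>.\<close>

lemma lx_abs_less_iff:
  fixes f :: "'a::{field,finite} fls"
  shows "lx_abs f < real CARD('a) powr (- real_of_int r) \<longleftrightarrow> (\<forall>l\<le>r. fls_nth f l = 0)"
proof -
  have k: "real CARD('a) > 1" using card_field_ge_2[where 'a='a] by simp
  show ?thesis
  proof (cases "f = 0")
    case False
    have "lx_abs f < real CARD('a) powr (- real_of_int r) \<longleftrightarrow> r < fls_subdegree f"
      using False k by (simp add: lx_abs_def)
    also have "\<dots> \<longleftrightarrow> (\<forall>l\<le>r. fls_nth f l = 0)"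
    proof
      assume "\<forall>l\<le>r. fls_nth f l = 0"
      thus "r < fls_subdegree f" using nth_fls_subdegree_nonzero[OF False] not_le by blast
    qed auto
    finally show ?thesis .
  qed (use k in \<open>simp add: lx_abs_def\<close>)
qed

lemma vec_lx_abs_less_iff:
  fixes v :: "'a::{field,finite} fls ^ 'n"
  shows "vec_lx_abs v < real CARD('a) powr (- real_of_int r) \<longleftrightarrow> (\<forall>j. \<forall>l\<le>r. fls_nth (v $ j) l = 0)"
  unfolding vec_lx_abs_def by (subst Max_less_iff) (auto simp: lx_abs_less_iff)

lemma vec_lx_abs_nonneg: "vec_lx_abs v \<ge> 0"
proof -
  have "0 \<le> lx_abs (v $ undefined)" by (simp add: lx_abs_def)
  also have "\<dots> \<le> vec_lx_abs v" unfolding vec_lx_abs_def by (intro Max_ge) auto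
  finally show ?thesis .
qed

lemma mat_lx_abs_less_iff:
  fixes A :: "'a::{field,finite} fls ^ 'n ^ 'm"
  shows "mat_lx_abs A < real CARD('a) powr (- real_of_int r) \<longleftrightarrow> (\<forall>i j. \<forall>l\<le>r. fls_nth (A $ i $ j) l = 0)"
  unfolding mat_lx_abs_def by (subst Max_less_iff) (auto simp: lx_abs_less_iff)

text \<open>A polynomial vector can match all nonpositive exponents and touches no others, so the
  exponents from 1 to \<open>r\<close> decide. Strictness lets a member of the set replace the
  infimum.\<close>

lemma dist_polys_less_iff:
  fixes v :: "'a::{field,finite} fls ^ 'n"
  shows "dist_polys v < real CARD('a) powr (- real r) \<longleftrightarrow> (\<forall>j. \<forall>l. 1 \<le> l \<and> l \<le> int r \<longrightarrow> fls_nth (v $ j) l = 0)"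
proof -
  let ?S = "{vec_lx_abs (v - (\<chi> j. poly_to_lx (P $ j))) | P :: 'a poly ^ 'n. True}"
  have "bdd_below ?S"
    by (rule bdd_belowI[of _ 0]) (auto simp: vec_lx_abs_nonneg)
  hence "dist_polys v < real CARD('a) powr (- real r) \<longleftrightarrow> (\<exists>x\<in>?S. x < real CARD('a) powr (- real r))"
    unfolding dist_polys_def by (intro cInf_less_iff) auto
  also have "\<dots> \<longleftrightarrow> (\<exists>P :: 'a poly ^ 'n. \<forall>j. \<forall>l\<le>int r. fls_nth (v $ j) l = fls_nth (poly_to_lx (P $ j)) l)"
    using vec_lx_abs_less_iff[where r="int r" and 'a='a and 'n='n] by auto
  also have "\<dots> \<longleftrightarrow> (\<forall>j. \<forall>l. 1 \<le> l \<and> l \<le> int r \<longrightarrow> fls_nth (v $ j) l = 0)" (is "_ \<longleftrightarrow> ?R")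
  proof
    assume ?R
    have "\<forall>j. \<exists>p. \<forall>l\<le>0. fls_nth (poly_to_lx p) l = fls_nth (v $ j) l"
      using exists_poly_part by metis
    then obtain P where P: "\<And>j l. l \<le> 0 \<Longrightarrow> fls_nth (poly_to_lx (P j)) l = fls_nth (v $ j) l" by metis
    have "fls_nth (v $ j) l = fls_nth (poly_to_lx ((\<chi> j. P j) $ j)) l" if "l \<le> int r" for j l
      using that P[of l j] \<open>?R\<close> by (cases "l \<le> 0") (auto simp: poly_to_lx_nth)
    thus "\<exists>P :: 'a poly ^ 'n. \<forall>j. \<forall>l\<le>int r. fls_nth (v $ j) l = fls_nth (poly_to_lx (P $ j)) l" by blast
  qed (auto simp: poly_to_lx_nth)
  finally show ?thesis .
qed

definition in_unit :: "'a::zero fls ^ 'n ^ 'm \<Rightarrow> bool" where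
  "in_unit A \<longleftrightarrow> (\<forall>i j. \<forall>l\<le>0. fls_nth (A $ i $ j) l = 0)"

text \<open>Position \<open>l\<close> holds the coefficient of \<open>X^(-(l+1))\<close>; in the
  unit ball, agreement of the first \<open>t\<close> digits is then the same as distance less than
  \<open>k powr (- t)\<close>.\<close>

definition digits :: "'a::zero fls ^ 'n ^ 'm \<Rightarrow> nat \<Rightarrow> 'a ^ 'n ^ 'm" where
  "digits A l = (\<chi> i j. fls_nth (A $ i $ j) (int l + 1))"

lemma exists_matrix_with_digits:
  fixes x :: "nat \<Rightarrow> 'a::zero ^ 'n ^ 'm"
  obtains A where "in_unit A" "digits A = x"
proof -
  define A where "A = (\<chi> i j. fls_shift (-1) (fps_to_fls (Abs_fps (\<lambda>l. x l $ i $ j))))"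
  have "in_unit A" by (auto simp: A_def in_unit_def)
  moreover have "digits A = x" by (rule ext) (auto simp: A_def digits_def vec_eq_iff)
  ultimately show ?thesis using that by blast
qed

lemma mat_dist_less_iff_digits:
  fixes A B :: "'a::{field,finite} fls ^ 'n ^ 'm"
  assumes "in_unit A" "in_unit B"
  shows "mat_dist A B < real CARD('a) powr (- real t) \<longleftrightarrow> map (digits A) [0..<t] = map (digits B) [0..<t]"
proof -
  have "mat_dist A B < real CARD('a) powr (- real t) \<longleftrightarrow> (\<forall>i j. \<forall>l\<le>int t. fls_nth (A $ i $ j) l = fls_nth (B $ i $ j) l)"
    using mat_lx_abs_less_iff[of "A - B" "int t"] by (simp add: mat_dist_def)
  also have "\<dots> \<longleftrightarrow> (\<forall>l<t. digits A l = digits B l)"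
  proof safe
    fix l assume "\<forall>i j. \<forall>l\<le>int t. fls_nth (A $ i $ j) l = fls_nth (B $ i $ j) l" "l < t"
    thus "digits A l = digits B l" by (simp add: digits_def vec_eq_iff)
  next
    fix i j l assume *: "\<forall>l<t. digits A l = digits B l" "l \<le> int t"
    show "fls_nth (A $ i $ j) l = fls_nth (B $ i $ j) l"
    proof (cases "l \<le> 0")
      case True
      thus ?thesis using assms by (simp add: in_unit_def)
    next
      case False
      hence "nat (l - 1) < t" using *(2) by simp
      hence "digits A (nat (l - 1)) $ i $ j = digits B (nat (l - 1)) $ i $ j" using *(1) by simp
      thus ?thesis using False by (simp add: digits_def)
    qed
  qed
  also have "\<dots> \<longleftrightarrow> map (digits A) [0..<t] = map (digits B) [0..<t]" by (auto simp: list_eq_iff_nth_eq)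
  finally show ?thesis .
qed

text \<open>In the coefficient of \<open>X^(-(v+1))\<close> of \<open>q A\<close>, the coefficient
  of \<open>X^c\<close> in \<open>q\<close> meets that of \<open>X^(-(v+1+c))\<close> in
  \<open>A\<close>, which is digit \<open>c + v\<close>. For \<open>v < r\<close> and
  \<open>c \<le> d\<close> this position is below \<open>d + r\<close>.\<close>

lemma sat_digits_iff:
  fixes A :: "'a::{field,finite} fls ^ 'n ^ 'm"
  assumes q: "exact_deg d q"
  shows "dist_polys (vecmat_lx q A) < real CARD('a) powr (- real r) \<longleftrightarrow> sat d q r (map (digits A) [0..<d + r])"
proof -
  have nth: "fls_nth (vecmat_lx q A $ j) (int v + 1) = lin_form d q (map (digits A) [0..<d + r]) v $ j" if "v < r" for v j
    using that q by (auto simp: vecmat_lx_def lin_form_def fls_nth_sum exact_deg_def poly_to_lx_times_nth[of _ d]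
        digits_def algebra_simps intro!: sum.cong)
  have "(\<forall>l. 1 \<le> l \<and> l \<le> int r \<longrightarrow> fls_nth f l = 0) \<longleftrightarrow> (\<forall>v<r. fls_nth f (int v + 1) = 0)" for f :: "'a fls"
  proof safe
    fix l :: int assume *: "\<forall>v<r. fls_nth f (int v + 1) = 0" "1 \<le> l" "l \<le> int r"
    hence "nat (l - 1) < r" by simp
    with *(1) have "fls_nth f (int (nat (l - 1)) + 1) = 0" by blast
    thus "fls_nth f l = 0" using *(2) by simp
  qed simp
  hence "dist_polys (vecmat_lx q A) < real CARD('a) powr (- real r) \<longleftrightarrow>
      (\<forall>j. \<forall>v<r. fls_nth (vecmat_lx q A $ j) (int v + 1) = 0)"
    unfolding dist_polys_less_iff by blast
  also have "\<dots> \<longleftrightarrow> (\<forall>v<r. lin_form d q (map (digits A) [0..<d + r]) v = 0)"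
    unfolding vec_eq_iff using nth by auto
  finally show ?thesis by (simp add: sat_def)
qed

text \<open>Indexed by coefficient lists because these form a countable type. Every polynomial
  matrix arises, so countably many translates of the unit ball cover the whole space.\<close>

definition poly_matrix :: "'a::zero list ^ 'n ^ 'm \<Rightarrow> 'a fls ^ 'n ^ 'm" where
  "poly_matrix L = (\<chi> i j. poly_to_lx (Poly (L $ i $ j)))"

lemma dist_polys_translate:
  fixes A :: "'a::{field,finite} fls ^ 'n ^ 'm"
  shows "dist_polys (vecmat_lx q (A - poly_matrix L)) < real CARD('a) powr (- real r) \<longleftrightarrow>
         dist_polys (vecmat_lx q A) < real CARD('a) powr (- real r)"
proof -
  have z: "fls_nth (poly_to_lx p * poly_to_lx p') l = 0" if "1 \<le> l" for p p' :: "'a poly" and l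
    using that by (subst poly_to_lx_times_nth[OF order_refl]) (auto simp: poly_to_lx_nth)
  have "fls_nth (vecmat_lx q (A - poly_matrix L) $ j) l = fls_nth (vecmat_lx q A $ j) l" if "1 \<le> l" for j l
    using z[OF that] by (simp add: vecmat_lx_def poly_matrix_def fls_nth_sum right_diff_distrib)
  thus ?thesis unfolding dist_polys_less_iff by auto
qed

lemma exists_translate_in_unit:
  fixes A :: "'a::{field,finite} fls ^ 'n ^ 'm"
  obtains L where "in_unit (A - poly_matrix L)"
proof -
  have "\<forall>i j. \<exists>p. \<forall>l\<le>0. fls_nth (poly_to_lx p) l = fls_nth (A $ i $ j) l"
    using exists_poly_part by metis
  then obtain P where P: "\<And>i j l. l \<le> 0 \<Longrightarrow> fls_nth (poly_to_lx (P i j)) l = fls_nth (A $ i $ j) l" by metis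
  have "in_unit (A - poly_matrix (\<chi> i j. coeffs (P i j)))"
    using P by (auto simp: in_unit_def poly_matrix_def)
  thus ?thesis using that by blast
qed

definition cyl :: "('a::zero ^ 'n ^ 'm) list \<Rightarrow> ('a fls ^ 'n ^ 'm) set" where
  "cyl ys = {A. in_unit A \<and> map (digits A) [0..<length ys] = ys}"

lemma diam_cyl_le: "diam_d mat_dist (cyl (ys :: ('a::{field,finite} ^ 'n ^ 'm) list)) \<le> ennreal (real CARD('a) powr (- real (length ys)))"
  unfolding diam_d_def
proof (intro SUP_least ennreal_leI)
  fix A B assume "A \<in> cyl ys" "B \<in> cyl ys"
  thus "mat_dist A B \<le> real CARD('a) powr (- real (length ys))"
    using mat_dist_less_iff_digits[of A B "length ys"] by (simp add: cyl_def)
qed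

lemma le_diam: "A \<in> U \<Longrightarrow> B \<in> U \<Longrightarrow> ennreal (d A B) \<le> diam_d d U"
  unfolding diam_d_def by (intro SUP_upper2[of A] SUP_upper2[of B]) auto

text \<open>Truncating at 0 loses nothing: the distance to the polynomial vectors is always below 1,
  so a value \<open>\<psi> q \<ge> 1\<close> imposes no condition. For \<open>\<psi> q = 0\<close>
  the number carries no meaning.\<close>

definition appr_exp :: "('a::finite poly ^ 'm \<Rightarrow> real) \<Rightarrow> 'a poly ^ 'm \<Rightarrow> nat" where
  "appr_exp \<psi> q = nat (- (SOME r. \<psi> q = real CARD('a) powi r))"

context
  fixes \<psi> :: "'a::{field,finite} poly ^ 'm \<Rightarrow> real"
  assumes psi_vals: "\<And>q. \<psi> q = 0 \<or> (\<exists>r::int. \<psi> q = real CARD('a) powi r)"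
begin

lemma psi_nonneg: "\<psi> q \<ge> 0"
  using psi_vals[of q] by auto

lemma psi_pos_cases:
  assumes "\<psi> q > 0"
  obtains r :: int where "\<psi> q = real CARD('a) powr (real_of_int r)" "appr_exp \<psi> q = nat (- r)"
proof -
  have "\<exists>r. \<psi> q = real CARD('a) powi r" using psi_vals[of q] assms by auto
  hence "\<psi> q = real CARD('a) powi (SOME r. \<psi> q = real CARD('a) powi r)" by (rule someI_ex)
  also have "\<dots> = real CARD('a) powr (real_of_int (SOME r. \<psi> q = real CARD('a) powi r))"
    using card_field_ge_2[where 'a='a] by (intro powr_real_of_int'[symmetric]) auto
  finally show ?thesis by (rule that) (simp add: appr_exp_def)
qed

lemma psi_ge:
  assumes "\<psi> q > 0" shows "real CARD('a) powr (- real (appr_exp \<psi> q)) \<le> \<psi> q"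
proof -
  obtain r where r: "\<psi> q = real CARD('a) powr (real_of_int r)" "appr_exp \<psi> q = nat (- r)"
    using psi_pos_cases[OF assms] .
  have "real CARD('a) > 1" using card_field_ge_2[where 'a='a] by simp
  thus ?thesis unfolding r by (intro powr_mono) auto
qed

text \<open>The factor \<open>B\<close> covers values above 1, where \<open>appr_exp\<close> is
  truncated to 0.\<close>

lemma psi_le:
  assumes "\<psi> q \<le> B" "B \<ge> 1" shows "\<psi> q \<le> B * real CARD('a) powr (- real (appr_exp \<psi> q))"
proof (cases "\<psi> q > 0")
  case True
  obtain r where r: "\<psi> q = real CARD('a) powr (real_of_int r)" "appr_exp \<psi> q = nat (- r)"
    using psi_pos_cases[OF True] .
  show ?thesis
  proof (cases "r \<le> 0")
    case True
    hence "- real (appr_exp \<psi> q) = real_of_int r" using r by simp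
    hence "\<psi> q = real CARD('a) powr (- real (appr_exp \<psi> q))" using r by simp
    thus ?thesis using assms(2) mult_right_mono[of 1 B "real CARD('a) powr (- real (appr_exp \<psi> q))"] by simp
  next
    case False
    thus ?thesis using assms r by simp
  qed
next
  case False
  hence "\<psi> q \<le> 0" by simp
  also have "0 \<le> B * real CARD('a) powr (- real (appr_exp \<psi> q))" using assms by simp
  finally show ?thesis .
qed

lemma dist_polys_less_psi_iff:
  fixes v :: "'a fls ^ 'n"
  shows "dist_polys v < \<psi> q \<longleftrightarrow> \<psi> q > 0 \<and> dist_polys v < real CARD('a) powr (- real (appr_exp \<psi> q))"
proof -
  have k: "real CARD('a) > 1" using card_field_ge_2[where 'a='a] by simp
  have d1: "dist_polys v < 1" using dist_polys_less_iff[of v 0] k by simp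
  have d0: "dist_polys v \<ge> 0"
    unfolding dist_polys_def
    by (rule cInf_greatest) (auto simp: vec_lx_abs_nonneg)
  show ?thesis
  proof (cases "\<psi> q > 0")
    case True
    obtain r where r: "\<psi> q = real CARD('a) powr (real_of_int r)" "appr_exp \<psi> q = nat (- r)"
      using psi_pos_cases[OF True] .
    show ?thesis
    proof (cases "r \<le> 0")
      case True
      thus ?thesis using r k by simp
    next
      case False
      have "1 \<le> \<psi> q" unfolding r using False k by (intro ge_one_powr_ge_zero) auto
      thus ?thesis using False d1 r k by simp
    qed
  qed (use d0 in auto)
qed

lemma W_set_translate: "A \<in> W_set \<psi> \<Longrightarrow> A - poly_matrix L \<in> (W_set \<psi> :: ('a fls ^ 'n ^ 'm) set)"
  unfolding W_set_def by (simp add: dist_polys_less_psi_iff dist_polys_translate)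

end

section \<open>Hausdorff measure and dimension\<close>

lemma hausdorff_measure_eq_0_iff:
  "hausdorff_measure d s S = 0 \<longleftrightarrow> (\<forall>\<delta>>0. \<forall>\<epsilon>>0. \<exists>C. S \<subseteq> (\<Union>i::nat. C i) \<and> (\<forall>i. diam_d d (C i) \<le> ennreal \<delta>) \<and>
     (\<Sum>i. ennreal (enn2real (diam_d d (C i)) powr s)) \<le> ennreal \<epsilon>)"
proof -
  have "hausdorff_pre d s \<delta> S = 0 \<longleftrightarrow> (\<forall>\<epsilon>>0. \<exists>C. S \<subseteq> (\<Union>i. C i) \<and> (\<forall>i. diam_d d (C i) \<le> ennreal \<delta>) \<and>
     (\<Sum>i. ennreal (enn2real (diam_d d (C i)) powr s)) \<le> ennreal \<epsilon>)" (is "_ \<longleftrightarrow> (\<forall>\<epsilon>>0. ?P \<epsilon>)") for \<delta>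
  proof safe
    fix \<epsilon> :: real assume "hausdorff_pre d s \<delta> S = 0" "\<epsilon> > 0"
    hence "hausdorff_pre d s \<delta> S < ennreal \<epsilon>" by simp
    then obtain C where "C \<in> {C. S \<subseteq> (\<Union>i. C i) \<and> (\<forall>i. diam_d d (C i) \<le> ennreal \<delta>)}"
      "(\<Sum>i. ennreal (enn2real (diam_d d (C i)) powr s)) < ennreal \<epsilon>"
      unfolding hausdorff_pre_def INF_less_iff by blast
    thus "?P \<epsilon>" by (intro exI[of _ C]) (simp add: less_imp_le)
  next
    assume P: "\<forall>\<epsilon>>0. ?P \<epsilon>"
    have "hausdorff_pre d s \<delta> S \<le> 0 + ennreal \<epsilon>" if e: "\<epsilon> > 0" for \<epsilon>
    proof -
      obtain C where C: "S \<subseteq> (\<Union>i. C i)" "\<forall>i. diam_d d (C i) \<le> ennreal \<delta>"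
        "(\<Sum>i. ennreal (enn2real (diam_d d (C i)) powr s)) \<le> ennreal \<epsilon>" using P[rule_format, OF e] by (elim exE conjE)
      have "hausdorff_pre d s \<delta> S \<le> (\<Sum>i. ennreal (enn2real (diam_d d (C i)) powr s))"
        unfolding hausdorff_pre_def by (rule INF_lower) (use C in blast)
      with C(3) show ?thesis by simp
    qed
    hence "hausdorff_pre d s \<delta> S \<le> 0" by (rule ennreal_le_epsilon)
    thus "hausdorff_pre d s \<delta> S = 0" by simp
  qed
  moreover have "hausdorff_measure d s S = 0 \<longleftrightarrow> (\<forall>\<delta>>0. hausdorff_pre d s \<delta> S = 0)"
    unfolding hausdorff_measure_def bot_ennreal[symmetric] SUP_bot_conv by auto
  ultimately show ?thesis by simp
qed

lemma hausdorff_measure_UN_eq_0: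
  fixes S :: "nat \<Rightarrow> 'b set"
  assumes "\<And>i. hausdorff_measure d s (S i) = 0"
  shows "hausdorff_measure d s (\<Union>i. S i) = 0"
  unfolding hausdorff_measure_eq_0_iff
proof (intro allI impI)
  fix \<delta> \<epsilon> :: real assume pos: "\<delta> > 0" "\<epsilon> > 0"
  have "\<exists>C. S i \<subseteq> (\<Union>j::nat. C j) \<and> (\<forall>j. diam_d d (C j) \<le> ennreal \<delta>) \<and>
     (\<Sum>j. ennreal (enn2real (diam_d d (C j)) powr s)) \<le> ennreal (\<epsilon> * (1 / 2) ^ Suc i)" for i
    using assms[of i] pos unfolding hausdorff_measure_eq_0_iff by simp
  then obtain C where C: "\<And>i. S i \<subseteq> (\<Union>j::nat. C i j)" "\<And>i j. diam_d d (C i j) \<le> ennreal \<delta>"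
    "\<And>i. (\<Sum>j. ennreal (enn2real (diam_d d (C i j)) powr s)) \<le> ennreal (\<epsilon> * (1 / 2) ^ Suc i)" by metis
  define C' where "C' n = C (fst (prod_decode n)) (snd (prod_decode n))" for n
  have "(\<Union>i. S i) \<subseteq> (\<Union>n. C' n)"
  proof
    fix x assume "x \<in> (\<Union>i. S i)"
    then obtain i j where "x \<in> C i j" using C(1) by blast
    hence "x \<in> C' (prod_encode (i, j))" by (simp add: C'_def)
    thus "x \<in> (\<Union>n. C' n)" by blast
  qed
  moreover have "diam_d d (C' n) \<le> ennreal \<delta>" for n using C(2) by (simp add: C'_def)
  moreover have "(\<Sum>n. ennreal (enn2real (diam_d d (C' n)) powr s)) \<le> ennreal \<epsilon>"
  proof -
    have "(\<Sum>n. (\<lambda>p. ennreal (enn2real (diam_d d (C (fst p) (snd p))) powr s)) (prod_decode n)) =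
        (\<Sum>i. \<Sum>j. ennreal (enn2real (diam_d d (C i j)) powr s))"
      by (rule suminf_ennreal_2dimen) simp
    also have "\<dots> \<le> (\<Sum>i. ennreal (\<epsilon> * (1 / 2) ^ Suc i))"
      by (intro suminf_le C summableI)
    also have "\<dots> = ennreal (\<Sum>i. \<epsilon> * (1 / 2) ^ Suc i)"
    proof (rule suminf_ennreal2)
      show "summable (\<lambda>i. \<epsilon> * (1 / 2) ^ Suc i)" using power_half_series by (intro summable_mult) (auto simp: sums_iff)
    qed (use pos in auto)
    also have "(\<Sum>i. \<epsilon> * (1 / 2) ^ Suc i) = \<epsilon>"
      using power_half_series sums_mult[OF power_half_series, of \<epsilon>] by (simp add: sums_iff)
    finally show ?thesis by (simp add: C'_def)
  qed
  ultimately show "\<exists>C. (\<Union>i. S i) \<subseteq> (\<Union>i. C i) \<and> (\<forall>i. diam_d d (C i) \<le> ennreal \<delta>) \<and>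
     (\<Sum>i. ennreal (enn2real (diam_d d (C i)) powr s)) \<le> ennreal \<epsilon>" by blast
qed

lemma hausdorff_measure_mono_0:
  assumes "hausdorff_measure d s S = 0" "S' \<subseteq> S" shows "hausdorff_measure d s S' = 0"
  using assms unfolding hausdorff_measure_eq_0_iff by (meson order_trans)

lemma hausdorff_measure_translate_0:
  fixes S :: "('a::{field,finite} fls ^ 'n ^ 'm) set"
  assumes "hausdorff_measure mat_dist s S = 0"
  shows "hausdorff_measure mat_dist s {A. A - M \<in> S} = 0"
  unfolding hausdorff_measure_eq_0_iff
proof (intro allI impI)
  fix \<delta> \<epsilon> :: real assume "\<delta> > 0" "\<epsilon> > 0"
  then obtain C where C: "S \<subseteq> (\<Union>i::nat. C i)" "\<And>i. diam_d mat_dist (C i) \<le> ennreal \<delta>"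
     "(\<Sum>i. ennreal (enn2real (diam_d mat_dist (C i)) powr s)) \<le> ennreal \<epsilon>"
    using assms unfolding hausdorff_measure_eq_0_iff by metis
  define C' where "C' i = {A. A - M \<in> C i}" for i
  have "diam_d mat_dist (C' i) = diam_d mat_dist (C i)" for i
  proof -
    have "A \<in> (\<lambda>A. A + M) ` C i" if "A - M \<in> C i" for A
      using imageI[OF that, of "\<lambda>A. A + M"] by simp
    hence "C' i = (\<lambda>A. A + M) ` C i" by (auto simp: C'_def)
    thus ?thesis by (simp add: diam_d_def mat_dist_def image_image)
  qed
  with C(2,3) have "\<forall>i. diam_d mat_dist (C' i) \<le> ennreal \<delta>"
     "(\<Sum>i. ennreal (enn2real (diam_d mat_dist (C' i)) powr s)) \<le> ennreal \<epsilon>"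
    by simp_all
  moreover have "{A. A - M \<in> S} \<subseteq> (\<Union>i. C' i)" unfolding C'_def using C(1) by blast
  ultimately show "\<exists>C. {A. A - M \<in> S} \<subseteq> (\<Union>i. C i) \<and> (\<forall>i. diam_d mat_dist (C i) \<le> ennreal \<delta>) \<and>
     (\<Sum>i. ennreal (enn2real (diam_d mat_dist (C i)) powr s)) \<le> ennreal \<epsilon>" by blast
qed

lemma hausdorff_measure_0_of_unit:
  fixes S :: "('a::{field,finite} fls ^ 'n ^ 'm) set"
  assumes "hausdorff_measure mat_dist s {A\<in>S. in_unit A} = 0"
    and "\<And>A L. A \<in> S \<Longrightarrow> A - poly_matrix L \<in> S"
  shows "hausdorff_measure mat_dist s S = 0"
proof (rule hausdorff_measure_mono_0)
  let ?S = "\<lambda>i. {A. A - poly_matrix (from_nat i) \<in> {A\<in>S. in_unit A}}"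
  show "hausdorff_measure mat_dist s (\<Union>i. ?S i) = 0"
    by (intro hausdorff_measure_UN_eq_0 hausdorff_measure_translate_0 assms(1))
  show "S \<subseteq> (\<Union>i. ?S i)"
  proof
    fix A assume "A \<in> S"
    obtain L where "in_unit (A - poly_matrix L)" by (rule exists_translate_in_unit)
    with assms(2)[OF \<open>A \<in> S\<close>, of L] have "A \<in> ?S (to_nat L)" by simp
    thus "A \<in> (\<Union>i. ?S i)" by blast
  qed
qed

text \<open>The set \<open>\<N>\<close> may be infinite; bounding its finite subsets is what the
  partial sums of the series over a cover call for.\<close>

lemma hausdorff_measure_0_of_nodes:
  fixes S :: "('a::{field,finite} fls ^ 'n ^ 'm) set"
  assumes s: "s > 0"
    and nodes: "\<And>\<epsilon> D. \<epsilon> > 0 \<Longrightarrow> \<exists>\<N>. S \<subseteq> (\<Union>ys\<in>\<N>. cyl ys) \<and> (\<forall>ys\<in>\<N>. length ys \<ge> D) \<and>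
      (\<forall>F. finite F \<longrightarrow> F \<subseteq> \<N> \<longrightarrow> (\<Sum>ys\<in>F. real CARD('a) powr (- s * real (length ys))) \<le> \<epsilon>)"
  shows "hausdorff_measure mat_dist s S = 0"
  unfolding hausdorff_measure_eq_0_iff
proof (intro allI impI)
  fix \<delta> \<epsilon> :: real assume pos: "\<delta> > 0" "\<epsilon> > 0"
  define k where "k = real CARD('a)"
  have k: "k > 1" using card_field_ge_2[where 'a='a] by (simp add: k_def)
  obtain D :: nat where D: "1 * k powr (- 1 * real D) \<le> \<delta>"
    using powr_decay[of k 1 \<delta> 1] k pos by (metis order_refl zero_le_one zero_less_one)
  obtain \<N> :: "('a ^ 'n ^ 'm) list set" where N: "S \<subseteq> (\<Union>ys\<in>\<N>. cyl ys)" "\<And>ys. ys \<in> \<N> \<Longrightarrow> length ys \<ge> D"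
      "\<And>F. finite F \<Longrightarrow> F \<subseteq> \<N> \<Longrightarrow> (\<Sum>ys\<in>F. k powr (- s * real (length ys))) \<le> \<epsilon>"
    using nodes[OF pos(2), of D] unfolding k_def by metis
  \<comment> \<open>Indices that encode no node get the empty set, of diameter 0, which adds nothing
    to the sum.\<close>
  define C where "C i = (if i \<in> to_nat ` \<N> then cyl (from_nat i :: ('a ^ 'n ^ 'm) list) else {})" for i
  have "S \<subseteq> (\<Union>i. C i)"
  proof
    fix A assume "A \<in> S"
    then obtain ys where "ys \<in> \<N>" "A \<in> cyl ys" using N(1) by blast
    hence "A \<in> C (to_nat ys)" by (simp add: C_def)
    thus "A \<in> (\<Union>i. C i)" by blast
  qed
  moreover have "diam_d mat_dist (C i) \<le> ennreal \<delta>" for i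
  proof (cases "i \<in> to_nat ` \<N>")
    case True
    then obtain ys where ys: "ys \<in> \<N>" "i = to_nat ys" by blast
    have "diam_d mat_dist (cyl ys) \<le> ennreal (k powr (- real (length ys)))"
      unfolding k_def by (rule diam_cyl_le)
    also have "\<dots> \<le> ennreal (k powr (- real D))"
      using N(2)[OF ys(1)] k by (intro ennreal_leI powr_mono) auto
    also have "\<dots> \<le> ennreal \<delta>" using D by (intro ennreal_leI) simp
    finally show ?thesis using ys by (simp add: C_def)
  qed (simp add: C_def diam_d_def)
  moreover have "(\<Sum>i. ennreal (enn2real (diam_d mat_dist (C i)) powr s)) \<le> ennreal \<epsilon>"
  proof (rule suminf_le_const[OF summableI])
    fix n
    define F where "F = {ys\<in>\<N>. to_nat ys < n}"
    have finF: "finite F"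
    proof (rule finite_imageD[where f=to_nat])
      show "finite (to_nat ` F)" by (rule finite_subset[of _ "{..<n}"]) (auto simp: F_def)
    qed (simp add: inj_on_def)
    have "(\<Sum>i<n. ennreal (enn2real (diam_d mat_dist (C i)) powr s)) = (\<Sum>i\<in>to_nat ` F. ennreal (enn2real (diam_d mat_dist (C i)) powr s))"
      by (rule sum.mono_neutral_right) (auto simp: F_def C_def diam_d_def bot_ennreal)
    also have "\<dots> = (\<Sum>ys\<in>F. ennreal (enn2real (diam_d mat_dist (C (to_nat ys))) powr s))"
      by (rule sum.reindex_cong[of to_nat]) (auto simp: inj_on_def)
    also have "\<dots> \<le> (\<Sum>ys\<in>F. ennreal (k powr (- s * real (length ys))))"
    proof (intro sum_mono ennreal_leI)
      fix ys assume "ys \<in> F"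
      hence "C (to_nat ys) = cyl ys" by (simp add: C_def F_def)
      hence "enn2real (diam_d mat_dist (C (to_nat ys))) \<le> k powr (- real (length ys))"
        using diam_cyl_le[of ys] by (simp add: k_def enn2real_leI)
      hence "enn2real (diam_d mat_dist (C (to_nat ys))) powr s \<le> (k powr (- real (length ys))) powr s"
        using s by (intro powr_mono2) auto
      thus "enn2real (diam_d mat_dist (C (to_nat ys))) powr s \<le> k powr (- s * real (length ys))"
        by (simp add: powr_powr mult_ac)
    qed
    also have "\<dots> = ennreal (\<Sum>ys\<in>F. k powr (- s * real (length ys)))"
      by (rule sum_ennreal) simp
    also have "\<dots> \<le> ennreal \<epsilon>" using finF by (intro ennreal_leI N(3)) (auto simp: F_def)
    finally show "(\<Sum>i<n. ennreal (enn2real (diam_d mat_dist (C i)) powr s)) \<le> ennreal \<epsilon>" .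
  qed
  ultimately show "\<exists>C. S \<subseteq> (\<Union>i. C i) \<and> (\<forall>i. diam_d mat_dist (C i) \<le> ennreal \<delta>) \<and>
     (\<Sum>i. ennreal (enn2real (diam_d mat_dist (C i)) powr s)) \<le> ennreal \<epsilon>" by blast
qed

section \<open>Upper bound for the dimension\<close>

lemma card_lists_length_UNIV: "card {ys :: 'v::finite list. length ys = t} = CARD('v) ^ t"
  using card_lists_length_eq[of "UNIV :: 'v set" t] by simp

lemma hausdorff_measure_above_full_dim:
  assumes s: "s > real (CARD('m) * CARD('n))"
  shows "hausdorff_measure mat_dist s (UNIV :: ('a::{field,finite} fls ^ 'n ^ 'm) set) = 0"
proof (rule hausdorff_measure_0_of_unit)
  define k where "k = real CARD('a)"
  have k: "k > 1" using card_field_ge_2[where 'a='a] by (simp add: k_def)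
  have s0: "s > 0" by (rule le_less_trans[OF _ s]) simp
  show "hausdorff_measure mat_dist s {A\<in>UNIV. in_unit (A :: 'a fls ^ 'n ^ 'm)} = 0"
  proof (rule hausdorff_measure_0_of_nodes[OF s0])
    fix \<epsilon> :: real and D :: nat assume "\<epsilon> > 0"
    then obtain D0 :: nat where D0: "\<And>d. d \<ge> D0 \<Longrightarrow> 1 * k powr (- (s - real (CARD('m) * CARD('n))) * real d) \<le> \<epsilon>"
      using powr_decay[of k "s - real (CARD('m) * CARD('n))" \<epsilon> 1] k s by auto
    define t where "t = max D D0"
    define \<N> where "\<N> = {ys :: ('a ^ 'n ^ 'm) list. length ys = t}"
    have "{A\<in>UNIV. in_unit (A :: 'a fls ^ 'n ^ 'm)} \<subseteq> (\<Union>ys\<in>\<N>. cyl ys)"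
    proof
      fix A :: "'a fls ^ 'n ^ 'm" assume "A \<in> {A\<in>UNIV. in_unit A}"
      hence "A \<in> cyl (map (digits A) [0..<t])" by (simp add: cyl_def)
      thus "A \<in> (\<Union>ys\<in>\<N>. cyl ys)" by (force simp: \<N>_def)
    qed
    moreover have "(\<Sum>ys\<in>F. k powr (- s * real (length ys))) \<le> \<epsilon>" if "F \<subseteq> \<N>" for F
    proof -
      have "(\<Sum>ys\<in>F. k powr (- s * real (length ys))) \<le> (\<Sum>ys\<in>\<N>. k powr (- s * real (length ys)))"
        unfolding \<N>_def using that finite_lists_length_eq_UNIV[of t "\<lambda>_. True"] by (intro sum_mono2) (auto simp: \<N>_def)
      also have "\<dots> = real CARD('a ^ 'n ^ 'm) ^ t * k powr (- s * real t)"
        by (simp add: \<N>_def card_lists_length_UNIV del: CARD_vec)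
      also have "\<dots> = k powr (- (s - real (CARD('m) * CARD('n))) * real t)"
        unfolding real_card_mat k_def[symmetric] by (simp add: algebra_simps flip: powr_add)
      also have "\<dots> \<le> \<epsilon>" using D0[of t] by (simp add: t_def)
      finally show ?thesis .
    qed
    ultimately show "\<exists>\<N>. {A\<in>UNIV. in_unit (A :: 'a fls ^ 'n ^ 'm)} \<subseteq> (\<Union>ys\<in>\<N>. cyl ys) \<and> (\<forall>ys\<in>\<N>. length ys \<ge> D) \<and>
      (\<forall>F. finite F \<longrightarrow> F \<subseteq> \<N> \<longrightarrow> (\<Sum>ys\<in>F. real CARD('a) powr (- s * real (length ys))) \<le> \<epsilon>)"
      by (intro exI[of _ \<N>]) (auto simp: \<N>_def t_def k_def)
  qed
qed simp

lemma sum_node_mass: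
  fixes Q :: "('a::{field,finite} poly ^ 'm) set"
  assumes Q: "finite Q" "Q \<noteq> {}" "\<And>q. q \<in> Q \<Longrightarrow> exact_deg d q"
  shows "(\<Sum>ys | length ys = t. node_mass d Q (ys :: ('a ^ 'n ^ 'm) list)) = 1"
proof (induction t)
  case 0
  have "{ys :: ('a ^ 'n ^ 'm) list. length ys = 0} = {[]}" by auto
  thus ?case using node_mass_le_degree[OF Q, of "[] :: ('a ^ 'n ^ 'm) list"] by simp
next
  case (Suc t)
  have "bij_betw (\<lambda>p. fst p @ [snd p]) ({ys :: ('a ^ 'n ^ 'm) list. length ys = t} \<times> UNIV) {ys. length ys = Suc t}"
    by (rule bij_betw_byWitness[where f'="\<lambda>ys. (butlast ys, last ys)"]) (auto simp: length_Suc_conv_rev)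
  hence "(\<Sum>ys | length ys = Suc t. node_mass d Q (ys :: ('a ^ 'n ^ 'm) list)) =
     (\<Sum>p\<in>{ys :: ('a ^ 'n ^ 'm) list. length ys = t} \<times> UNIV. node_mass d Q (fst p @ [snd p]))"
    by (rule sum.reindex_bij_betw[symmetric])
  also have "\<dots> = (\<Sum>ys | length ys = t. \<Sum>y\<in>UNIV. node_mass d Q (ys @ [y :: 'a ^ 'n ^ 'm]))"
    by (subst sum.cartesian_product) (simp add: split_beta)
  also have "\<dots> = (\<Sum>ys | length ys = t. node_mass d Q (ys :: ('a ^ 'n ^ 'm) list))"
    by (simp only: node_mass_additive[OF Q, symmetric])
  finally show ?case using Suc by simp
qed

text \<open>Read off from the total mass 1: for \<open>Q = {q}\<close> the measure has the same mass
  \<open>k ^ (n * r) / N\<close> at each of these strings and vanishes at the others of that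
  length.\<close>

lemma card_sat:
  fixes q :: "'a::{field,finite} poly ^ 'm"
  assumes q: "exact_deg d q"
  shows "real (card {ys :: ('a ^ 'n ^ 'm) list. length ys = d + r \<and> sat d q r ys}) =
    real CARD('a) powr (real (CARD('m) * CARD('n)) * real (d + r) - real CARD('n) * real r)"
proof -
  define k where "k = real CARD('a)"
  define N where "N = real CARD('a ^ 'n ^ 'm) ^ (d + r)"
  have k: "k > 1" using card_field_ge_2[where 'a='a] by (simp add: k_def)
  have N: "N > 0" unfolding N_def by (simp add: finite_UNIV_card_ge_0 del: CARD_vec)
  have fin: "finite {ys :: ('a ^ 'n ^ 'm) list. length ys = d + r}"
    using finite_lists_length_eq_UNIV[of "d + r" "\<lambda>_. True"] by simp
  have "1 = (\<Sum>ys | length ys = d + r. node_mass d {q} (ys :: ('a ^ 'n ^ 'm) list))"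
    by (rule sum_node_mass[symmetric]) (use q in auto)
  also have "\<dots> = (\<Sum>ys | length (ys :: ('a ^ 'n ^ 'm) list) = d + r. if sat d q r ys then k ^ (CARD('n) * r) / N else 0)"
  proof (rule sum.cong)
    fix ys :: "('a ^ 'n ^ 'm) list" assume "ys \<in> {ys. length ys = d + r}"
    hence len: "length ys = d + r" by simp
    have "{q' \<in> {q}. sat d q' r ys} = (if sat d q r ys then {q} else {})" by auto
    thus "node_mass d {q} ys = (if sat d q r ys then k ^ (CARD('n) * r) / N else 0)"
      unfolding node_mass_def len N_def k_def by (simp del: CARD_vec)
  qed simp
  also have "\<dots> = real (card {ys :: ('a ^ 'n ^ 'm) list. length ys = d + r \<and> sat d q r ys}) * (k ^ (CARD('n) * r) / N)"
    by (subst sum.inter_filter[OF fin, symmetric]) simp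
  finally have "real (card {ys :: ('a ^ 'n ^ 'm) list. length ys = d + r \<and> sat d q r ys}) = N / k ^ (CARD('n) * r)"
    using k N by (simp add: field_simps)
  also have "\<dots> = k powr (real (CARD('m) * CARD('n)) * real (d + r)) / k powr (real CARD('n) * real r)"
    using k unfolding N_def real_card_mat k_def[symmetric] by (simp flip: powr_realpow)
  also have "\<dots> = k powr (real (CARD('m) * CARD('n)) * real (d + r) - real CARD('n) * real r)"
    by (simp add: powr_diff)
  finally show ?thesis by (simp only: k_def)
qed

lemma summable_on_tail:
  fixes f :: "'b \<Rightarrow> real"
  assumes "f summable_on A" "\<epsilon> > 0"
  shows "\<exists>F0. finite F0 \<and> (\<forall>F. finite F \<longrightarrow> F \<subseteq> A \<longrightarrow> F \<inter> F0 = {} \<longrightarrow> sum f F \<le> \<epsilon>)"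
proof -
  obtain x where "(f has_sum x) A" using assms(1) by (auto simp: summable_on_def)
  hence "(sum f \<longlongrightarrow> x) (finite_subsets_at_top A)" by (simp add: has_sum_def)
  hence "eventually (\<lambda>F. dist (sum f F) x < \<epsilon> / 2) (finite_subsets_at_top A)"
    using assms(2) by (intro tendstoD) auto
  then obtain F0 where F0: "finite F0" "F0 \<subseteq> A" "\<forall>F. finite F \<and> F0 \<subseteq> F \<and> F \<subseteq> A \<longrightarrow> dist (sum f F) x < \<epsilon> / 2"
    unfolding eventually_finite_subsets_at_top by (elim exE conjE)
  show ?thesis
  proof (intro exI[of _ F0] conjI allI impI F0(1))
    fix F assume F: "finite F" "F \<subseteq> A" "F \<inter> F0 = {}"
    have "sum f (F \<union> F0) = sum f F + sum f F0" using F F0(1) by (intro sum.union_disjoint) auto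
    moreover have "dist (sum f (F \<union> F0)) x < \<epsilon> / 2"
      by (rule F0(3)[rule_format]) (use F F0(1,2) in auto)
    moreover have "dist (sum f F0) x < \<epsilon> / 2"
      by (rule F0(3)[rule_format]) (use F0(1,2) in auto)
    ultimately show "sum f F \<le> \<epsilon>" unfolding dist_real_def by linarith
  qed
qed

context
  fixes \<psi> :: "'a::{field,finite} poly ^ 'm \<Rightarrow> real"
  assumes psi_vals: "\<And>q. \<psi> q = 0 \<or> (\<exists>r::int. \<psi> q = real CARD('a) powi r)"
begin

text \<open>The nodes belonging to a vector of degree \<open>d\<close> with exponent
  \<open>r\<close> have total weight
  \<open>k powr (d * n) * (k powr (- (d + r))) powr \<eta>\<close>, at most its term in the series.
  A tail of the convergent series thus bounds the weight of a cover.\<close>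

lemma hausdorff_measure_W_set_eq_0:
  assumes sum: "(\<lambda>q. vec_poly_abs q ^ CARD('n::finite) * (\<psi> q / vec_poly_abs q) powr \<eta>) summable_on (UNIV - {0})"
    and \<eta>: "\<eta> > 0" and s: "s = real CARD('n) * (real CARD('m) - 1) + \<eta>"
  shows "hausdorff_measure mat_dist s (W_set \<psi> :: ('a fls ^ 'n ^ 'm) set) = 0"
proof (rule hausdorff_measure_0_of_unit)
  define k where "k = real CARD('a)"
  define n where "n = real CARD('n)"
  define rt where "rt = appr_exp \<psi>"
  define f where "f q = vec_poly_abs q ^ CARD('n) * (\<psi> q / vec_poly_abs q) powr \<eta>" for q
  have k: "k > 1" using card_field_ge_2[where 'a='a] by (simp add: k_def)
  have m1: "real CARD('m) \<ge> 1" by (simp add: Suc_leI)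
  have s0: "s > 0" unfolding s using m1 \<eta> by (intro add_nonneg_pos) auto
  define Y where "Y q = {ys :: ('a ^ 'n ^ 'm) list. length ys = vdeg q + rt q \<and> sat (vdeg q) q (rt q) ys}" for q
  have finY: "finite (Y q)" for q unfolding Y_def by (rule finite_lists_length_eq_UNIV)
  have weight: "(\<Sum>ys\<in>Y q. k powr (- s * real (length ys))) \<le> f q" if "q \<noteq> 0" "\<psi> q > 0" for q
  proof -
    define d where "d = vdeg q"
    define r where "r = rt q"
    have "(\<Sum>ys\<in>Y q. k powr (- s * real (length ys))) = (\<Sum>ys\<in>Y q. k powr (- s * real (d + r)))"
      by (rule sum.cong) (auto simp: Y_def d_def r_def)
    also have "\<dots> = real (card (Y q)) * k powr (- s * real (d + r))" by simp
    also have "real (card (Y q)) = k powr (real (CARD('m) * CARD('n)) * real (d + r) - n * real r)"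
      unfolding Y_def d_def[symmetric] r_def[symmetric] k_def n_def
      by (rule card_sat) (use exact_deg_vdeg[OF that(1)] in \<open>simp add: d_def\<close>)
    also have "k powr (real (CARD('m) * CARD('n)) * real (d + r) - n * real r) * k powr (- s * real (d + r))
       = k powr (real d * n) * (k powr (- real (d + r))) powr \<eta>"
      unfolding s n_def powr_powr by (simp add: algebra_simps flip: powr_add)
    also have "\<dots> \<le> k powr (real d * n) * (\<psi> q / vec_poly_abs q) powr \<eta>"
    proof (intro mult_left_mono powr_mono2)
      have "- real (d + r) = - real r - real d" by simp
      hence "k powr (- real (d + r)) = k powr (- real r) / k powr (real d)"
        by (simp only: powr_diff)
      also have "\<dots> \<le> \<psi> q / k powr (real d)"
        using psi_ge[of \<psi>, OF psi_vals that(2)] by (intro divide_right_mono) (auto simp: k_def r_def rt_def)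
      also have "k powr (real d) = vec_poly_abs q"
        using k that(1) by (simp add: vec_poly_abs_eq k_def d_def powr_realpow)
      finally show "k powr (- real (d + r)) \<le> \<psi> q / vec_poly_abs q" .
    qed (use \<eta> in auto)
    also have "k powr (real d * n) = vec_poly_abs q ^ CARD('n)"
      using k that(1) by (simp add: vec_poly_abs_eq k_def d_def n_def powr_realpow flip: powr_powr)
    finally show ?thesis by (simp add: f_def)
  qed
  show "hausdorff_measure mat_dist s {A\<in>(W_set \<psi> :: ('a fls ^ 'n ^ 'm) set). in_unit A} = 0"
  proof (rule hausdorff_measure_0_of_nodes[OF s0])
    fix \<epsilon> :: real and D :: nat assume "\<epsilon> > 0"
    obtain F0 where F0: "finite F0" "\<And>F. finite F \<Longrightarrow> F \<subseteq> UNIV - {0} \<Longrightarrow> F \<inter> F0 = {} \<Longrightarrow> sum f F \<le> \<epsilon>"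
      using summable_on_tail[OF sum[folded f_def] \<open>\<epsilon> > 0\<close>] by blast
    \<comment> \<open>Only finitely many vectors are discarded besides those with
      \<open>\<psi> q = 0\<close>, which never satisfy the inequality; a point of the limsup set
      therefore keeps a solution in \<open>G\<close>.\<close>
    define G where "G = {q. q \<noteq> 0 \<and> \<psi> q > 0 \<and> q \<notin> F0 \<and> vdeg q \<ge> D}"
    define \<N> where "\<N> = (\<Union>q\<in>G. Y q)"
    have "{A\<in>(W_set \<psi> :: ('a fls ^ 'n ^ 'm) set). in_unit A} \<subseteq> (\<Union>ys\<in>\<N>. cyl ys)"
    proof
      fix A assume "A \<in> {A\<in>(W_set \<psi> :: ('a fls ^ 'n ^ 'm) set). in_unit A}"
      hence A: "infinite {q. dist_polys (vecmat_lx q A) < \<psi> q}" "in_unit A" by (auto simp: W_set_def)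
      have "finite ({0} \<union> F0 \<union> {q :: 'a poly ^ 'm. vdeg q < D})" using F0(1) finite_vdeg_less by blast
      with A(1) have "infinite ({q. dist_polys (vecmat_lx q A) < \<psi> q} - ({0} \<union> F0 \<union> {q. vdeg q < D}))"
        by (rule Diff_infinite_finite[rotated])
      then obtain q where "q \<in> {q. dist_polys (vecmat_lx q A) < \<psi> q} - ({0} \<union> F0 \<union> {q. vdeg q < D})"
        using infinite_imp_nonempty by blast
      hence q: "dist_polys (vecmat_lx q A) < \<psi> q" "q \<noteq> 0" "q \<notin> F0" "vdeg q \<ge> D"
        by auto
      have "\<psi> q > 0" "dist_polys (vecmat_lx q A) < real CARD('a) powr (- real (rt q))"
        using q(1) dist_polys_less_psi_iff[of \<psi>, OF psi_vals] unfolding rt_def by blast+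
      moreover from this have "sat (vdeg q) q (rt q) (map (digits A) [0..<vdeg q + rt q])"
        using sat_digits_iff[OF exact_deg_vdeg[OF q(2)]] by blast
      ultimately have "map (digits A) [0..<vdeg q + rt q] \<in> \<N>"
        using q unfolding \<N>_def G_def Y_def by auto
      moreover have "A \<in> cyl (map (digits A) [0..<vdeg q + rt q])" using A(2) by (simp add: cyl_def)
      ultimately show "A \<in> (\<Union>ys\<in>\<N>. cyl ys)" by blast
    qed
    moreover have "(\<Sum>ys\<in>F. k powr (- s * real (length ys))) \<le> \<epsilon>" if F: "finite F" "F \<subseteq> \<N>" for F
    proof -
      \<comment> \<open>A node may belong to several \<open>Y q\<close>; selecting one splits
        \<open>F\<close> into disjoint groups.\<close>
      have "\<forall>ys\<in>F. \<exists>q. q \<in> G \<and> ys \<in> Y q" using F(2) by (auto simp: \<N>_def)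
      then obtain g where g: "\<And>ys. ys \<in> F \<Longrightarrow> g ys \<in> G \<and> ys \<in> Y (g ys)" by metis
      have "(\<Sum>ys\<in>F. k powr (- s * real (length ys))) = (\<Sum>q\<in>g ` F. \<Sum>ys | ys \<in> F \<and> g ys = q. k powr (- s * real (length ys)))"
        by (rule sum.image_gen[OF F(1)])
      also have "\<dots> \<le> (\<Sum>q\<in>g ` F. \<Sum>ys\<in>Y q. k powr (- s * real (length ys)))"
      proof (intro sum_mono sum_mono2 finY)
        show "{ys. ys \<in> F \<and> g ys = q} \<subseteq> Y q" for q using g by blast
      qed auto
      also have "\<dots> \<le> (\<Sum>q\<in>g ` F. f q)" by (intro sum_mono weight) (use g in \<open>auto simp: G_def\<close>)
      also have "\<dots> \<le> \<epsilon>" by (rule F0(2)) (use F(1) g in \<open>auto simp: G_def\<close>)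
      finally show ?thesis .
    qed
    ultimately show "\<exists>\<N>. {A\<in>(W_set \<psi> :: ('a fls ^ 'n ^ 'm) set). in_unit A} \<subseteq> (\<Union>ys\<in>\<N>. cyl ys) \<and> (\<forall>ys\<in>\<N>. length ys \<ge> D) \<and>
      (\<forall>F. finite F \<longrightarrow> F \<subseteq> \<N> \<longrightarrow> (\<Sum>ys\<in>F. real CARD('a) powr (- s * real (length ys))) \<le> \<epsilon>)"
      by (intro exI[of _ \<N>]) (auto simp: \<N>_def G_def Y_def k_def)
  qed
qed (rule W_set_translate[of \<psi>, OF psi_vals])

section \<open>Lower bound for the dimension\<close>

lemma exists_node_of_small_set:
  fixes U :: "('a fls ^ 'n ^ 'm) set"
  assumes diam: "diam_d mat_dist U \<le> ennreal (1 / (2 * real CARD('a)))" and s: "s > 0" and \<epsilon>: "\<epsilon> > 0"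
  obtains ys :: "('a ^ 'n ^ 'm) list" where "\<And>A. A \<in> U \<Longrightarrow> in_unit A \<Longrightarrow> map (digits A) [0..<length ys] = ys"
    "real CARD('a) powr (- s * real (length ys)) \<le> real CARD('a) powr s * enn2real (diam_d mat_dist U) powr s + \<epsilon>"
proof -
  define k where "k = real CARD('a)"
  have k: "k > 1" using card_field_ge_2[where 'a='a] by (simp add: k_def)
  define D where "D = enn2real (diam_d mat_dist U)"
  have "diam_d mat_dist U < top" using diam by (rule le_less_trans) simp
  hence D: "diam_d mat_dist U = ennreal D" "D \<ge> 0" by (auto simp: D_def)
  have Dle: "D \<le> 1 / (2 * k)" using diam k unfolding D k_def by (subst (asm) ennreal_le_iff) auto
  \<comment> \<open>For \<open>D > 0\<close> the depth satisfies
    \<open>k powr (- (t + 1)) \<le> D < k powr (- t)\<close>, at the cost of the factor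
    \<open>k powr s\<close>. For \<open>D = 0\<close> no node has weight 0, which is what the
    summand \<open>\<epsilon>\<close> is for.\<close>
  have "\<exists>t::nat. D < k powr (- real t) \<and> k powr (- s * real t) \<le> k powr s * D powr s + \<epsilon>"
  proof (cases "D = 0")
    case True
    obtain t :: nat where "1 * k powr (- s * real t) \<le> \<epsilon>"
      using powr_decay[of k s \<epsilon> 1] k s \<epsilon> by (metis order_refl zero_le_one)
    thus ?thesis using True k by (intro exI[of _ t]) auto
  next
    case False
    hence D0: "D > 0" using D by simp
    define y where "y = - log k D"
    have Dy: "D = k powr (- y)" using D0 k by (simp add: y_def)
    have "k powr (- y) < k powr (- 1)"
      unfolding Dy[symmetric] using Dle k by (simp add: powr_minus field_simps)
    hence "- y < - 1" using powr_less_cancel_iff[OF k] by blast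
    hence y1: "y > 1" by simp
    \<comment> \<open>As \<open>y > 1\<close>, nothing is truncated by \<open>nat\<close>; taking
      \<open>\<lceil>y\<rceil> - 1\<close> instead of the floor keeps \<open>t < y\<close> strict
      for integral \<open>y\<close>.\<close>
    define t where "t = nat (\<lceil>y\<rceil> - 1)"
    have t: "real t < y" "y \<le> real t + 1" using y1 unfolding t_def by linarith+
    have "D < k powr (- real t)" unfolding Dy using k t by simp
    moreover have "k powr (- s * real t) \<le> k powr s * D powr s + \<epsilon>"
    proof -
      have "k powr (- s * real t) \<le> k powr (s + - y * s)"
      proof (rule powr_mono)
        have "y * s \<le> (real t + 1) * s" using s t(2) by (intro mult_right_mono) auto
        thus "- s * real t \<le> s + - y * s" by (simp add: algebra_simps)
      qed (use k in simp)
      also have "\<dots> = k powr s * D powr s" unfolding Dy powr_powr by (rule powr_add)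
      finally show ?thesis using \<epsilon> by simp
    qed
    ultimately show ?thesis by blast
  qed
  then obtain t :: nat where t: "D < k powr (- real t)" "k powr (- s * real t) \<le> k powr s * D powr s + \<epsilon>" by blast
  show ?thesis
  proof (cases "\<exists>A. A \<in> U \<and> in_unit A")
    case True
    then obtain A0 where A0: "A0 \<in> U" "in_unit A0" by blast
    show ?thesis
    proof (rule that[of "map (digits A0) [0..<t]"])
      fix A assume A: "A \<in> U" "in_unit A"
      have "ennreal (mat_dist A A0) \<le> ennreal D" unfolding D(1)[symmetric] by (rule le_diam) (use A A0 in auto)
      hence "mat_dist A A0 \<le> D" using D(2) by simp
      hence "mat_dist A A0 < real CARD('a) powr (- real t)" using t(1) by (simp add: k_def)
      thus "map (digits A) [0..<length (map (digits A0) [0..<t])] = map (digits A0) [0..<t]"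
        using mat_dist_less_iff_digits[OF A(2) A0(2)] by simp
    qed (use t in \<open>simp add: k_def D_def\<close>)
  next
    case False
    \<comment> \<open>There is no point of the unit ball to capture, so any node of depth
      \<open>t\<close> serves.\<close>
    show ?thesis by (rule that[of "replicate t 0"]) (use False t in \<open>auto simp: k_def D_def\<close>)
  qed
qed

text \<open>Small energies are obtained only for exponents other than \<open>n * (m - 1)\<close>, so
  the energy is allowed a larger exponent \<open>s'\<close>. Node weights decrease as the exponent
  grows, so a cover that is cheap for \<open>s\<close> is cheap for \<open>s'\<close>.\<close>

lemma hausdorff_measure_W_set_neq_0:
  assumes s: "0 < s" "s \<le> s'" "s' \<le> real (CARD('m) * CARD('n::finite))"
    and energy: "\<And>\<epsilon> D. \<epsilon> > 0 \<Longrightarrow> \<exists>d\<ge>D. \<exists>r Q. finite Q \<and> Q \<noteq> {} \<and>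
        (\<forall>q\<in>Q. exact_deg d q \<and> appr_exp \<psi> q = r \<and> \<psi> q > 0) \<and> energy TYPE('n) s' d r Q \<le> \<epsilon>"
  shows "hausdorff_measure mat_dist s (W_set \<psi> :: ('a fls ^ 'n ^ 'm) set) \<noteq> 0"
proof
  assume zero: "hausdorff_measure mat_dist s (W_set \<psi> :: ('a fls ^ 'n ^ 'm) set) = 0"
  define k where "k = real CARD('a)"
  have k: "k > 1" using card_field_ge_2[where 'a='a] by (simp add: k_def)
  \<comment> \<open>Passing to nodes multiplies the mass by \<open>k powr s\<close> and adds terms
    of sum \<open>1 / 8\<close>, giving at most \<open>1 / 4\<close>, below the permitted
    \<open>1 / 2\<close>.\<close>
  define \<epsilon> where "\<epsilon> = 1 / (8 * k powr s)"
  have \<epsilon>: "\<epsilon> > 0" and k2: "1 / (2 * k) > 0" using k by (simp_all add: \<epsilon>_def)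
  obtain C where C: "(W_set \<psi> :: ('a fls ^ 'n ^ 'm) set) \<subseteq> (\<Union>i::nat. C i)"
    "\<forall>i. diam_d mat_dist (C i) \<le> ennreal (1 / (2 * k))"
    "(\<Sum>i. ennreal (enn2real (diam_d mat_dist (C i)) powr s)) \<le> ennreal \<epsilon>"
    using zero[unfolded hausdorff_measure_eq_0_iff, THEN spec, THEN mp, OF k2, THEN spec, THEN mp, OF \<epsilon>]
    by (elim exE conjE)
  have "\<forall>i. \<exists>ys :: ('a ^ 'n ^ 'm) list. (\<forall>A\<in>C i. in_unit A \<longrightarrow> map (digits A) [0..<length ys] = ys) \<and>
    k powr (- s * real (length ys)) \<le> k powr s * enn2real (diam_d mat_dist (C i)) powr s + 1 / 8 * (1 / 2) ^ Suc i"
  proof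
    fix i
    have "(1 / 8 * (1 / 2) ^ Suc i :: real) > 0" by simp
    from exists_node_of_small_set[OF C(2)[rule_format, of i, unfolded k_def] s(1) this]
    show "\<exists>ys :: ('a ^ 'n ^ 'm) list. (\<forall>A\<in>C i. in_unit A \<longrightarrow> map (digits A) [0..<length ys] = ys) \<and>
      k powr (- s * real (length ys)) \<le> k powr s * enn2real (diam_d mat_dist (C i)) powr s + 1 / 8 * (1 / 2) ^ Suc i"
      unfolding k_def by metis
  qed
  then obtain N :: "nat \<Rightarrow> ('a ^ 'n ^ 'm) list" where
    N: "\<And>i A. A \<in> C i \<Longrightarrow> in_unit A \<Longrightarrow> map (digits A) [0..<length (N i)] = N i"
      "\<And>i. k powr (- s * real (length (N i))) \<le> k powr s * enn2real (diam_d mat_dist (C i)) powr s + 1 / 8 * (1 / 2) ^ Suc i"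
    by metis
  have "(\<Sum>i. ennreal (enn2real (diam_d mat_dist (C i)) powr s)) \<noteq> top"
    using C(3) by (metis ennreal_less_top leD)
  hence summ: "summable (\<lambda>i. enn2real (diam_d mat_dist (C i)) powr s)"
    and "(\<Sum>i. ennreal (enn2real (diam_d mat_dist (C i)) powr s)) = ennreal (\<Sum>i. enn2real (diam_d mat_dist (C i)) powr s)"
    by (auto intro!: summable_suminf_not_top)
  with C(3) have le: "(\<Sum>i. enn2real (diam_d mat_dist (C i)) powr s) \<le> \<epsilon>" using \<epsilon> by simp
  have half: "summable (\<lambda>i. 1 / 8 * (1 / 2 :: real) ^ Suc i)" "(\<Sum>i. 1 / 8 * (1 / 2 :: real) ^ Suc i) = 1 / 8"
    using sums_mult[OF power_half_series, of "1 / 8"] by (auto simp: sums_iff)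
  define b where "b i = k powr s * enn2real (diam_d mat_dist (C i)) powr s + 1 / 8 * (1 / 2) ^ Suc i" for i
  have b: "summable b" unfolding b_def by (intro summable_add summable_mult summ half)
  have "suminf b = k powr s * (\<Sum>i. enn2real (diam_d mat_dist (C i)) powr s) + 1 / 8"
    unfolding b_def using half summ by (subst suminf_add[symmetric]) (auto simp: suminf_mult intro!: summable_mult)
  also have "\<dots> \<le> k powr s * \<epsilon> + 1 / 8" using le k by simp
  also have "\<dots> < 1 / 2" using k by (simp add: \<epsilon>_def)
  finally have b_less: "suminf b < 1 / 2" .
  have wb: "k powr (- s' * real (length (N i))) \<le> b i" for i
  proof -
    have "k powr (- s' * real (length (N i))) \<le> k powr (- s * real (length (N i)))"
      using s k by (intro powr_mono) (auto intro: mult_right_mono)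
    thus ?thesis using N(2)[of i] by (simp add: b_def)
  qed
  have wsum: "summable (\<lambda>i. k powr (- s' * real (length (N i))))"
    by (rule summable_comparison_test'[OF b, of 0]) (use wb in simp)
  have "(\<Sum>i. k powr (- s' * real (length (N i)))) \<le> suminf b"
    by (rule suminf_le[OF wb wsum b])
  hence "(\<Sum>i. k powr (- s' * real (length (N i)))) < 1 / 2" using b_less by simp
  with exists_point_in_limsup_avoiding_cover[of s' "\<lambda>r q. appr_exp \<psi> q = r \<and> \<psi> q > 0" N] s energy wsum
  obtain x where x: "\<And>i. map x [0..<length (N i)] \<noteq> N i"
    "\<And>D. \<exists>d\<ge>D. \<exists>q r. exact_deg d q \<and> (appr_exp \<psi> q = r \<and> \<psi> q > 0) \<and> sat d q r (map x [0..<d + r])"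
    unfolding k_def by force
  obtain A where A: "in_unit A" "digits A = x" by (rule exists_matrix_with_digits)
  have "infinite {q. dist_polys (vecmat_lx q A) < \<psi> q}"
  proof
    assume fin: "finite {q. dist_polys (vecmat_lx q A) < \<psi> q}"
    \<comment> \<open>A degree exceeding that of every solution, were there only finitely
      many.\<close>
    define D where "D = Suc (Max (insert 0 (vdeg ` {q. dist_polys (vecmat_lx q A) < \<psi> q})))"
    obtain d q where q: "d \<ge> D" "exact_deg d q" "\<psi> q > 0" "sat d q (appr_exp \<psi> q) (map x [0..<d + appr_exp \<psi> q])"
      using x(2)[of D] by blast
    have "dist_polys (vecmat_lx q A) < \<psi> q"
      using q(3,4) sat_digits_iff[OF q(2), of A "appr_exp \<psi> q"] dist_polys_less_psi_iff[of \<psi>, OF psi_vals] A(2) by blast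
    hence "vdeg q \<le> Max (insert 0 (vdeg ` {q. dist_polys (vecmat_lx q A) < \<psi> q}))"
      using fin by (intro Max_ge) auto
    thus False using exact_deg_unique[OF q(2)] q(1) by (simp add: D_def)
  qed
  hence "A \<in> W_set \<psi>" by (simp add: W_set_def)
  then obtain i where "A \<in> C i" using C(1) by blast
  with N(1)[of A i] A x(1)[of i] show False by simp
qed

text \<open>For large \<open>q\<close> the base \<open>\<psi> q / vec_poly_abs q\<close> is at most
  1, so with \<open>\<eta> \<le> 0\<close> each of the infinitely many terms with
  \<open>\<psi> q > 0\<close> is at least 1.\<close>

lemma summable_exponent_pos:
  assumes bounded: "\<And>q. \<psi> q \<le> B" and inf_pos: "infinite {q. \<psi> q > 0}"
    and sum: "(\<lambda>q. vec_poly_abs q ^ n * (\<psi> q / vec_poly_abs q) powr \<eta>) summable_on (UNIV - {0})"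
  shows "\<eta> > 0"
proof (rule ccontr)
  assume neg: "\<not> \<eta> > 0"
  define k where "k = real CARD('a)"
  have k: "k > 1" using card_field_ge_2[where 'a='a] by (simp add: k_def)
  obtain D :: nat where D: "max B 1 < k ^ D" using real_arch_pow[OF k] by blast
  define f where "f q = vec_poly_abs q ^ n * (\<psi> q / vec_poly_abs q) powr \<eta>" for q
  define X where "X = {q. \<psi> q > 0} - ({0} \<union> {q. vdeg q < D})"
  have "infinite X" unfolding X_def by (rule Diff_infinite_finite[OF _ inf_pos]) (simp add: finite_vdeg_less)
  have f1: "f q \<ge> 1" if "q \<in> X" for q
  proof -
    have q: "q \<noteq> 0" "\<psi> q > 0" "vdeg q \<ge> D" using that by (auto simp: X_def)
    have "k ^ D \<le> k ^ vdeg q" using k q by (intro power_increasing) auto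
    hence v: "vec_poly_abs q \<ge> max B 1" using D q by (simp add: vec_poly_abs_eq k_def)
    have "0 < \<psi> q / vec_poly_abs q" "\<psi> q / vec_poly_abs q \<le> 1" using v q bounded[of q] by auto
    hence "1 \<le> (\<psi> q / vec_poly_abs q) powr \<eta>" using neg powr_mono2'[of "\<eta>" "\<psi> q / vec_poly_abs q" 1] by simp
    moreover have "1 \<le> vec_poly_abs q ^ n" using v by simp
    ultimately show ?thesis unfolding f_def using mult_mono[of 1 "vec_poly_abs q ^ n" 1 "(\<psi> q / vec_poly_abs q) powr \<eta>"] by simp
  qed
  have f0: "f q \<ge> 0" for q
  proof (cases "q = 0")
    case True
    have "vec_poly_abs (0 :: 'a poly ^ 'm) = 0" by (simp add: vec_poly_abs_def poly_abs_def)
    thus ?thesis using True by (simp add: f_def)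
  qed (simp add: f_def vec_poly_abs_eq)
  obtain F where F: "finite F" "F \<subseteq> X" "card F = nat \<lceil>infsum f (UNIV - {0})\<rceil> + 1"
    using infinite_arbitrarily_large[OF \<open>infinite X\<close>] by blast
  have "real (card F) = (\<Sum>q\<in>F. 1)" by simp
  also have "\<dots> \<le> sum f F" using F f1 by (intro sum_mono) auto
  also have "\<dots> \<le> infsum f (UNIV - {0})"
    by (rule finite_sum_le_infsum) (use sum F f0 in \<open>auto simp: f_def[abs_def] X_def\<close>)
  finally show False using F(3) by linarith
qed

text \<open>At most \<open>k ^ (m * (d + 1))\<close> vectors have degree \<open>d\<close>, and their
  terms are at most a constant times \<open>k powr ((n - \<eta>) * d)\<close>;
  \<open>\<eta> = n + m + 1\<close> leaves a geometric series of ratio \<open>1 / k\<close>.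
  Together with positivity this makes the \<open>Inf\<close> in \<open>eta_psi\<close> a genuine
  infimum.\<close>

lemma summable_exponent_exists:
  assumes bounded: "\<And>q. \<psi> q \<le> B"
  shows "\<exists>\<eta>. (\<lambda>q. vec_poly_abs q ^ n * (\<psi> q / vec_poly_abs q) powr \<eta>) summable_on (UNIV - {0})"
proof -
  define k where "k = real CARD('a)"
  have k: "k > 1" using card_field_ge_2[where 'a='a] by (simp add: k_def)
  define m where "m = CARD('m)"
  define \<eta> where "\<eta> = real (n + m + 1)"
  define B' where "B' = max B 0"
  define f where "f q = vec_poly_abs q ^ n * (\<psi> q / vec_poly_abs q) powr \<eta>" for q
  have psi0: "\<psi> q \<ge> 0" for q by (rule psi_nonneg[of \<psi>, OF psi_vals])
  have fle: "f q \<le> B' powr \<eta> * (k powr (- real m - 1)) ^ vdeg q" if "q \<noteq> 0" for q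
  proof -
    have v: "vec_poly_abs q = k powr real (vdeg q)" using k that by (simp add: vec_poly_abs_eq k_def powr_realpow)
    have "(\<psi> q / vec_poly_abs q) powr \<eta> \<le> (B' * k powr (- real (vdeg q))) powr \<eta>"
      unfolding v using bounded[of q] psi0[of q] k
      by (intro powr_mono2) (auto simp: \<eta>_def B'_def powr_minus divide_inverse intro!: mult_right_mono)
    also have "\<dots> = B' powr \<eta> * k powr (- real (vdeg q) * \<eta>)"
      by (simp add: B'_def powr_mult powr_powr)
    finally have "f q \<le> vec_poly_abs q ^ n * (B' powr \<eta> * k powr (- real (vdeg q) * \<eta>))"
      unfolding f_def v by (intro mult_left_mono) auto
    also have "vec_poly_abs q ^ n = k powr (real (vdeg q) * real n)"
      unfolding v using k by (simp add: powr_powr flip: powr_realpow)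
    also have "k powr (real (vdeg q) * real n) * (B' powr \<eta> * k powr (- real (vdeg q) * \<eta>))
       = B' powr \<eta> * k powr ((- real m - 1) * real (vdeg q))"
    proof -
      have "real (vdeg q) * real n + - real (vdeg q) * \<eta> = (- real m - 1) * real (vdeg q)"
        by (simp add: \<eta>_def algebra_simps)
      hence "k powr (real (vdeg q) * real n) * k powr (- real (vdeg q) * \<eta>) = k powr ((- real m - 1) * real (vdeg q))"
        by (simp only: powr_add[symmetric])
      thus ?thesis by (simp only: mult.left_commute)
    qed
    also have "k powr ((- real m - 1) * real (vdeg q)) = (k powr (- real m - 1)) ^ vdeg q"
      using k by (simp add: powr_powr flip: powr_realpow)
    finally show ?thesis .
  qed
  have card_le: "real (card {q :: 'a poly ^ 'm. vdeg q = d}) \<le> k ^ m * (k ^ m) ^ d" for d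
  proof -
    have "{q :: 'a poly ^ 'm. vdeg q = d} \<subseteq> {q. \<forall>i. q $ i \<in> polys_below (Suc d)}"
      using degree_le_vdeg by (auto simp: polys_below_iff)
    hence "card {q :: 'a poly ^ 'm. vdeg q = d} \<le> card {q :: 'a poly ^ 'm. \<forall>i. q $ i \<in> polys_below (Suc d)}"
      by (intro card_mono finite_vec_components card_polys_below)
    also have "\<dots> = (CARD('a) ^ Suc d) ^ m" by (simp add: card_vec_components card_polys_below m_def)
    finally have "real (card {q :: 'a poly ^ 'm. vdeg q = d}) \<le> real ((CARD('a) ^ Suc d) ^ m)" by (simp only: of_nat_le_iff)
    also have "\<dots> = k ^ m * (k ^ m) ^ d" by (simp add: k_def power_mult_distrib mult.commute flip: power_mult)
    finally show ?thesis .
  qed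
  have f0: "f q \<ge> 0" if "q \<noteq> 0" for q using that by (simp add: f_def vec_poly_abs_eq)
  have "bdd_above (sum f ` {F. F \<subseteq> UNIV - {0} \<and> finite F})"
  proof (rule bdd_aboveI2)
    fix F :: "('a poly ^ 'm) set" assume "F \<in> {F. F \<subseteq> UNIV - {0} \<and> finite F}"
    hence F: "finite F" "0 \<notin> F" by auto
    define R where "R = Max (insert 0 (vdeg ` F))"
    have R: "vdeg q \<le> R" if "q \<in> F" for q unfolding R_def using F that by (intro Max_ge) auto
    have "sum f F = (\<Sum>d\<le>R. sum f {q\<in>F. vdeg q = d})"
      by (rule sum.group[symmetric]) (use F R in auto)
    also have "\<dots> \<le> (\<Sum>d\<le>R. k ^ m * B' powr \<eta> * (1 / k) ^ d)"
    proof (rule sum_mono)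
      fix d
      have "sum f {q\<in>F. vdeg q = d} \<le> (\<Sum>q\<in>{q\<in>F. vdeg q = d}. B' powr \<eta> * (k powr (- real m - 1)) ^ d)"
        using fle F by (intro sum_mono) (metis (mono_tags, lifting) mem_Collect_eq)
      also have "\<dots> = real (card {q\<in>F. vdeg q = d}) * (B' powr \<eta> * (k powr (- real m - 1)) ^ d)" by simp
      also have "\<dots> \<le> (k ^ m * (k ^ m) ^ d) * (B' powr \<eta> * (k powr (- real m - 1)) ^ d)"
      proof (rule mult_right_mono)
        have "card {q\<in>F. vdeg q = d} \<le> card {q :: 'a poly ^ 'm. vdeg q = d}"
          by (intro card_mono finite_subset[OF _ finite_vdeg_less[of "Suc d"]]) auto
        thus "real (card {q\<in>F. vdeg q = d}) \<le> k ^ m * (k ^ m) ^ d" using card_le[of d] by linarith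
      qed simp
      also have "\<dots> = k ^ m * B' powr \<eta> * (k ^ m * k powr (- real m - 1)) ^ d"
        by (simp add: power_mult_distrib)
      also have "k ^ m * k powr (- real m - 1) = 1 / k"
        using k by (simp add: powr_minus_divide powr_diff flip: powr_realpow)
      finally show "sum f {q\<in>F. vdeg q = d} \<le> k ^ m * B' powr \<eta> * (1 / k) ^ d" .
    qed
    also have "\<dots> = k ^ m * B' powr \<eta> * (\<Sum>d\<le>R. (1 / k) ^ d)" by (simp add: sum_distrib_left)
    also have "\<dots> \<le> k ^ m * B' powr \<eta> * (1 / (1 - 1 / k))"
      using k by (intro mult_left_mono geometric_sum_le) auto
    finally show "sum f F \<le> k ^ m * B' powr \<eta> * (1 / (1 - 1 / k))" .
  qed
  hence "f summable_on (UNIV - {0})" using f0 by (intro nonneg_bdd_above_summable_on) auto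
  thus ?thesis unfolding f_def[abs_def] by blast
qed

end

theorem theorem2:
  fixes \<psi> :: "'a::{field,finite} poly ^ 'm \<Rightarrow> real"
  assumes psi_vals: "\<And>q. \<psi> q = 0 \<or> (\<exists>r::int. \<psi> q = real CARD('a) powi r)"
    and bounded: "\<exists>B. \<forall>q. \<psi> q \<le> B"
    and inf_pos: "infinite {q. \<psi> q > 0}"
  shows "hausdorff_dim mat_dist (W_set \<psi> :: ('a fls ^ 'n ^ 'm) set)
         = ereal (real CARD('n) * (real CARD('m) - 1) + min (eta_psi \<psi> CARD('n)) (real CARD('n)))"
proof -
  define n where "n = real CARD('n)"
  define m where "m = real CARD('m)"
  have n1: "n \<ge> 1" and m1: "m \<ge> 1" by (simp_all add: n_def m_def Suc_leI)
  have mn: "real (CARD('m) * CARD('n)) = n * (m - 1) + n" by (simp add: n_def m_def algebra_simps)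
  let ?W = "W_set \<psi> :: ('a fls ^ 'n ^ 'm) set"
  define X where "X = {\<eta>::real. (\<lambda>q. vec_poly_abs q ^ CARD('n) * (\<psi> q / vec_poly_abs q) powr \<eta>) summable_on (UNIV - {0})}"
  have eta: "eta_psi \<psi> CARD('n) = Inf X" by (simp add: eta_psi_def X_def)
  obtain B0 where B0: "\<And>q. \<psi> q \<le> B0" using bounded by blast
  define B where "B = max B0 1"
  have B: "\<And>q. \<psi> q \<le> B" "B \<ge> 1" using B0 by (auto simp: B_def le_max_iff_disj)
  have Xpos: "\<eta> > 0" if "\<eta> \<in> X" for \<eta>
    using summable_exponent_pos[of \<psi>, OF psi_vals B(1) inf_pos] that by (simp add: X_def)
  have Xne: "X \<noteq> {}" using summable_exponent_exists[of \<psi>, OF psi_vals B(1)] by (auto simp: X_def)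
  have Xbdd: "bdd_below X" using Xpos by (intro bdd_belowI[of _ 0]) (auto intro: less_imp_le)
  define \<tau> where "\<tau> = n * (m - 1) + min (Inf X) n"
  have lower: "\<tau> \<le> s" if s: "s > 0" "hausdorff_measure mat_dist s ?W = 0" for s
  proof (rule ccontr)
    assume "\<not> \<tau> \<le> s"
    hence s\<tau>: "s < \<tau>" by simp
    show False
    \<comment> \<open>Below \<open>n * (m - 1)\<close> single vectors suffice; the argument from the
      divergent series needs a positive excess \<open>\<eta>\<close> over this value.\<close>
    proof (cases "s < n * (m - 1)")
      case True
      have "hausdorff_measure mat_dist s ?W \<noteq> 0"
      proof (rule hausdorff_measure_W_set_neq_0[of \<psi>, OF psi_vals s(1) order_refl])
        show "s \<le> real (CARD('m) * CARD('n))" unfolding mn using True n1 by simp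
        fix \<epsilon> :: real and D :: nat assume "\<epsilon> > 0"
        then obtain d q where "d \<ge> D" "\<psi> q > 0" "exact_deg d q" "energy TYPE('n) s d (appr_exp \<psi> q) {q} \<le> \<epsilon>"
          using energy_small_singleton[OF inf_pos True[unfolded n_def m_def], of \<epsilon> D "appr_exp \<psi>"] by blast
        thus "\<exists>d\<ge>D. \<exists>r Q. finite Q \<and> Q \<noteq> {} \<and> (\<forall>q\<in>Q. exact_deg d q \<and> appr_exp \<psi> q = r \<and> \<psi> q > 0) \<and> energy TYPE('n) s d r Q \<le> \<epsilon>"
          by (intro exI[of _ d] conjI exI[of _ "appr_exp \<psi> q"] exI[of _ "{q}"]) auto
      qed
      thus False using s(2) by simp
    next
      case False
      \<comment> \<open>Strictly above \<open>s\<close>, so that \<open>\<eta>\<close> is positive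
        even when \<open>s = n * (m - 1)\<close>.\<close>
      obtain s' where s': "s < s'" "s' < \<tau>" using dense[OF s\<tau>] by blast
      define \<eta> where "\<eta> = s' - n * (m - 1)"
      have \<eta>: "0 < \<eta>" "\<eta> < Inf X" "\<eta> < n" using s' False by (auto simp: \<eta>_def \<tau>_def)
      \<comment> \<open>The series still diverges at \<open>\<eta>2\<close>, and its gap to
        \<open>\<eta>\<close> leaves room for the divisor bound.\<close>
      obtain \<eta>2 where \<eta>2: "\<eta> < \<eta>2" "\<eta>2 < Inf X" using dense[OF \<eta>(2)] by blast
      have "\<eta>2 \<notin> X" using \<eta>2(2) cInf_lower[OF _ Xbdd] by (meson not_le)
      hence div: "\<not> (\<lambda>q. vec_poly_abs q ^ CARD('n) * (\<psi> q / vec_poly_abs q) powr \<eta>2) summable_on (UNIV - {0})"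
        by (simp add: X_def)
      have s'eq: "s' = real (CARD('m) * CARD('n)) - (real CARD('n) - \<eta>)"
        unfolding mn by (simp add: \<eta>_def n_def)
      have "hausdorff_measure mat_dist s ?W \<noteq> 0"
      proof (rule hausdorff_measure_W_set_neq_0[of \<psi>, OF psi_vals s(1) less_imp_le[OF s'(1)]])
        show "s' \<le> real (CARD('m) * CARD('n))" unfolding mn using \<eta> by (simp add: \<eta>_def)
        fix \<epsilon> :: real and D :: nat assume \<epsilon>: "\<epsilon> > 0"
        show "\<exists>d\<ge>D. \<exists>r Q. finite Q \<and> Q \<noteq> {} \<and> (\<forall>q\<in>Q. exact_deg d q \<and> appr_exp \<psi> q = r \<and> \<psi> q > 0) \<and> energy TYPE('n) s' d r Q \<le> \<epsilon>"
        proof (rule energy_small_of_divergent_sum[OF _ _ _ \<eta>(1) \<eta>2(1) \<eta>(3)[unfolded n_def] s'eq div \<epsilon>])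
          show "\<psi> q \<ge> 0" for q by (rule psi_nonneg[of \<psi>, OF psi_vals])
          show "\<psi> q \<le> B * real CARD('a) powr (- real (appr_exp \<psi> q))" for q
            by (rule psi_le[of \<psi>, OF psi_vals B])
          show "B > 0" using B(2) by simp
        qed
      qed
      thus False using s(2) by simp
    qed
  qed
  let ?Z = "{s. 0 < s \<and> hausdorff_measure mat_dist s ?W = 0}"
  have upper: "Inf (ereal ` ?Z) \<le> ereal y" if y: "\<tau> < y" for y
  \<comment> \<open>If the minimum is \<open>Inf X\<close>, the natural cover is efficient;
    otherwise \<open>\<tau>\<close> is the full dimension \<open>m * n\<close>, and every exponent
    above it gives measure zero.\<close>
  proof (cases "Inf X \<le> n")
    case True
    hence "Inf X < y - n * (m - 1)" using y by (simp add: \<tau>_def)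
    then obtain \<eta> where \<eta>: "\<eta> \<in> X" "\<eta> < y - n * (m - 1)" using cInf_lessD[OF Xne] by blast
    have "hausdorff_measure mat_dist (n * (m - 1) + \<eta>) ?W = 0"
      unfolding n_def m_def by (rule hausdorff_measure_W_set_eq_0[of \<psi>, OF psi_vals _ Xpos[OF \<eta>(1)] refl]) (use \<eta>(1) in \<open>simp add: X_def\<close>)
    moreover have "n * (m - 1) + \<eta> > 0" using Xpos[OF \<eta>(1)] n1 m1 by (intro add_nonneg_pos) auto
    ultimately have "Inf (ereal ` ?Z) \<le> ereal (n * (m - 1) + \<eta>)" by (intro Inf_lower) auto
    also have "\<dots> \<le> ereal y" using \<eta>(2) by simp
    finally show ?thesis .
  next
    case False
    hence "y > real (CARD('m) * CARD('n))" unfolding mn using y by (simp add: \<tau>_def)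
    hence "hausdorff_measure mat_dist y ?W = 0" "y > 0"
      using hausdorff_measure_mono_0[OF hausdorff_measure_above_full_dim] by (auto intro: le_less_trans[rotated])
    thus ?thesis by (intro Inf_lower) auto
  qed
  have "hausdorff_dim mat_dist ?W = ereal \<tau>"
    unfolding hausdorff_dim_def
  proof (rule antisym)
    show "Inf (ereal ` ?Z) \<le> ereal \<tau>"
    proof (rule ccontr)
      assume "\<not> ?thesis"
      hence "ereal \<tau> < Inf (ereal ` ?Z)" by simp
      then obtain y where y: "ereal \<tau> < ereal y" "ereal y < Inf (ereal ` ?Z)" using ereal_dense2 by blast
      with upper[of y] show False by simp
    qed
    show "ereal \<tau> \<le> Inf (ereal ` ?Z)" using lower by (intro Inf_greatest) auto
  qed
  thus ?thesis by (simp add: \<tau>_def eta n_def m_def)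
qed

end
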